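(* (a) Let $E=\mathbb{R}^d$. Every generalized Mehler semigroup $(\mathcal{T}_t,t\ge 0)$, $(\mathcal{T}_t f)(x)=\int_E f(T_t x+y)\,\rho_t(dy)$, on $C_b(E)$ with $t\mapsto\rho_t$ continuous at zero is of the form $$(\mathcal{T}_t f)(x)=\mathbf{E}\Big[f\Big(T_t x+\int_{(0,t]}T_{t-s}\,dY(s)\Big)\Big],\qquad f\in C_b(E),\ x\in E,\ t\ge 0, \qquad (\star)$$ for some $E$-valued Lévy process $(Y(t),t\ge 0)$. (b) Let $E$ be an arbitrary real separable Banach space and let $T_t=\exp(tQ)$, $t\ge 0$, be a uniformly continuous semigroup, where $Q$ is a bounded linear operator on $E$. Every generalized Mehler semigroup $(\mathcal{T}_tf)(x)=\int_E f(T_tx+y)\,\rho_t(dy)$ associated with $(T_t)$ and with $t\mapsto\rho_t$ continuous at zero is of the form $(\star)$ for some $E$-valued Lévy process $(Y(t),t\ge 0)$.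
   Context: $C_b(E)$ is the space of real-valued bounded continuous functions on $E$. Continuity of $t\mapsto\rho_t$ is with respect to weak convergence of Borel probability measures on $E$. $\mathbf{E}[\cdot]$ is expectation. A $C_0$-semigroup on $E$ is a family $(T_t)_{t\ge 0}$ of bounded linear operators with $T_0=I$, $T_tT_s=T_{t+s}$ for $s,t\ge0$, and $t\mapsto T_t x$ continuous for each $x\in E$. A generalized Mehler semigroup is a one-parameter semigroup of operators $(\mathcal{T}_t)_{t\ge 0}$ on $C_b(E)$ (i.e. $\mathcal{T}_t\mathcal{T}_s=\mathcal{T}_{t+s}$ for all $s,t\ge0$) of the form $(\mathcal{T}_t f)(x)=\int_E f(T_t x+y)\,\rho_t(dy)$ for $f\in C_b(E)$, $x\in E$, where $(T_t)_{t\ge 0}$ is a $C_0$-semigroup on $E$ and $\rho_t$, $t\ge 0$, are Borel probability measures on $E$. A Lévy process is an $E$-valued càdlàg process (paths right continuous with left limits) with stationary and independent increments, starting from zero. Random integral: for an operator-valued function $g$ of locally bounded variation and a càdlàg $E$-valued process $Y$ with independent increments, $$\int_{(a,b]}g(t)\,dY(t):=g(b)Y(b)-g(a)Y(a)-\int_{(a,b]}dg(t)\,Y(t),$$ where the last integral is defined path-wise through approximation by partial sums of the form $\sum_{j=1}^n (g(t_j)-g(t_{j-1}))Y(t_j)$ over partitions of $(a,b]$. *)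

theory Defs
  imports "HOL-Probability.Probability"
begin

section \<open>Operator semigroups\<close>

definition C0_semigroup :: "(real \<Rightarrow> 'a::real_normed_vector \<Rightarrow>\<^sub>L 'a) \<Rightarrow> bool" where
  "C0_semigroup T \<longleftrightarrow>
     T 0 = id_blinfun \<and>
     (\<forall>s\<ge>0. \<forall>t\<ge>0. T t o\<^sub>L T s = T (t + s)) \<and>
     (\<forall>x. continuous_on {0..} (\<lambda>t. T t x))"

text \<open>
  The type of bounded operators is not an instance of the class \<^class>\<open>real_normed_algebra_1\<close>
  (on the zero space the identity would have norm 0), so \<^const>\<open>exp\<close> is not available for it;
  the operator exponential is given by its power series, converging in operator norm.
\<close>

primrec blinfun_pow :: "('a::real_normed_vector \<Rightarrow>\<^sub>L 'a) \<Rightarrow> nat \<Rightarrow> 'a \<Rightarrow>\<^sub>L 'a" where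
  "blinfun_pow A 0 = id_blinfun"
| "blinfun_pow A (Suc n) = A o\<^sub>L blinfun_pow A n"

definition blinfun_exp :: "('a::real_normed_vector \<Rightarrow>\<^sub>L 'a) \<Rightarrow> 'a \<Rightarrow>\<^sub>L 'a" where
  "blinfun_exp A = (\<Sum>n. blinfun_pow A n /\<^sub>R fact n)"

lemma norm_blinfun_pow_le: "norm (blinfun_pow A n) \<le> norm A ^ n"
proof (induction n)
  case 0
  show ?case by (simp add: norm_blinfun_id_le)
next
  case (Suc n)
  have "norm (blinfun_pow A (Suc n)) \<le> norm A * norm (blinfun_pow A n)"
    by (simp add: norm_blinfun_compose)
  also have "\<dots> \<le> norm A * norm A ^ n"
    using Suc by (intro mult_left_mono) auto
  finally show ?case by simp
qed

lemma summable_blinfun_exp: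
  fixes A :: "'a::banach \<Rightarrow>\<^sub>L 'a"
  shows "summable (\<lambda>n. blinfun_pow A n /\<^sub>R fact n)"
proof (rule summable_comparison_test')
  show "summable (\<lambda>n. norm A ^ n /\<^sub>R fact n)"
    by (rule summable_exp_generic)
  show "norm (blinfun_pow A n /\<^sub>R fact n) \<le> norm A ^ n /\<^sub>R fact n" if "n \<ge> 0" for n
    using norm_blinfun_pow_le[of A n] by (simp add: field_simps)
qed


section \<open>Generalized Mehler semigroups\<close>

definition generalized_mehler_semigroup ::
  "(real \<Rightarrow> 'a \<Rightarrow>\<^sub>L 'a) \<Rightarrow> (real \<Rightarrow> 'a measure) \<Rightarrow>
   (real \<Rightarrow> ('a::real_normed_vector \<Rightarrow>\<^sub>C real) \<Rightarrow> ('a \<Rightarrow>\<^sub>C real)) \<Rightarrow> bool" where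
  "generalized_mehler_semigroup T \<rho> P \<longleftrightarrow>
     C0_semigroup T \<and>
     (\<forall>t\<ge>0. prob_space (\<rho> t) \<and> sets (\<rho> t) = sets borel) \<and>
     (\<forall>t\<ge>0. \<forall>f x. P t f x = (\<integral>y. f (T t x + y) \<partial>\<rho> t)) \<and>
     (\<forall>s\<ge>0. \<forall>t\<ge>0. P t \<circ> P s = P (t + s))"

definition weakly_continuous_at_zero ::
  "(real \<Rightarrow> 'a::topological_space measure) \<Rightarrow> bool" where
  "weakly_continuous_at_zero \<rho> \<longleftrightarrow>
     (\<forall>f :: 'a \<Rightarrow>\<^sub>C real. ((\<lambda>t. \<integral>x. f x \<partial>\<rho> t) \<longlongrightarrow> (\<integral>x. f x \<partial>\<rho> 0)) (at 0 within {0..}))"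


section \<open>Levy processes\<close>

definition cadlag :: "(real \<Rightarrow> 'a::topological_space) \<Rightarrow> bool" where
  "cadlag y \<longleftrightarrow>
     (\<forall>t\<ge>0. (y \<longlongrightarrow> y t) (at_right t)) \<and>
     (\<forall>t>0. \<exists>l. (y \<longlongrightarrow> l) (at_left t))"

text \<open>Time runs through \<open>[0,\<infinity>)\<close>; the values of a process at negative times are irrelevant.\<close>

definition levy_process ::
  "'w measure \<Rightarrow> (real \<Rightarrow> 'w \<Rightarrow> 'a::real_normed_vector) \<Rightarrow> bool" where
  "levy_process M Y \<longleftrightarrow>
     prob_space M \<and>
     (\<forall>t\<ge>0. Y t \<in> borel_measurable M) \<and>
     (\<forall>\<omega>\<in>space M. Y 0 \<omega> = 0) \<and>
     (\<forall>\<omega>\<in>space M. cadlag (\<lambda>t. Y t \<omega>)) \<and>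
     (\<forall>n (t :: nat \<Rightarrow> real). 0 \<le> t 0 \<and> (\<forall>i<n. t i < t (Suc i)) \<longrightarrow>
        prob_space.indep_vars M (\<lambda>_. borel) (\<lambda>i \<omega>. Y (t (Suc i)) \<omega> - Y (t i) \<omega>) {..<n}) \<and>
     (\<forall>s\<ge>0. \<forall>h\<ge>0. distr M borel (\<lambda>\<omega>. Y (s + h) \<omega> - Y s \<omega>) = distr M borel (\<lambda>\<omega>. Y h \<omega> - Y 0 \<omega>))"


section \<open>The random integral\<close>

definition is_partition :: "real \<Rightarrow> real \<Rightarrow> nat \<Rightarrow> (nat \<Rightarrow> real) \<Rightarrow> bool" where
  "is_partition a b n t \<longleftrightarrow> t 0 = a \<and> t n = b \<and> (\<forall>i<n. t i < t (Suc i))"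

text \<open>
  \<open>has_dg_integral g y a b I\<close> states that \<open>I\<close> is the integral of \<open>dg(t) y(t)\<close> over \<open>(a,b]\<close>,
  i.e. the limit, as the mesh tends to 0, of the sums evaluating \<open>y\<close> at the right end points.
\<close>

definition has_dg_integral ::
  "(real \<Rightarrow> 'a \<Rightarrow>\<^sub>L 'a) \<Rightarrow> (real \<Rightarrow> 'a::real_normed_vector) \<Rightarrow> real \<Rightarrow> real \<Rightarrow> 'a \<Rightarrow> bool" where
  "has_dg_integral g y a b I \<longleftrightarrow>
     (\<forall>\<epsilon>>0. \<exists>\<delta>>0. \<forall>n t. is_partition a b n t \<and> (\<forall>i<n. t (Suc i) - t i < \<delta>) \<longrightarrow>
        norm ((\<Sum>i<n. (g (t (Suc i)) - g (t i)) (y (t (Suc i)))) - I) < \<epsilon>)"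

lemma has_dg_integral_unique:
  assumes "a \<le> b" "has_dg_integral g y a b I" "has_dg_integral g y a b J"
  shows "I = J"
proof (rule ccontr)
  assume "I \<noteq> J"
  define \<epsilon> where "\<epsilon> = norm (I - J) / 2"
  have "\<epsilon> > 0" using \<open>I \<noteq> J\<close> by (simp add: \<epsilon>_def)
  define S where "S n t = (\<Sum>i<n. (g (t (Suc i)) - g (t i)) (y (t (Suc i))))" for n and t :: "nat \<Rightarrow> real"
  have close: "\<exists>\<delta>>0. \<forall>n t. is_partition a b n t \<and> (\<forall>i<n. t (Suc i) - t i < \<delta>) \<longrightarrow> norm (S n t - K) < \<epsilon>"
    if "has_dg_integral g y a b K" for K
    using that[unfolded has_dg_integral_def, rule_format, OF \<open>\<epsilon> > 0\<close>] by (simp only: S_def)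
  obtain d1 where d1: "d1 > 0"
      "\<forall>n t. is_partition a b n t \<and> (\<forall>i<n. t (Suc i) - t i < d1) \<longrightarrow> norm (S n t - I) < \<epsilon>"
    using close[OF assms(2)] by (elim exE conjE)
  obtain d2 where d2: "d2 > 0"
      "\<forall>n t. is_partition a b n t \<and> (\<forall>i<n. t (Suc i) - t i < d2) \<longrightarrow> norm (S n t - J) < \<epsilon>"
    using close[OF assms(3)] by (elim exE conjE)
  obtain n t where t: "is_partition a b n t" "\<forall>i<n. t (Suc i) - t i < min d1 d2"
  proof (cases "a = b")
    case True
    then show ?thesis
      using that[of 0 "\<lambda>_. a"] by (simp add: is_partition_def)
  next
    case False
    with \<open>a \<le> b\<close> have "a < b" by simp
    obtain n where n: "real n * min d1 d2 > b - a"
      using reals_Archimedean3[of "min d1 d2"] d1(1) d2(1) by auto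
    have "n > 0" using n \<open>a < b\<close> by (cases n) auto
    define t where "t i = a + real i * ((b - a) / n)" for i
    have step: "t (Suc i) - t i = (b - a) / n" for i
      by (simp add: t_def distrib_right del: times_divide_eq_right)
    have "(b - a) / n > 0" using \<open>a < b\<close> \<open>n > 0\<close> by simp
    then have "t i < t (Suc i)" for i using step[of i] by linarith
    then have "is_partition a b n t"
      using \<open>n > 0\<close> by (simp add: is_partition_def t_def)
    moreover have "(b - a) / n < min d1 d2"
      using n \<open>n > 0\<close> by (simp only: pos_divide_less_eq of_nat_0_less_iff mult.commute)
    ultimately show ?thesis
      using that step by simp
  qed
  have "norm (S n t - I) < \<epsilon>" "norm (S n t - J) < \<epsilon>"
    using d1(2)[rule_format, of n t] d2(2)[rule_format, of n t] t by simp_all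
  then have "norm (I - J) < 2 * \<epsilon>"
    using norm_triangle_ineq4[of "S n t - J" "S n t - I"] by simp
  then show False by (simp add: \<epsilon>_def)
qed

definition dg_integrable ::
  "(real \<Rightarrow> 'a \<Rightarrow>\<^sub>L 'a) \<Rightarrow> (real \<Rightarrow> 'a::real_normed_vector) \<Rightarrow> real \<Rightarrow> real \<Rightarrow> bool" where
  "dg_integrable g y a b \<longleftrightarrow> (\<exists>I. has_dg_integral g y a b I)"

definition dg_integral ::
  "(real \<Rightarrow> 'a \<Rightarrow>\<^sub>L 'a) \<Rightarrow> (real \<Rightarrow> 'a::real_normed_vector) \<Rightarrow> real \<Rightarrow> real \<Rightarrow> 'a" where
  "dg_integral g y a b = (THE I. has_dg_integral g y a b I)"

definition random_integral ::
  "(real \<Rightarrow> 'a \<Rightarrow>\<^sub>L 'a) \<Rightarrow> (real \<Rightarrow> 'w \<Rightarrow> 'a::real_normed_vector) \<Rightarrow> real \<Rightarrow> real \<Rightarrow> 'w \<Rightarrow> 'a" where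
  "random_integral g Y a b \<omega> = g b (Y b \<omega>) - g a (Y a \<omega>) - dg_integral g (\<lambda>t. Y t \<omega>) a b"

text \<open>
  Besides the equation itself, the representation records that its right-hand side is meaningful:
  the pathwise integrals exist (so that \<^const>\<open>dg_integral\<close> is a genuine limit of partial sums)
  and the expectations exist (so that the Bochner integral is not the default value 0).
\<close>

definition mehler_representation ::
  "(real \<Rightarrow> 'a \<Rightarrow>\<^sub>L 'a) \<Rightarrow> (real \<Rightarrow> ('a::real_normed_vector \<Rightarrow>\<^sub>C real) \<Rightarrow> ('a \<Rightarrow>\<^sub>C real)) \<Rightarrow>
   'w measure \<Rightarrow> (real \<Rightarrow> 'w \<Rightarrow> 'a) \<Rightarrow> bool" where
  "mehler_representation T P M Y \<longleftrightarrow>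
     (\<forall>t\<ge>0.
        (\<forall>\<omega>\<in>space M. dg_integrable (\<lambda>s. T (t - s)) (\<lambda>s. Y s \<omega>) 0 t) \<and>
        (\<forall>f x.
           integrable M (\<lambda>\<omega>. apply_bcontfun f (T t x + random_integral (\<lambda>s. T (t - s)) Y 0 t \<omega>)) \<and>
           P t f x =
             prob_space.expectation M (\<lambda>\<omega>. apply_bcontfun f (T t x + random_integral (\<lambda>s. T (t - s)) Y 0 t \<omega>))))"

end

theory Submission
  imports Defs
begin

text \<open>
  In both parts \<open>(T\<^sub>t)\<close> is norm continuous, hence locally Lipschitz in operator norm and invertible.
  The semigroup law of the \<open>\<T>\<^sub>t\<close> is the skew convolution equation \<open>\<rho>\<^sub>t\<^sub>+\<^sub>s = (T\<^sub>s \<rho>\<^sub>t) * \<rho>\<^sub>s\<close>; in particular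
  \<open>\<rho>\<^sub>0\<close> is idempotent, hence \<open>\<delta>\<^sub>0\<close>. Pulling back by \<open>T\<^sub>t\<close>, the measures \<open>\<nu>\<^sub>s\<^sub>,\<^sub>t = T\<^sub>t\<inverse> \<rho>\<^sub>t\<^sub>-\<^sub>s\<close> satisfy
  \<open>\<nu>\<^sub>s\<^sub>,\<^sub>t * \<nu>\<^sub>t\<^sub>,\<^sub>u = \<nu>\<^sub>s\<^sub>,\<^sub>u\<close>, so Kolmogorov's theorem yields a process \<open>U\<close> with independent increments
  \<open>U\<^sub>t - U\<^sub>s \<sim> \<nu>\<^sub>s\<^sub>,\<^sub>t\<close>; it is stochastically continuous and therefore has a cadlag modification.
  Put \<open>Y\<^sub>t = \<integral>\<^bsub>(0,t]\<^esub> T\<^sub>s dU\<^sub>s\<close> pathwise. Since \<open>T\<^sub>s (U\<^sub>s\<^sub>+\<^sub>\<delta> - U\<^sub>s) \<sim> T\<^sub>\<delta>\<inverse> \<rho>\<^sub>\<delta>\<close> does not depend on \<open>s\<close>, the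
  increments of \<open>Y\<close> are stationary as well as independent, and \<open>\<integral>\<^bsub>(0,t]\<^esub> T\<^sub>t\<^sub>-\<^sub>s dY\<^sub>s = T\<^sub>t U\<^sub>t \<sim> \<rho>\<^sub>t\<close>. Both pathwise
  statements are trivial for step functions and extend to cadlag paths by uniform approximation.
\<close>

section \<open>Measures determined by bounded continuous functions\<close>

text \<open>Two obstacles shape the argument. Paths of an additive process may have unbounded
  variation, so integrals against them are controlled only after summation by parts. This costs
  bounded variation of the integrand in operator norm, which is why a Lipschitz bound on the
  semigroup is wanted; it comes from a doubling estimate for T_h - I, without a generator. Moreover
  E is merely a separable Banach space, so neither characteristic functions nor local compactness
  are used: laws are compared on bounded continuous functions, \<open>\<rho> 0\<close> is identified
  by a second-moment martingale argument on the support of the measure, and cadlag paths come from a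
  maximal inequality that bounds the number of oscillations. Continuity of \<rho> at zero makes
  \<rho>_t small for small t. Because the inverses of T_t are bounded on compact time intervals,
  this becomes stochastic continuity of the pulled-back process, uniformly on such
  intervals.\<close>

lemma closed_indicator_limit_bcontfun:
  fixes F :: "'a::metric_space set"
  assumes "closed F"
  obtains f :: "nat \<Rightarrow> 'a \<Rightarrow>\<^sub>C real"
    where "\<And>k x. 0 \<le> f k x" "\<And>k x. f k x \<le> 1" "\<And>x. (\<lambda>k. f k x) \<longlonglongrightarrow> indicator F x"
\<comment> \<open>The distance to the empty set is 0 by convention, so the formula used below would
  give the constant 1 there.\<close>
proof (cases "F = {}")
  case True
  show ?thesis by (rule that[of "\<lambda>_. 0"]) (auto simp: True)
next
  case False
  \<comment> \<open>Tents of slope \<open>k\<close> over \<open>F\<close>: equal to 1 on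
    \<open>F\<close>, and eventually 0 at every point of positive distance from \<open>F\<close>,
    hence at every point off the closed set \<open>F\<close>.\<close>
  define g where "g k x = max 0 (1 - real k * infdist x F)" for k x
  have [simp]: "0 \<le> real k * infdist x F" for k x
    by (simp add: infdist_nonneg)
  have g01: "0 \<le> g k x" "g k x \<le> 1" for k x
    by (auto simp: g_def)
  have "g k \<in> bcontfun" for k
    by (rule bcontfun_normI[where b = 1]) (auto simp: g_def intro!: continuous_intros)
  then have gb: "apply_bcontfun (Bcontfun (g k)) = g k" for k
    by (simp add: Bcontfun_inverse)
  have "(\<lambda>k. g k x) \<longlonglongrightarrow> indicator F x" for x
  proof (cases "x \<in> F")
    case True
    then show ?thesis by (simp add: g_def)
  next
    case x: False
    then have "infdist x F > 0"
      using assms False in_closed_iff_infdist_zero infdist_nonneg[of x F]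
      by (metis order_le_less)
    then obtain N where N: "real N * infdist x F > 1"
      using reals_Archimedean3 by blast
    have "eventually (\<lambda>k. g k x = indicator F x) sequentially"
    proof (rule eventually_sequentiallyI[of N])
      fix k assume "N \<le> k"
      then have "real k * infdist x F \<ge> real N * infdist x F"
        using infdist_nonneg by (intro mult_right_mono) auto
      with N show "g k x = indicator F x" using x by (simp add: g_def)
    qed
    then show ?thesis by (rule tendsto_eventually)
  qed
  with g01 show ?thesis by (intro that[of "\<lambda>k. Bcontfun (g k)"]) (simp_all add: gb)
qed

lemma borel_measurable_apply_bcontfun [measurable]:
  "apply_bcontfun f \<in> borel_measurable borel"
  by (rule borel_measurable_continuous_onI) simp

lemma (in prob_space) integrable_bcontfun:
  fixes f :: "'b::topological_space \<Rightarrow>\<^sub>C real"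
  assumes "X \<in> borel_measurable M"
  shows "integrable M (\<lambda>\<omega>. f (X \<omega>))"
proof (rule integrable_const_bound[where B = "norm f"])
  show "AE \<omega> in M. norm (f (X \<omega>)) \<le> norm f" using norm_bounded[of f] by simp
  show "(\<lambda>\<omega>. f (X \<omega>)) \<in> borel_measurable M" using assms by measurable
qed

lemma sets_borel_eq_closed: "sets (borel :: 'a::topological_space measure) = sigma_sets UNIV {F. closed F}"
  by (subst borel_eq_closed) (simp add: sets_measure_of)

text \<open>Dominated convergence along the approximations of closed indicators gives equality on
  closed sets, a pi-system generating the Borel sets. This identifies laws that are known only
  through the operators \<open>P t\<close> or as limits.\<close>

lemma prob_eqI_bcontfun:
  fixes M N :: "'a::metric_space measure"
  assumes "prob_space M" "prob_space N" and sets: "sets M = sets borel" "sets N = sets borel"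
    and eq: "\<And>f :: 'a \<Rightarrow>\<^sub>C real. (\<integral>x. f x \<partial>M) = (\<integral>x. f x \<partial>N)"
  shows "M = N"
proof -
  interpret M: prob_space M by fact
  interpret N: prob_space N by fact
  have space: "space M = UNIV" "space N = UNIV"
    using sets[THEN sets_eq_imp_space_eq] by simp_all
  have closed: "emeasure M F = emeasure N F" if F: "closed F" for F
  proof -
    obtain f :: "nat \<Rightarrow> 'a \<Rightarrow>\<^sub>C real" where f: "\<And>k x. 0 \<le> f k x" "\<And>k x. f k x \<le> 1"
        "\<And>x. (\<lambda>k. f k x) \<longlonglongrightarrow> indicator F x"
      by (rule closed_indicator_limit_bcontfun[OF F]) blast
    have lim: "(\<lambda>k. \<integral>x. f k x \<partial>L) \<longlonglongrightarrow> measure L F"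
      if "prob_space L" "sets L = sets borel" for L
    proof -
      interpret L: prob_space L by fact
      note [measurable_cong] = that(2)
      have [measurable]: "F \<in> sets L" using \<open>closed F\<close> that(2) by auto
      have "(\<lambda>k. \<integral>x. f k x \<partial>L) \<longlonglongrightarrow> (\<integral>x. indicator F x \<partial>L)"
        by (rule integral_dominated_convergence[where w = "\<lambda>_. 1"]) (use f in auto)
      then show ?thesis by simp
    qed
    have "measure M F = measure N F"
      using LIMSEQ_unique[OF lim[OF assms(1) sets(1)]] lim[OF assms(2) sets(2)] by (simp add: eq)
    then show ?thesis by (simp add: M.emeasure_eq_measure N.emeasure_eq_measure)
  qed
  show ?thesis
  proof (rule measure_eqI_generator_eq[where E = "{F. closed F}" and \<Omega> = UNIV and A = "\<lambda>_. UNIV"])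
    show "Int_stable {F :: 'a set. closed F}" by (auto simp: Int_stable_def)
    show "sets M = sigma_sets UNIV {F. closed F}" "sets N = sigma_sets UNIV {F. closed F}"
      by (simp_all add: sets sets_borel_eq_closed)
  qed (use closed in auto)
qed

text \<open>The product formula for expectations of bounded continuous functions survives pointwise
  limits. Applied to approximations of closed indicators it yields the product formula on preimages
  of closed sets, an intersection-stable generator. It serves the increments of \<open>Y\<close>,
  which are limits of Riemann sums of increments of \<open>U\<close>.\<close>

lemma (in prob_space) indep_vars_limit:
  fixes X :: "'i \<Rightarrow> 'a \<Rightarrow> 'b::metric_space"
  assumes "finite I"
    and indep: "\<And>m. indep_vars (\<lambda>_. borel) (X' m) I"
    and lim: "\<And>i \<omega>. i \<in> I \<Longrightarrow> \<omega> \<in> space M \<Longrightarrow> (\<lambda>m. X' m i \<omega>) \<longlonglongrightarrow> X i \<omega>"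
  shows "indep_vars (\<lambda>_. borel) X I"
proof -
  have X'_meas [measurable]: "i \<in> I \<Longrightarrow> X' m i \<in> borel_measurable M" for m i
    using indep[of m] by (auto simp: indep_vars_def)
  have X_meas [measurable]: "X i \<in> borel_measurable M" if "i \<in> I" for i
    by (rule borel_measurable_LIMSEQ_metric[OF X'_meas lim]) (use that in auto)
  define E where "E i = {X i -` F \<inter> space M | F. closed F}" for i
  have "indep_sets E I"
  proof (rule indep_setsI)
    show "E i \<subseteq> events" if "i \<in> I" for i
      using that by (auto simp: E_def intro!: measurable_sets[OF X_meas])
    fix A J assume J: "J \<noteq> {}" "J \<subseteq> I" "finite J" and A: "\<forall>j\<in>J. A j \<in> E j"
    from A obtain F where F: "\<And>j. j \<in> J \<Longrightarrow> closed (F j)" "\<And>j. j \<in> J \<Longrightarrow> A j = X j -` F j \<inter> space M"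
      unfolding E_def by simp metis
    have "\<exists>f. \<forall>j\<in>J. (\<forall>k x. 0 \<le> apply_bcontfun (f j k) x \<and> apply_bcontfun (f j k) x \<le> 1) \<and>
        (\<forall>x. (\<lambda>k. apply_bcontfun (f j k) x) \<longlonglongrightarrow> (indicator (F j) x :: real))"
    proof (rule bchoice, rule ballI)
      fix j assume "j \<in> J"
      show "\<exists>f. (\<forall>k x. 0 \<le> apply_bcontfun (f k) x \<and> apply_bcontfun (f k) x \<le> 1) \<and>
        (\<forall>x. (\<lambda>k. apply_bcontfun (f k) x) \<longlonglongrightarrow> (indicator (F j) x :: real))"
        by (rule closed_indicator_limit_bcontfun[OF F(1)[OF \<open>j \<in> J\<close>]]) blast
    qed
    then obtain f :: "'i \<Rightarrow> nat \<Rightarrow> 'b \<Rightarrow>\<^sub>C real"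
      where f: "\<And>j k x. j \<in> J \<Longrightarrow> 0 \<le> f j k x" "\<And>j k x. j \<in> J \<Longrightarrow> f j k x \<le> 1"
        "\<And>j x. j \<in> J \<Longrightarrow> (\<lambda>k. f j k x) \<longlonglongrightarrow> indicator (F j) x"
      by blast
    have XJ [measurable]: "X j \<in> borel_measurable M" if "j \<in> J" for j using that J X_meas by auto
    have prod_bound: "norm (\<Prod>j\<in>J. f j k (x j)) \<le> 1" for k x
      using f by (auto simp: abs_prod intro!: prod_le_1)
    \<comment> \<open>The limit in \<open>m\<close> is taken with \<open>k\<close> fixed, while the
      test functions are still continuous; for the indicators themselves it could fail.\<close>
    have fact: "(\<integral>\<omega>. (\<Prod>j\<in>J. f j k (X j \<omega>)) \<partial>M) = (\<Prod>j\<in>J. \<integral>\<omega>. f j k (X j \<omega>) \<partial>M)" for k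
    proof -
      have m: "(\<integral>\<omega>. (\<Prod>j\<in>J. f j k (X' m j \<omega>)) \<partial>M) = (\<Prod>j\<in>J. \<integral>\<omega>. f j k (X' m j \<omega>) \<partial>M)" for m
      proof (rule indep_vars_lebesgue_integral)
        have "indep_vars (\<lambda>_. borel) (X' m) J" using indep J(2) by (rule indep_vars_subset)
        then show "indep_vars (\<lambda>_. borel) (\<lambda>j \<omega>. f j k (X' m j \<omega>)) J"
          by (rule indep_vars_compose2) simp
        show "integrable M (\<lambda>\<omega>. f j k (X' m j \<omega>))" if "j \<in> J" for j
          using that J by (intro integrable_bcontfun X'_meas) auto
      qed fact
      have pt: "(\<lambda>m. f j k (X' m j \<omega>)) \<longlonglongrightarrow> f j k (X j \<omega>)" if "j \<in> J" "\<omega> \<in> space M" for j \<omega>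
      proof -
        have "isCont (f j k) (X j \<omega>)"
          using continuous_on_apply_bcontfun[of UNIV "f j k"] by (simp add: continuous_on_eq_continuous_at del: continuous_on_apply_bcontfun)
        moreover have "(\<lambda>m. X' m j \<omega>) \<longlonglongrightarrow> X j \<omega>" using that J lim by auto
        ultimately show ?thesis by (rule isCont_tendsto_compose)
      qed
      have "(\<lambda>m. \<integral>\<omega>. (\<Prod>j\<in>J. f j k (X' m j \<omega>)) \<partial>M) \<longlonglongrightarrow> (\<integral>\<omega>. (\<Prod>j\<in>J. f j k (X j \<omega>)) \<partial>M)"
      proof (rule integral_dominated_convergence[where w = "\<lambda>_. 1"])
        show "AE \<omega> in M. (\<lambda>m. \<Prod>j\<in>J. f j k (X' m j \<omega>)) \<longlonglongrightarrow> (\<Prod>j\<in>J. f j k (X j \<omega>))"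
          by (rule AE_I2) (intro tendsto_prod pt)
        show "(\<lambda>\<omega>. \<Prod>j\<in>J. f j k (X j \<omega>)) \<in> borel_measurable M" by measurable
        have "X' m j \<in> borel_measurable M" if "j \<in> J" for m j using that J by auto
        note [measurable] = this
        show "(\<lambda>\<omega>. \<Prod>j\<in>J. f j k (X' m j \<omega>)) \<in> borel_measurable M" for m by measurable
      qed (use prod_bound in auto)
      moreover have "(\<lambda>m. \<Prod>j\<in>J. \<integral>\<omega>. f j k (X' m j \<omega>) \<partial>M) \<longlonglongrightarrow> (\<Prod>j\<in>J. \<integral>\<omega>. f j k (X j \<omega>) \<partial>M)"
      proof (intro tendsto_prod)
        fix j assume "j \<in> J"
        then have [measurable]: "X' m j \<in> borel_measurable M" "X j \<in> borel_measurable M" for m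
          using J by auto
        show "(\<lambda>m. \<integral>\<omega>. f j k (X' m j \<omega>) \<partial>M) \<longlonglongrightarrow> (\<integral>\<omega>. f j k (X j \<omega>) \<partial>M)"
          by (rule integral_dominated_convergence[where w = "\<lambda>_. 1"])
             (use pt[OF \<open>j \<in> J\<close>] f \<open>j \<in> J\<close> in auto)
      qed
      ultimately show ?thesis unfolding m by (rule LIMSEQ_unique)
    qed
    have "(\<lambda>k. \<integral>\<omega>. (\<Prod>j\<in>J. f j k (X j \<omega>)) \<partial>M) \<longlonglongrightarrow> (\<integral>\<omega>. (\<Prod>j\<in>J. indicator (F j) (X j \<omega>)) \<partial>M)"
    proof (rule integral_dominated_convergence[where w = "\<lambda>_. 1"])
      show "AE \<omega> in M. (\<lambda>k. \<Prod>j\<in>J. f j k (X j \<omega>)) \<longlonglongrightarrow> (\<Prod>j\<in>J. indicator (F j) (X j \<omega>))"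
        by (rule AE_I2) (intro tendsto_prod f)
      have "(\<lambda>\<omega>. indicator (F j) (X j \<omega>) :: real) \<in> borel_measurable M" if "j \<in> J" for j
        by (rule measurable_compose[OF XJ[OF that]]) (use F that in auto)
      then show "(\<lambda>\<omega>. \<Prod>j\<in>J. indicator (F j) (X j \<omega>) :: real) \<in> borel_measurable M" by measurable
      show "(\<lambda>\<omega>. \<Prod>j\<in>J. f j k (X j \<omega>)) \<in> borel_measurable M" for k by measurable
    qed (use prod_bound in auto)
    also have "(\<integral>\<omega>. (\<Prod>j\<in>J. indicator (F j) (X j \<omega>)) \<partial>M :: real) = (\<integral>\<omega>. indicator (\<Inter>j\<in>J. A j) \<omega> \<partial>M)"
    proof (intro Bochner_Integration.integral_cong refl)
      fix \<omega> assume "\<omega> \<in> space M"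
      then show "(\<Prod>j\<in>J. indicator (F j) (X j \<omega>)) = (indicator (\<Inter>j\<in>J. A j) \<omega> :: real)"
        using J by (cases "\<forall>j\<in>J. X j \<omega> \<in> F j") (auto simp: F(2) indicator_def intro!: prod_zero)
    qed
    also have "\<dots> = prob (\<Inter>j\<in>J. A j)"
    proof -
      have "A j \<in> events" if "j \<in> J" for j
        using F that by (auto intro!: measurable_sets[OF XJ])
      then have "(\<Inter>j\<in>J. A j) \<in> events" using J by (intro sets.finite_INT) auto
      then show ?thesis by simp
    qed
    finally have 1: "(\<lambda>k. \<Prod>j\<in>J. \<integral>\<omega>. f j k (X j \<omega>) \<partial>M) \<longlonglongrightarrow> prob (\<Inter>j\<in>J. A j)"
      unfolding fact .
    have "(\<lambda>k. \<Prod>j\<in>J. \<integral>\<omega>. f j k (X j \<omega>) \<partial>M) \<longlonglongrightarrow> (\<Prod>j\<in>J. prob (A j))"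
    proof (intro tendsto_prod)
      fix j assume j: "j \<in> J"
      have [measurable]: "X j \<in> borel_measurable M" using j by simp
      have Aj: "A j \<in> events" using F[OF j] by (auto intro!: measurable_sets[OF XJ[OF j]])
      have "(\<lambda>k. \<integral>\<omega>. f j k (X j \<omega>) \<partial>M) \<longlonglongrightarrow> (\<integral>\<omega>. indicator (F j) (X j \<omega>) \<partial>M)"
      proof (rule integral_dominated_convergence[where w = "\<lambda>_. 1"])
        show "(\<lambda>\<omega>. indicator (F j) (X j \<omega>) :: real) \<in> borel_measurable M"
          by (rule measurable_compose[OF XJ[OF j]]) (use F j in auto)
      qed (use f j in auto)
      also have "(\<integral>\<omega>. indicator (F j) (X j \<omega>) \<partial>M :: real) = (\<integral>\<omega>. indicator (A j) \<omega> \<partial>M)"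
        by (intro Bochner_Integration.integral_cong refl) (auto simp: F[OF j] indicator_def)
      also have "\<dots> = prob (A j)" using Aj by simp
      finally show "(\<lambda>k. \<integral>\<omega>. f j k (X j \<omega>) \<partial>M) \<longlonglongrightarrow> prob (A j)" .
    qed
    with 1 show "prob (\<Inter>j\<in>J. A j) = (\<Prod>j\<in>J. prob (A j))" by (rule LIMSEQ_unique)
  qed
  then have "indep_sets (\<lambda>i. sigma_sets (space M) (E i)) I"
  proof (rule indep_sets_sigma)
    fix i
    show "Int_stable (E i)"
    proof (rule Int_stableI)
      fix a b assume "a \<in> E i" "b \<in> E i"
      then obtain F G where "closed F" "closed G" "a = X i -` F \<inter> space M" "b = X i -` G \<inter> space M"
        by (auto simp: E_def)
      then show "a \<inter> b \<in> E i"
        unfolding E_def by (intro CollectI exI[of _ "F \<inter> G"]) auto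
    qed
  qed
  moreover have "sigma_sets (space M) (E i) = sigma_sets (space M) {X i -` A \<inter> space M | A. A \<in> sets borel}" if "i \<in> I" for i
  proof -
    have "sigma_sets (space M) (E i) = {X i -` A \<inter> space M | A. A \<in> sigma_sets UNIV {F. closed F}}"
      using sigma_sets_vimage_commute[of "X i" "space M" UNIV "{F. closed F}"] by (simp add: E_def)
    then have "sigma_sets (space M) (E i) = {X i -` A \<inter> space M | A. A \<in> sets borel}"
      by (simp only: sets_borel_eq_closed)
    moreover have "sigma_algebra (space M) {X i -` A \<inter> space M | A. A \<in> sets borel}"
      using sets.sigma_algebra_axioms[of "vimage_algebra (space M) (X i) borel"]
      by (simp add: sets_vimage_algebra2)
    ultimately show ?thesis
      by (simp add: sigma_algebra.sigma_sets_eq)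
  qed
  ultimately show ?thesis
    unfolding indep_vars_def using X_meas by (simp cong: indep_sets_cong)
qed

section \<open>Idempotent probability measures\<close>

text \<open>Let y be a nonzero point of the support, f a bump of bounded support, and g(x) the
  average of f(x + z) over z. Idempotence makes g harmonic for the random walk with step law \<mu>,
  and equality of second moments forces g(u + v) = g(u) on the support. The support is closed under
  addition, so g is constant along the multiples of y; since f vanishes far out, that constant is 0.
  Hence y + z avoids the ball of radius R almost surely, for every R, which is absurd.\<close>

lemma prob_idempotent_convolution_imp_AE_zero:
  fixes \<mu> :: "'a::{banach, second_countable_topology} measure"
  assumes "prob_space \<mu>" and sets [measurable_cong]: "sets \<mu> = sets borel"
    and idem: "distr (\<mu> \<Otimes>\<^sub>M \<mu>) borel (\<lambda>(x, y). x + y) = \<mu>"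
  shows "AE x in \<mu>. x = 0"
proof -
  interpret prob_space \<mu> by fact
  interpret PP: pair_prob_space \<mu> \<mu> ..
  have [simp]: "space \<mu> = UNIV" using sets_eq_imp_space_eq[OF sets] by simp
  have ball_times: "measure (\<mu> \<Otimes>\<^sub>M \<mu>) (ball x d \<times> ball y e) = measure \<mu> (ball x d) * measure \<mu> (ball y e)" for x y d e
    using sets by (simp add: measure_def emeasure_pair_measure_Times enn2real_mult)
  have [simp]: "measure \<mu> UNIV = 1" using prob_space by simp
  define supp where "supp = {x. \<forall>e>0. measure \<mu> (ball x e) > 0}"
  have ball [measurable]: "ball x e \<in> sets \<mu>" for x e using sets by simp
  have conv_integral: "(\<integral>x. \<integral>y. h (x + y) \<partial>\<mu> \<partial>\<mu>) = (\<integral>x. h x \<partial>\<mu>)"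
    if [measurable]: "h \<in> borel_measurable borel" and "\<And>x. \<bar>h x\<bar> \<le> B" for h :: "'a \<Rightarrow> real" and B
  proof -
    have "(\<integral>x. h x \<partial>\<mu>) = (\<integral>x. h x \<partial>distr (\<mu> \<Otimes>\<^sub>M \<mu>) borel (\<lambda>(x, y). x + y))" by (simp add: idem)
    also have "\<dots> = (\<integral>z. h (case z of (x, y) \<Rightarrow> x + y) \<partial>(\<mu> \<Otimes>\<^sub>M \<mu>))"
      by (rule Bochner_Integration.integral_distr) measurable
    also have "\<dots> = (\<integral>z. h (fst z + snd z) \<partial>(\<mu> \<Otimes>\<^sub>M \<mu>))"
      by (simp add: case_prod_beta)
    also have "\<dots> = (\<integral>x. \<integral>y. h (x + y) \<partial>\<mu> \<partial>\<mu>)"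
    proof (subst PP.integral_fst'[symmetric])
      show "integrable (\<mu> \<Otimes>\<^sub>M \<mu>) (\<lambda>z. h (fst z + snd z))"
        by (rule PP.P.integrable_const_bound[where B = B]) (use that in auto)
    qed simp
    finally show ?thesis by simp
  qed
  have supp_add: "x + y \<in> supp" if "x \<in> supp" "y \<in> supp" for x y
    unfolding supp_def
  proof safe
    fix e :: real assume e: "0 < e"
    have "0 < measure \<mu> (ball x (e/2)) * measure \<mu> (ball y (e/2))"
      using that e unfolding supp_def by (intro mult_pos_pos) auto
    also have "\<dots> = measure (\<mu> \<Otimes>\<^sub>M \<mu>) (ball x (e/2) \<times> ball y (e/2))"
      by (simp add: ball_times)
    also have "\<dots> \<le> measure (\<mu> \<Otimes>\<^sub>M \<mu>) ((\<lambda>(x, y). x + y) -` ball (x + y) e \<inter> space (\<mu> \<Otimes>\<^sub>M \<mu>))"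
    proof (rule PP.P.finite_measure_mono)
      show "ball x (e/2) \<times> ball y (e/2) \<subseteq> (\<lambda>(x, y). x + y) -` ball (x + y) e \<inter> space (\<mu> \<Otimes>\<^sub>M \<mu>)"
      proof (clarsimp simp: space_pair_measure)
        fix u v assume "dist x u * 2 < e" "dist y v * 2 < e"
        then show "dist (x + y) (u + v) < e"
          using dist_triangle_add[of x y u v] by linarith
      qed
    qed measurable
    also have "\<dots> = measure \<mu> (ball (x + y) e)"
      by (subst (2) idem[symmetric], subst measure_distr) measurable
    finally show "0 < measure \<mu> (ball (x + y) e)" .
  qed
  have "supp \<subseteq> {0}"
  proof
    fix y assume y: "y \<in> supp"
    show "y \<in> {0}"
    proof (rule ccontr)
      assume "y \<notin> {0}"
      then have y0: "norm y > 0" by simp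
      have far: "AE z in \<mu>. R \<le> norm (y + z)" if R: "R > 0" for R
      proof -
        \<comment> \<open>A cone of height and radius \<open>R\<close>: bounded, 1-Lipschitz and
          vanishing outside the ball, the three properties used below.\<close>
        define f where "f w = max 0 (R - norm w)" for w :: 'a
        have f01: "0 \<le> f w" "f w \<le> R" for w using R by (auto simp: f_def)
        have f_lip: "\<bar>f u - f v\<bar> \<le> dist u v" for u v
          unfolding f_def dist_norm using norm_triangle_ineq3[of u v] by (auto simp: max_def)
        have f_meas [measurable]: "f \<in> borel_measurable borel" unfolding f_def by measurable
        have f_int: "integrable \<mu> (\<lambda>y. f (x + y))" for x
          by (rule integrable_const_bound[where B = R]) (use f01 in auto)
        define g where "g x = (\<integral>y. f (x + y) \<partial>\<mu>)" for x
        have g01: "0 \<le> g x" "g x \<le> R" for x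
        proof -
          show "0 \<le> g x" unfolding g_def using f01 by (intro Bochner_Integration.integral_nonneg) auto
          show "g x \<le> R"
            using Bochner_Integration.integral_mono[OF f_int[of x], of "\<lambda>_. R"] f01 by (simp add: g_def prob_space)
        qed
        have g_lip: "\<bar>g u - g v\<bar> \<le> dist u v" for u v
        proof -
          have "g u - g v = (\<integral>y. f (u + y) - f (v + y) \<partial>\<mu>)"
            unfolding g_def by (rule Bochner_Integration.integral_diff[symmetric]) (rule f_int)+
          also have "\<bar>\<dots>\<bar> \<le> (\<integral>y. \<bar>f (u + y) - f (v + y)\<bar> \<partial>\<mu>)"
            by (rule integral_abs_bound)
          also have "\<dots> \<le> (\<integral>y. dist u v \<partial>\<mu>)"
          proof (rule Bochner_Integration.integral_mono)
            show "integrable \<mu> (\<lambda>y. \<bar>f (u + y) - f (v + y)\<bar>)"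
              by (intro integrable_abs Bochner_Integration.integrable_diff f_int)
            show "\<bar>f (u + z) - f (v + z)\<bar> \<le> dist u v" for z
              using f_lip[of "u + z" "v + z"] by simp
          qed simp
          finally show ?thesis by (simp add: prob_space)
        qed
        have "1-lipschitz_on UNIV g"
          by (rule lipschitz_onI) (use g_lip in \<open>auto simp: dist_real_def\<close>)
        then have g_cont: "continuous_on UNIV g" by (rule lipschitz_on_continuous_on)
        then have [measurable]: "g \<in> borel_measurable borel" by (rule borel_measurable_continuous_onI)
        have g_abs: "\<bar>g x\<bar> \<le> R" for x using g01[of x] by simp
        have g_int: "integrable \<mu> (\<lambda>y. g (x + y))" "integrable \<mu> (\<lambda>y. (g (x + y))\<^sup>2)" for x
        proof -
          show "integrable \<mu> (\<lambda>y. g (x + y))"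
            by (rule integrable_const_bound[where B = R]) (use g01 in auto)
          show "integrable \<mu> (\<lambda>y. (g (x + y))\<^sup>2)"
            by (rule integrable_const_bound[where B = "R\<^sup>2"]) (use g01 in \<open>auto intro!: power_mono\<close>)
        qed
        \<comment> \<open>\<open>g\<close> is already an average over one step of law \<mu>; a
          second independent step changes nothing because the sum of the two has law \<mu>
          again.\<close>
        have g_harmonic: "(\<integral>y. g (x + y) \<partial>\<mu>) = g x" for x
          using conv_integral[of "\<lambda>w. f (x + w)" R] f01 by (simp add: g_def add.assoc)
        \<comment> \<open>The martingale \<open>g (S\<^sub>n)\<close> along the random walk with step law \<open>\<mu>\<close> has constant second moment.\<close>
        have sq_int: "(\<integral>y. (g (x + y) - g x)\<^sup>2 \<partial>\<mu>) = (\<integral>y. (g (x + y))\<^sup>2 \<partial>\<mu>) - (g x)\<^sup>2" for x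
        proof -
          have "(\<integral>y. (g (x + y) - g x)\<^sup>2 \<partial>\<mu>) = (\<integral>y. (g (x + y))\<^sup>2 + ((g x)\<^sup>2 - 2 * g x * g (x + y)) \<partial>\<mu>)"
            by (intro Bochner_Integration.integral_cong refl) (simp add: power2_diff algebra_simps)
          also have "\<dots> = (\<integral>y. (g (x + y))\<^sup>2 \<partial>\<mu>) + (\<integral>y. (g x)\<^sup>2 - 2 * g x * g (x + y) \<partial>\<mu>)"
            by (intro Bochner_Integration.integral_add g_int Bochner_Integration.integrable_diff) (use g_int in auto)
          also have "(\<integral>y. (g x)\<^sup>2 - 2 * g x * g (x + y) \<partial>\<mu>) = (g x)\<^sup>2 - 2 * g x * g x"
            by (subst Bochner_Integration.integral_diff) (use g_int in \<open>auto simp: g_harmonic prob_space\<close>)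
          finally show ?thesis by (simp add: power2_eq_square)
        qed
        have int_pair: "integrable (\<mu> \<Otimes>\<^sub>M \<mu>) (\<lambda>z. (g (fst z + snd z) - g (fst z))\<^sup>2)"
        proof (rule PP.P.integrable_const_bound[where B = "(2 * R)\<^sup>2"])
          have "\<bar>(g (u + v) - g u)\<^sup>2\<bar> \<le> (2 * R)\<^sup>2" for u v
            using g01[of "u + v"] g01[of u] abs_le_square_iff[of "g (u + v) - g u" "2 * R"]
            by (simp del: power_mult_distrib) linarith
          then show "AE z in \<mu> \<Otimes>\<^sub>M \<mu>. norm ((g (fst z + snd z) - g (fst z))\<^sup>2) \<le> (2 * R)\<^sup>2" by simp
        qed measurable
        have "(\<integral>z. (g (fst z + snd z) - g (fst z))\<^sup>2 \<partial>(\<mu> \<Otimes>\<^sub>M \<mu>)) = (\<integral>x. \<integral>y. (g (x + y) - g x)\<^sup>2 \<partial>\<mu> \<partial>\<mu>)"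
          using PP.integral_fst'[OF int_pair] by simp
        also have "\<dots> = (\<integral>x. (\<integral>y. (g (x + y))\<^sup>2 \<partial>\<mu>) - (g x)\<^sup>2 \<partial>\<mu>)"
          by (simp only: sq_int)
        also have "\<dots> = (\<integral>x. \<integral>y. (g (x + y))\<^sup>2 \<partial>\<mu> \<partial>\<mu>) - (\<integral>x. (g x)\<^sup>2 \<partial>\<mu>)"
        proof (rule Bochner_Integration.integral_diff)
          have "\<bar>\<integral>y. (g (x + y))\<^sup>2 \<partial>\<mu>\<bar> \<le> R\<^sup>2" for x
          proof -
            have "(\<integral>y. (g (x + y))\<^sup>2 \<partial>\<mu>) \<le> (\<integral>y. R\<^sup>2 \<partial>\<mu>)"
              using g01 by (intro Bochner_Integration.integral_mono g_int) (auto intro!: power_mono)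
            then show ?thesis by (simp add: prob_space)
          qed
          then show "integrable \<mu> (\<lambda>x. \<integral>y. (g (x + y))\<^sup>2 \<partial>\<mu>)"
            by (intro integrable_const_bound[where B = "R\<^sup>2"]) auto
          show "integrable \<mu> (\<lambda>x. (g x)\<^sup>2)" using g_int(2)[of 0] by simp
        qed
        \<comment> \<open>Idempotence once more: the two-step and the one-step position have the
          same law, so the expected squared martingale increment is 0.\<close>
        also have "(\<integral>x. \<integral>y. (g (x + y))\<^sup>2 \<partial>\<mu> \<partial>\<mu>) = (\<integral>x. (g x)\<^sup>2 \<partial>\<mu>)"
        proof (rule conv_integral)
          show "\<bar>(g x)\<^sup>2\<bar> \<le> R\<^sup>2" for x using g01 by (auto intro!: power_mono)
        qed measurable
        finally have "(\<integral>z. (g (fst z + snd z) - g (fst z))\<^sup>2 \<partial>(\<mu> \<Otimes>\<^sub>M \<mu>)) = 0" by simp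
        then have "AE z in \<mu> \<Otimes>\<^sub>M \<mu>. (g (fst z + snd z) - g (fst z))\<^sup>2 = 0"
          by (subst (asm) integral_nonneg_eq_0_iff_AE) (use int_pair in auto)
        then have g_AE: "AE z in \<mu> \<Otimes>\<^sub>M \<mu>. g (fst z + snd z) = g (fst z)" by simp
        \<comment> \<open>Continuous functions that agree almost everywhere for the product measure
          agree on the product of the supports: balls of radius \<open>e/3\<close> around
          \<open>u\<close> and \<open>v\<close> have positive mass and so contain a pair where
          equality holds.\<close>
        have g_supp: "g (u + v) = g u" if "u \<in> supp" "v \<in> supp" for u v
        proof -
          have "\<bar>g (u + v) - g u\<bar> \<le> e" if e: "e > 0" for e
          proof -
            have "0 < measure \<mu> (ball u (e/3)) * measure \<mu> (ball v (e/3))"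
              using \<open>u \<in> supp\<close> \<open>v \<in> supp\<close> e unfolding supp_def by (intro mult_pos_pos) auto
            then have "measure (\<mu> \<Otimes>\<^sub>M \<mu>) (ball u (e/3) \<times> ball v (e/3)) > 0"
              by (simp add: ball_times)
            moreover have "measure (\<mu> \<Otimes>\<^sub>M \<mu>) (ball u (e/3) \<times> ball v (e/3)) = 0"
              if "\<And>z. z \<in> ball u (e/3) \<times> ball v (e/3) \<Longrightarrow> g (fst z + snd z) \<noteq> g (fst z)"
            proof -
              have "AE z in \<mu> \<Otimes>\<^sub>M \<mu>. z \<notin> ball u (e/3) \<times> ball v (e/3)"
                using g_AE by eventually_elim (use that in blast)
              then show ?thesis by (subst PP.prob_eq_0) auto
            qed
            ultimately obtain z where z: "z \<in> ball u (e/3) \<times> ball v (e/3)" "g (fst z + snd z) = g (fst z)"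
              by (metis less_irrefl)
            obtain a b where ab: "z = (a, b)" by (cases z)
            have "\<bar>g (u + v) - g u\<bar> \<le> \<bar>g (u + v) - g (a + b)\<bar> + \<bar>g a - g u\<bar>"
              using z(2) ab by simp
            also have "\<dots> \<le> (dist u a + dist v b) + dist a u"
              using g_lip[of "u + v" "a + b"] g_lip[of a u] dist_triangle_add[of u v a b] by linarith
            also have "\<dots> \<le> e" using z(1) ab by (auto simp: dist_commute)
            finally show ?thesis .
          qed
          then have "\<bar>g (u + v) - g u\<bar> \<le> 0" by (rule field_le_epsilon) simp
          then show ?thesis by simp
        qed
        have iter: "real (Suc n) *\<^sub>R y \<in> supp \<and> g (real (Suc n) *\<^sub>R y) = g y" for n
        proof (induction n)
          case (Suc n)
          have "real (Suc (Suc n)) *\<^sub>R y = real (Suc n) *\<^sub>R y + y" by (simp add: algebra_simps scaleR_2)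
          then show ?case using Suc y supp_add g_supp by metis
        qed (use y in simp)
        \<comment> \<open>The multiples of \<open>y\<close> leave every ball, and \<open>f\<close>
          has bounded support.\<close>
        have "(\<lambda>n. g (real (Suc n) *\<^sub>R y)) \<longlonglongrightarrow> (\<integral>z. 0 \<partial>\<mu>)"
          unfolding g_def
        proof (rule integral_dominated_convergence[where w = "\<lambda>_. R"])
          show "AE z in \<mu>. (\<lambda>n. f (real (Suc n) *\<^sub>R y + z)) \<longlonglongrightarrow> 0"
          proof (rule AE_I2, rule tendsto_eventually)
            fix z :: 'a
            obtain N where N: "real N * norm y > R + norm z"
              using reals_Archimedean3[OF y0] by blast
            show "\<forall>\<^sub>F n in sequentially. f (real (Suc n) *\<^sub>R y + z) = 0"
            proof (rule eventually_sequentiallyI[of N])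
              fix n assume "N \<le> n"
              then have "real N * norm y \<le> real (Suc n) * norm y" by (intro mult_right_mono) auto
              moreover have "norm (real (Suc n) *\<^sub>R y) - norm z \<le> norm (real (Suc n) *\<^sub>R y + z)"
                by (rule norm_diff_ineq)
              ultimately have "norm (real (Suc n) *\<^sub>R y + z) \<ge> R"
                using N by (simp only: norm_scaleR abs_of_nat)
              then show "f (real (Suc n) *\<^sub>R y + z) = 0" by (simp add: f_def)
            qed
          qed
        qed (use f01 in auto)
        then have "g y = 0" using iter LIMSEQ_unique[OF tendsto_const] by simp
        then have "AE z in \<mu>. f (y + z) = 0"
          unfolding g_def using integral_nonneg_eq_0_iff_AE[OF f_int[of y]] f01 by simp
        then show ?thesis by eventually_elim (auto simp: f_def max_def split: if_splits)
      qed
      have "AE z in \<mu>. \<forall>n. real (Suc n) \<le> norm (y + z)"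
        using far by (subst AE_all_countable) auto
      moreover have no: "\<not> (\<forall>n. real (Suc n) \<le> norm (y + z))" for z
        using reals_Archimedean2[of "norm (y + z)"] by (metis lessI less_eq_real_def not_less of_nat_less_iff order_less_trans)
      ultimately have "AE z in \<mu>. False" by (auto elim!: eventually_mono simp del: of_nat_Suc)
      then show False by simp
    qed
  qed
  \<comment> \<open>Separability: the points outside the support are covered by countably many basic
    open null sets.\<close>
  moreover have "AE x in \<mu>. x \<in> supp"
  proof -
    obtain B :: "'a set set" where B: "countable B" "topological_basis B"
      using ex_countable_basis by blast
    have B_sets: "b \<in> sets \<mu>" if "b \<in> B" for b
      using topological_basis_open[OF B(2) that] by (simp add: sets)
    have "AE x in \<mu>. \<forall>b\<in>{b\<in>B. measure \<mu> b = 0}. x \<notin> b"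
    proof (subst AE_ball_countable)
      show "countable {b\<in>B. measure \<mu> b = 0}" using B(1) by simp
      show "\<forall>b\<in>{b\<in>B. measure \<mu> b = 0}. AE x in \<mu>. x \<notin> b"
        using B_sets prob_eq_0 by auto
    qed
    then show ?thesis
    proof eventually_elim
      case (elim x)
      show ?case unfolding supp_def
      proof safe
        fix e :: real assume "0 < e"
        then obtain b where b: "b \<in> B" "x \<in> b" "b \<subseteq> ball x e"
          using topological_basisE[OF B(2), of "ball x e" x] by auto
        then have "measure \<mu> b \<noteq> 0" using elim by blast
        then have "0 < measure \<mu> b" by (simp add: zero_less_measure_iff)
        also have "\<dots> \<le> measure \<mu> (ball x e)" using finite_measure_mono[OF b(3) ball] .
        finally show "0 < measure \<mu> (ball x e)" .
      qed
    qed
  qed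
  ultimately show ?thesis by (auto elim!: eventually_mono)
qed

section \<open>Uniformly continuous semigroups\<close>

text \<open>In finite dimension, operator-norm convergence can be tested on a basis, so strong
  continuity at 0 is already norm continuity. This brings part (a) into the setting of part
  (b).\<close>

lemma C0_semigroup_euclidean_tendsto:
  fixes T :: "real \<Rightarrow> 'a::euclidean_space \<Rightarrow>\<^sub>L 'a"
  assumes "C0_semigroup T"
  shows "(T \<longlongrightarrow> id_blinfun) (at_right 0)"
proof (rule tendsto_componentwise1)
  fix j :: 'a
  have "((\<lambda>t. T t j) \<longlongrightarrow> T 0 j) (at 0 within {0..})"
  proof -
    have "continuous_on {0..} (\<lambda>t. T t j)" using assms unfolding C0_semigroup_def by blast
    then show ?thesis by (simp add: continuous_on_def)
  qed
  then have "((\<lambda>t. T t j) \<longlongrightarrow> T 0 j) (at_right 0)"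
    by (rule tendsto_within_subset) auto
  then show "((\<lambda>t. T t j) \<longlongrightarrow> id_blinfun j) (at_right 0)"
    using assms by (simp add: C0_semigroup_def)
qed

text \<open>Subtracting the identity drops the term \<open>n = 0\<close>; the rest is dominated term
  by term by the scalar exponential series.\<close>

lemma norm_blinfun_exp_minus_id_le:
  fixes A :: "'a::banach \<Rightarrow>\<^sub>L 'a"
  shows "norm (blinfun_exp A - id_blinfun) \<le> exp (norm A) - 1"
proof -
  let ?f = "\<lambda>n. blinfun_pow A n /\<^sub>R fact n"
  have s: "summable (\<lambda>n. norm A ^ n /\<^sub>R fact n)" by (rule summable_exp_generic)
  have le: "norm (?f n) \<le> norm A ^ n /\<^sub>R fact n" for n
    using norm_blinfun_pow_le[of A n] by (simp add: field_simps)
  have "blinfun_exp A - id_blinfun = (\<Sum>n. ?f (Suc n))"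
    unfolding blinfun_exp_def by (subst suminf_split_head[OF summable_blinfun_exp]) simp
  also have "norm \<dots> \<le> (\<Sum>n. norm A ^ Suc n /\<^sub>R fact (Suc n))"
    by (rule norm_suminf_le[OF le]) (use s summable_Suc_iff[of "\<lambda>n. norm A ^ n /\<^sub>R fact n"] in simp)
  also have "\<dots> = exp (norm A) - 1"
    by (subst suminf_split_head[OF s]) (simp add: exp_def)
  finally show ?thesis .
qed

lemma blinfun_exp_tendsto_id:
  fixes Q :: "'a::banach \<Rightarrow>\<^sub>L 'a"
  shows "((\<lambda>t. blinfun_exp (t *\<^sub>R Q)) \<longlongrightarrow> id_blinfun) (at_right 0)"
proof (rule Lim_null_comparison[THEN Lim_null[THEN iffD2]])
  show "\<forall>\<^sub>F t in at_right 0. norm (blinfun_exp (t *\<^sub>R Q) - id_blinfun) \<le> exp (norm (t *\<^sub>R Q)) - 1"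
    by (simp add: norm_blinfun_exp_minus_id_le del: norm_scaleR)
  show "((\<lambda>t. exp (norm (t *\<^sub>R Q)) - 1) \<longlongrightarrow> 0) (at_right 0)"
    by (rule tendsto_eq_intros refl | simp)+
qed

text \<open>Common setting of both parts. No generator is given: boundedness, the Lipschitz estimate
  and the inverses below all come from the semigroup law and norm convergence at 0.\<close>

locale uniformly_continuous_semigroup =
  fixes T :: "real \<Rightarrow> 'a::banach \<Rightarrow>\<^sub>L 'a"
  assumes T_0: "T 0 = id_blinfun"
    and T_add: "\<And>s t. 0 \<le> s \<Longrightarrow> 0 \<le> t \<Longrightarrow> T t o\<^sub>L T s = T (t + s)"
    and T_tendsto_0: "(T \<longlongrightarrow> id_blinfun) (at_right 0)"
begin

lemma T_add_apply: "0 \<le> s \<Longrightarrow> 0 \<le> t \<Longrightarrow> T t (T s x) = T (t + s) x"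
  using T_add[of s t] by (metis blinfun_apply_blinfun_compose)

lemma T_near_id: obtains \<delta> where "\<delta> > 0" "\<And>t. 0 \<le> t \<Longrightarrow> t \<le> \<delta> \<Longrightarrow> norm (T t - id_blinfun) \<le> 1/2"
proof -
  have "eventually (\<lambda>t. dist (T t) id_blinfun < 1/2) (at_right 0)"
    using T_tendsto_0 by (rule tendstoD) simp
  then obtain b where "b > 0" "\<And>t. 0 < t \<Longrightarrow> t < b \<Longrightarrow> dist (T t) id_blinfun < 1/2"
    unfolding eventually_at_right_field by auto
  then have "norm (T t - id_blinfun) \<le> 1/2" if "0 \<le> t" "t \<le> b/2" for t
  proof (cases "t = 0")
    case False
    then have "0 < t" "t < b" using that \<open>b > 0\<close> by auto
    then have "dist (T t) id_blinfun < 1/2"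
      by (rule \<open>\<And>t. 0 < t \<Longrightarrow> t < b \<Longrightarrow> dist (T t) id_blinfun < 1/2\<close>)
    then show ?thesis by (simp add: dist_norm)
  qed (simp add: T_0)
  with \<open>b > 0\<close> show ?thesis by (intro that[of "b/2"]) auto
qed

\<comment> \<open>From \<open>T (2 h) - I = 2 A + A\<^sup>2\<close> with \<open>A = T h - I\<close>.\<close>
lemma norm_T_double:
  assumes "0 \<le> h"
  shows "2 * norm (T h - id_blinfun) - (norm (T h - id_blinfun))\<^sup>2 \<le> norm (T (2 * h) - id_blinfun)"
proof -
  let ?A = "T h - id_blinfun"
  have "T (2 * h) - id_blinfun = 2 *\<^sub>R ?A + (?A o\<^sub>L ?A)"
    using T_add[OF assms assms, symmetric]
    by (intro blinfun_eqI) (simp add: blinfun.bilinear_simps scaleR_2)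
  then have "2 *\<^sub>R ?A = (T (2 * h) - id_blinfun) - (?A o\<^sub>L ?A)" by simp
  then have "2 * norm ?A = norm ((T (2 * h) - id_blinfun) - (?A o\<^sub>L ?A))"
    by (metis norm_scaleR abs_numeral)
  also have "\<dots> \<le> norm (T (2 * h) - id_blinfun) + norm (?A o\<^sub>L ?A)" by (rule norm_triangle_ineq4)
  also have "norm (?A o\<^sub>L ?A) \<le> (norm ?A)\<^sup>2"
    using norm_blinfun_compose[of ?A ?A] by (simp add: power2_eq_square)
  finally show ?thesis by simp
qed

text \<open>With a(t) the norm of T_t - I, the doubling estimate reads 1 - a(2t) \<le> (1 - a(t))^2,
  hence 1 - a(2^k t) \<le> (1 - a(t))^(2^k). Choosing k with 2^k t comparable to \<delta> keeps the
  left side at least 1/2, which forces 2^k a(t) \<le> 1; so a(t) is of order t.\<close>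

lemma T_lipschitz_0:
  obtains \<delta> C where "\<delta> > 0" "C \<ge> 0" "\<And>t. 0 \<le> t \<Longrightarrow> t \<le> \<delta> \<Longrightarrow> norm (T t - id_blinfun) \<le> C * t"
proof -
  obtain \<delta> where \<delta>: "\<delta> > 0" "\<And>t. 0 \<le> t \<Longrightarrow> t \<le> \<delta> \<Longrightarrow> norm (T t - id_blinfun) \<le> 1/2"
    by (rule T_near_id) blast
  define a where "a t = norm (T t - id_blinfun)" for t
  have a_nonneg: "0 \<le> a t" for t by (simp add: a_def)
  have a_half: "a t \<le> 1/2" if "0 \<le> t" "t \<le> \<delta>" for t using \<delta>(2)[OF that] by (simp add: a_def)
  have pow: "1 - a (2 ^ k * t) \<le> (1 - a t) ^ (2 ^ k)" if "0 \<le> t" "2 ^ k * t \<le> \<delta>" for k t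
    using that
  proof (induction k arbitrary: t)
    case (Suc k)
    have "1 - a (2 ^ Suc k * t) \<le> (1 - a (2 * t)) ^ (2 ^ k)"
      using Suc.IH[of "2 * t"] Suc.prems by (simp add: mult_ac)
    also have "\<dots> \<le> ((1 - a t)\<^sup>2) ^ (2 ^ k)"
    proof (rule power_mono)
      show "1 - a (2 * t) \<le> (1 - a t)\<^sup>2"
        using norm_T_double[OF Suc.prems(1)] unfolding a_def power2_eq_square by (simp add: algebra_simps)
      have "2 * t \<le> 2 ^ Suc k * t" using Suc.prems(1) by (intro mult_right_mono) auto
      then show "0 \<le> 1 - a (2 * t)" using a_half[of "2 * t"] Suc.prems by auto
    qed
    finally show ?case by (simp add: power_mult)
  qed simp
  have lip: "a t \<le> (4 / \<delta>) * t" if t: "0 \<le> t" "t \<le> \<delta>" for t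
  proof (cases "t = 0")
    case True
    then show ?thesis by (simp add: a_def T_0)
  next
    case False
    define P where "P k \<longleftrightarrow> 2 ^ k * t > \<delta>" for k
    have "\<exists>k. P k"
    proof -
      obtain k where "\<delta> / t < 2 ^ k" using real_arch_pow[of 2 "\<delta> / t"] by auto
      then show ?thesis using t False by (auto simp: P_def field_simps)
    qed
    \<comment> \<open>The last doubling that stays within \<delta> is \<open>k = m - 1\<close>;
      minimality of \<open>m\<close> places \<open>2 ^ k * t\<close> between \<delta> / 2 and
      \<delta>.\<close>
    define m where "m = (LEAST k. P k)"
    have m: "P m" unfolding m_def using \<open>\<exists>k. P k\<close> by (rule LeastI_ex)
    have "m \<noteq> 0" using m t by (auto simp: P_def intro: Nat.gr0I)
    then obtain k where k: "m = Suc k" by (cases m) auto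
    have "\<not> P k" using not_less_Least[of k P] k by (simp add: m_def)
    then have kt: "2 ^ k * t \<le> \<delta>" "2 ^ k * t > \<delta> / 2" using m by (auto simp: P_def k)
    have at: "a t \<le> 1/2" using a_half t by auto
    have "1/2 \<le> (1 - a t) ^ (2 ^ k)"
      using pow[OF t(1) kt(1)] a_half[of "2 ^ k * t"] kt t by auto
    \<comment> \<open>\<open>1 - a \<le> 1 / (1 + a)\<close> and Bernoulli's inequality\<close>
    also have "(1 - a t) ^ (2 ^ k) * (1 + real (2 ^ k) * a t) \<le> (1 - a t) ^ (2 ^ k) * (1 + a t) ^ (2 ^ k)"
      using at a_nonneg[of t] by (intro mult_left_mono Bernoulli_inequality) auto
    then have "(1 - a t) ^ (2 ^ k) * (1 + real (2 ^ k) * a t) \<le> (1 - (a t)\<^sup>2) ^ (2 ^ k)"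
      by (simp add: power_mult_distrib[symmetric] power2_eq_square algebra_simps)
    then have "(1 - a t) ^ (2 ^ k) * (1 + real (2 ^ k) * a t) \<le> 1"
      using at a_nonneg[of t] power_le_one[of "1 - (a t)\<^sup>2" "2 ^ k"] abs_square_le_1[of "a t"] by simp
    then have "(1 - a t) ^ (2 ^ k) \<le> 1 / (1 + real (2 ^ k) * a t)"
      using a_nonneg[of t] by (subst pos_le_divide_eq) (auto intro: add_pos_nonneg)
    finally have "1 + real (2 ^ k) * a t \<le> 2"
      using a_nonneg[of t] by (simp add: field_simps add_pos_nonneg split: if_splits)
    then have "real (2 ^ k) * a t * (\<delta> / 2) \<le> 1 * (2 ^ k * t)"
      using kt a_nonneg[of t] \<delta>(1) by (intro mult_mono) auto
    then have "a t * (\<delta> / 2) \<le> t" by (simp add: mult.assoc)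
    then have "a t \<le> 2 / \<delta> * t" using \<delta>(1) by (simp add: field_simps)
    also have "\<dots> \<le> 4 / \<delta> * t" using \<delta>(1) t by (intro mult_right_mono divide_right_mono) auto
    finally show ?thesis .
  qed
  show ?thesis
    by (rule that[of \<delta> "4 / \<delta>"]) (use \<delta>(1) lip in \<open>auto simp: a_def\<close>)
qed

lemma T_bounded: obtains C where "C > 0" "\<And>t. 0 \<le> t \<Longrightarrow> t \<le> K \<Longrightarrow> norm (T t) \<le> C"
proof -
  obtain \<delta> where \<delta>: "\<delta> > 0" "\<And>t. 0 \<le> t \<Longrightarrow> t \<le> \<delta> \<Longrightarrow> norm (T t - id_blinfun) \<le> 1/2"
    by (rule T_near_id) blast
  have small: "norm (T t) \<le> 2" if "0 \<le> t" "t \<le> \<delta>" for t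
    using norm_triangle_ineq[of "T t - id_blinfun" id_blinfun] \<delta>(2)[OF that] norm_blinfun_id_le[where 'a='a] by simp
  have mult: "norm (T (real n * t)) \<le> 2 ^ n" if "0 \<le> t" "t \<le> \<delta>" for n t
  proof (induction n)
    case 0
    show ?case using norm_blinfun_id_le by (simp add: T_0)
  next
    case (Suc n)
    have "T (real (Suc n) * t) = T t o\<^sub>L T (real n * t)"
      using that by (subst T_add) (auto simp: algebra_simps)
    then have "norm (T (real (Suc n) * t)) \<le> norm (T t) * norm (T (real n * t))"
      by (simp add: norm_blinfun_compose)
    also have "\<dots> \<le> 2 * 2 ^ n" using small[OF that] Suc by (intro mult_mono) auto
    finally show ?case by simp
  qed
  obtain N where N: "real N * \<delta> > K" using reals_Archimedean3[OF \<delta>(1)] by blast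
  have "norm (T t) \<le> 2 ^ N" if "0 \<le> t" "t \<le> K" for t
  proof -
    have "N > 0" using N that by (cases N) auto
    then show ?thesis
      using mult[of "t / N" N] that N by (simp add: field_simps)
  qed
  then show ?thesis by (intro that[of "2 ^ N"]) auto
qed

text \<open>Short time gaps factor through T_{t-s} - I and use the estimate at 0; gaps longer than
  \<delta> use the crude bound 2B, absorbed by (2B / \<delta>)(t - s).\<close>

lemma T_lipschitz:
  obtains L where "L \<ge> 0" "\<And>s t. s \<in> {0..K} \<Longrightarrow> t \<in> {0..K} \<Longrightarrow> norm (T t - T s) \<le> L * \<bar>t - s\<bar>"
proof -
  obtain \<delta> C where \<delta>: "\<delta> > 0" "C \<ge> 0" "\<And>t. 0 \<le> t \<Longrightarrow> t \<le> \<delta> \<Longrightarrow> norm (T t - id_blinfun) \<le> C * t"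
    by (rule T_lipschitz_0) blast
  obtain B where B: "B > 0" "\<And>t. 0 \<le> t \<Longrightarrow> t \<le> K \<Longrightarrow> norm (T t) \<le> B"
    by (rule T_bounded) blast
  define L where "L = B * C + 2 * B / \<delta>"
  have L: "norm (T t - T s) \<le> L * (t - s)" if "0 \<le> s" "s \<le> t" "t \<le> K" for s t
  proof (cases "t - s \<le> \<delta>")
    case True
    have "T t - T s = (T (t - s) - id_blinfun) o\<^sub>L T s"
      using that T_add_apply[of s "t - s"] by (intro blinfun_eqI) (simp add: blinfun.bilinear_simps)
    then have "norm (T t - T s) \<le> norm (T (t - s) - id_blinfun) * norm (T s)"
      by (simp add: norm_blinfun_compose)
    also have "\<dots> \<le> (C * (t - s)) * B"
      using that True \<delta> B by (intro mult_mono) auto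
    also have "\<dots> \<le> L * (t - s)"
      using that \<delta> B unfolding L_def by (simp add: algebra_simps mult_left_mono)
    finally show ?thesis .
  next
    case False
    have "norm (T t - T s) \<le> B + B"
      using norm_triangle_ineq4[of "T t" "T s"] B(2)[of t] B(2)[of s] that by simp
    also have "\<dots> = 2 * B / \<delta> * \<delta>" using \<delta> by simp
    also have "\<dots> \<le> 2 * B / \<delta> * (t - s)"
      using False \<delta> B by (intro mult_left_mono) auto
    also have "\<dots> \<le> L * (t - s)"
      using that \<delta> B by (intro mult_right_mono) (auto simp: L_def)
    finally show ?thesis .
  qed
  show ?thesis
  proof (rule that)
    show "L \<ge> 0" using \<delta> B by (auto simp: L_def)
    show "norm (T t - T s) \<le> L * \<bar>t - s\<bar>" if "s \<in> {0..K}" "t \<in> {0..K}" for s t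
      using L[of s t] L[of t s] that by (cases "s \<le> t") (auto simp: norm_minus_commute)
  qed
qed

text \<open>For small t, T_t is within 1/2 of the identity, hence bounded below and, by a
  contraction argument, onto; composing N small steps carries both properties to [0, K] with
  constant 2^N. The bound on \<open>R\<close> over compact time intervals later transfers smallness
  of \<rho> to the increment laws.\<close>

lemma T_inverse:
  obtains R :: "real \<Rightarrow> 'a \<Rightarrow>\<^sub>L 'a"
  where "\<And>t x. 0 \<le> t \<Longrightarrow> T t (R t x) = x" "\<And>t x. 0 \<le> t \<Longrightarrow> R t (T t x) = x"
    "\<And>K. \<exists>C. \<forall>t. 0 \<le> t \<and> t \<le> K \<longrightarrow> norm (R t) \<le> C"
proof -
  obtain \<delta> where \<delta>: "\<delta> > 0" "\<And>t. 0 \<le> t \<Longrightarrow> t \<le> \<delta> \<Longrightarrow> norm (T t - id_blinfun) \<le> 1/2"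
    by (rule T_near_id) blast
  have lower: "norm x \<le> 2 * norm (T t x)" if "0 \<le> t" "t \<le> \<delta>" for t x
  proof -
    have "norm ((T t - id_blinfun) x) \<le> 1/2 * norm x"
      using norm_blinfun[of "T t - id_blinfun" x] mult_right_mono[OF \<delta>(2)[OF that], of "norm x"] by simp
    then show ?thesis
      using norm_triangle_ineq2[of x "T t x"] by (simp add: blinfun.bilinear_simps norm_minus_commute)
  qed
  have small_surj: "\<exists>x. T t x = y" if "0 \<le> t" "t \<le> \<delta>" for t y
  proof -
    \<comment> \<open>Fixed points of this 1/2-contraction are the solutions of
      \<open>T t x = y\<close>.\<close>
    have "\<exists>!x\<in>UNIV. y + (x - T t x) = x"
    proof (rule Banach_fix[where c = "1/2"])
      fix x z
      have "dist (y + (x - T t x)) (y + (z - T t z)) = norm ((T t - id_blinfun) (z - x))"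
        by (simp add: dist_norm blinfun.bilinear_simps algebra_simps)
      also have "\<dots> \<le> 1/2 * norm (z - x)"
        using norm_blinfun[of "T t - id_blinfun" "z - x"] mult_right_mono[OF \<delta>(2)[OF that], of "norm (z - x)"] by simp
      finally show "dist (y + (x - T t x)) (y + (z - T t z)) \<le> 1/2 * dist x z"
        by (simp add: dist_norm norm_minus_commute)
    qed (auto simp: complete_UNIV)
    then show ?thesis by (auto simp: algebra_simps)
  qed
  have iter: "(\<forall>y. \<exists>x. T (real n * t) x = y) \<and> (\<forall>x. norm x \<le> 2 ^ n * norm (T (real n * t) x))"
    if "0 \<le> t" "t \<le> \<delta>" for n t
  proof (induction n)
    case 0
    show ?case by (simp add: T_0)
  next
    case (Suc n)
    have eq: "T (real (Suc n) * t) x = T t (T (real n * t) x)" for x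
      using that by (subst T_add_apply) (auto simp: algebra_simps)
    have "norm x \<le> 2 ^ Suc n * norm (T (real (Suc n) * t) x)" for x
    proof -
      have "norm x \<le> 2 ^ n * norm (T (real n * t) x)" using Suc by blast
      also have "\<dots> \<le> 2 ^ n * (2 * norm (T t (T (real n * t) x)))"
        using lower[OF that] by (intro mult_left_mono) auto
      finally show ?thesis unfolding eq by simp
    qed
    moreover have "\<exists>x. T (real (Suc n) * t) x = y" for y
      using Suc small_surj[OF that] unfolding eq by metis
    ultimately show ?case by blast
  qed
  have main: "\<exists>N. \<forall>t. 0 \<le> t \<and> t \<le> K \<longrightarrow> (\<forall>y. \<exists>x. T t x = y) \<and> (\<forall>x. norm x \<le> 2 ^ N * norm (T t x))" for K
  proof -
    obtain N where N: "real N * \<delta> > K" using reals_Archimedean3[OF \<delta>(1)] by blast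
    have "(\<forall>y. \<exists>x. T t x = y) \<and> (\<forall>x. norm x \<le> 2 ^ N * norm (T t x))" if "0 \<le> t" "t \<le> K" for t
    proof -
      have "N > 0" using N that by (cases N) auto
      then show ?thesis using iter[of "t / N" N] that N by (simp add: field_simps)
    qed
    then show ?thesis by blast
  qed
  have main': "\<exists>N :: nat. (\<forall>y. \<exists>x. T t x = y) \<and> (\<forall>x. norm x \<le> 2 ^ N * norm (T t x))" if "0 \<le> t" for t
  proof -
    obtain N where N: "\<forall>s. 0 \<le> s \<and> s \<le> t \<longrightarrow> (\<forall>y. \<exists>x. T s x = y) \<and> (\<forall>x. norm x \<le> 2 ^ N * norm (T s x))"
      using main[of t] by blast
    show ?thesis by (rule exI[of _ N]) (use N[rule_format, of t] that in auto)
  qed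
  define r where "r t = inv (blinfun_apply (T t))" for t
  have bij: "bij (T t)" if t0: "0 \<le> t" for t
  proof -
    obtain N where N: "\<And>y. \<exists>x. T t x = y" "\<And>x. norm x \<le> 2 ^ N * norm (T t x)"
      using main'[OF t0] by blast
    have "inj (T t)"
    proof (rule injI)
      fix x y assume "T t x = T t y"
      then show "x = y" using N(2)[of "x - y"] by (simp add: blinfun.bilinear_simps)
    qed
    moreover have "surj (T t)" using N(1) by (metis surjI)
    ultimately show ?thesis by (simp add: bij_def)
  qed
  have Tr: "T t (r t x) = x" and rT: "r t (T t x) = x" if "0 \<le> t" for t x
    using bij[OF that] by (auto simp: r_def bij_def surj_f_inv_f inv_f_f)
  have r_blin: "bounded_linear (r t)" if t0: "0 \<le> t" for t
  proof -
    obtain N where N: "\<And>x. norm x \<le> 2 ^ N * norm (T t x)" using main'[OF t0] by blast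
    show ?thesis
    proof (rule bounded_linear_intro)
      show "r t (x + y) = r t x + r t y" for x y
        using that by (metis Tr rT blinfun.add_right)
      show "r t (a *\<^sub>R x) = a *\<^sub>R r t x" for a x
        using that by (metis Tr rT blinfun.scaleR_right)
      show "norm (r t x) \<le> norm x * 2 ^ N" for x
        using N[of "r t x"] Tr[OF that] by (simp add: mult.commute)
    qed
  qed
  define R where "R t = Blinfun (r t)" for t
  have R: "blinfun_apply (R t) = r t" if "0 \<le> t" for t
    using r_blin[OF that] by (simp add: R_def bounded_linear_Blinfun_apply)
  show ?thesis
  proof (rule that)
    show "T t (R t x) = x" "R t (T t x) = x" if "0 \<le> t" for t x
      using that by (simp_all add: R Tr rT)
    show "\<exists>C. \<forall>t. 0 \<le> t \<and> t \<le> K \<longrightarrow> norm (R t) \<le> C" for K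
    proof -
      obtain N where N: "\<And>t x. 0 \<le> t \<Longrightarrow> t \<le> K \<Longrightarrow> norm x \<le> 2 ^ N * norm (T t x)"
        using main[of K] by blast
      have "norm (R t) \<le> 2 ^ N" if "0 \<le> t" "t \<le> K" for t
        by (rule norm_blinfun_bound) (use N[OF that] that in \<open>simp_all add: R, metis Tr\<close>)
      then show ?thesis by blast
    qed
  qed
qed

end

section \<open>Pathwise integration against cadlag functions\<close>

lemma Cauchy_filter_limit:
  fixes f :: "'a \<Rightarrow> 'b::complete_space"
  assumes "F \<noteq> bot"
    and "\<And>e. e > 0 \<Longrightarrow> \<exists>P. eventually P F \<and> (\<forall>x y. P x \<and> P y \<longrightarrow> dist (f x) (f y) < e)"
  obtains l where "(f \<longlongrightarrow> l) F"
proof -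
  have "cauchy_filter (filtermap f F)"
    using assms(2) by (simp add: cauchy_filter_metric_filtermap)
  moreover have "filtermap f F \<noteq> bot" using assms(1) by (simp add: filtermap_bot_iff)
  ultimately obtain l where "filtermap f F \<le> nhds l"
    using complete_UNIV[where 'a = 'b] unfolding complete_uniform by auto
  then show ?thesis by (intro that[of l]) (simp add: filterlim_def)
qed

section \<open>Partitions of an interval\<close>

lemma is_partition_strict_mono:
  assumes "is_partition a b n t" "i < j" "j \<le> n"
  shows "t i < t j"
  using assms(2,3)
proof (induction j)
  case (Suc j)
  have "t j < t (Suc j)" using assms(1) Suc.prems by (simp add: is_partition_def)
  with Suc show ?case by (cases "i = j") auto
qed simp

lemma is_partition_mono: "is_partition a b n t \<Longrightarrow> i \<le> j \<Longrightarrow> j \<le> n \<Longrightarrow> t i \<le> t j"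
  using is_partition_strict_mono[of a b n t i j] by (cases "i = j") auto

lemma is_partition_mem: "is_partition a b n t \<Longrightarrow> i \<le> n \<Longrightarrow> t i \<in> {a..b}"
  using is_partition_mono[of a b n t 0 i] is_partition_mono[of a b n t i n]
  by (auto simp: is_partition_def)

lemma is_partition_uniform:
  assumes "a < b" "n > 0"
  shows "is_partition a b n (\<lambda>i. a + real i * ((b - a) / real n))"
  using assms by (auto simp: is_partition_def field_simps)

lemma uniform_partition_step:
  "a + real (Suc i) * h - (a + real i * h) = h"
  by (simp add: algebra_simps)

lemma partition_mesh_exists:
  assumes "a \<le> b" "\<delta> > 0"
  obtains n t where "is_partition a b n t" "\<forall>i<n. t (Suc i) - t i < \<delta>"
proof (cases "a = b")
  case True
  then show ?thesis using that[of 0 "\<lambda>_. a"] by (simp add: is_partition_def)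
next
  case False
  with assms have "a < b" by simp
  obtain n where n: "real n * \<delta> > b - a" using reals_Archimedean3[OF assms(2)] by blast
  then have "n > 0" using \<open>a < b\<close> by (cases n) auto
  have "(b - a) / real n < \<delta>" using n \<open>n > 0\<close> by (simp add: pos_divide_less_eq mult.commute)
  then show ?thesis
    using that[OF is_partition_uniform[OF \<open>a < b\<close> \<open>n > 0\<close>]] unfolding uniform_partition_step by blast
qed

text \<open>Left end points for the integrand, so that summation by parts produces exactly the sums
  of \<open>has_dg_integral\<close>, which evaluate \<open>y\<close> at right end points.\<close>

definition dy_sum ::
  "(real \<Rightarrow> 'a \<Rightarrow>\<^sub>L 'a) \<Rightarrow> (real \<Rightarrow> 'a::real_normed_vector) \<Rightarrow> nat \<Rightarrow> (nat \<Rightarrow> real) \<Rightarrow> 'a" where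
  "dy_sum g y n t = (\<Sum>i<n. g (t i) (y (t (Suc i)) - y (t i)))"

definition has_dy_integral ::
  "(real \<Rightarrow> 'a \<Rightarrow>\<^sub>L 'a) \<Rightarrow> (real \<Rightarrow> 'a::real_normed_vector) \<Rightarrow> real \<Rightarrow> real \<Rightarrow> 'a \<Rightarrow> bool" where
  "has_dy_integral g y a b I \<longleftrightarrow>
     (\<forall>\<epsilon>>0. \<exists>\<delta>>0. \<forall>n t. is_partition a b n t \<and> (\<forall>i<n. t (Suc i) - t i < \<delta>) \<longrightarrow>
        norm (dy_sum g y n t - I) < \<epsilon>)"

lemma dy_sum_by_parts:
  "dy_sum g y n t =
     g (t n) (y (t n)) - g (t 0) (y (t 0)) - (\<Sum>i<n. (g (t (Suc i)) - g (t i)) (y (t (Suc i))))"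
  by (induction n) (simp_all add: dy_sum_def blinfun.bilinear_simps)

text \<open>Summation by parts is exact on each partition, so the two notions of limit coincide. The
  \<open>dy\<close> form sees only increments of \<open>y\<close>, which makes step functions easy;
  the \<open>dg\<close> form is the one in the definition of the random integral.\<close>

lemma has_dy_integral_iff_dg:
  "has_dy_integral g y a b I \<longleftrightarrow> has_dg_integral g y a b (g b (y b) - g a (y a) - I)"
proof -
  have "norm (dy_sum g y n t - I) =
      norm ((\<Sum>i<n. (g (t (Suc i)) - g (t i)) (y (t (Suc i)))) - (g b (y b) - g a (y a) - I))"
    if "is_partition a b n t" for n t
    using that by (subst norm_minus_commute) (simp add: dy_sum_by_parts is_partition_def algebra_simps)
  then show ?thesis
    unfolding has_dy_integral_def has_dg_integral_def by simp
qed

lemma has_dy_integral_unique: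
  assumes "a \<le> b" "has_dy_integral g y a b I" "has_dy_integral g y a b J"
  shows "I = J"
  using has_dg_integral_unique[OF assms(1)] assms(2,3) unfolding has_dy_integral_iff_dg
  by (metis diff_left_imp_eq)

lemma has_dy_integral_add:
  assumes "has_dy_integral g y a b I" "has_dy_integral g z a b J"
  shows "has_dy_integral g (\<lambda>s. y s + z s) a b (I + J)"
  unfolding has_dy_integral_def
proof safe
  fix e :: real assume "e > 0"
  then have "e / 2 > 0" by simp
  obtain d1 where d1: "d1 > 0" "\<And>n t. is_partition a b n t \<Longrightarrow> (\<forall>i<n. t (Suc i) - t i < d1) \<Longrightarrow>
      norm (dy_sum g y n t - I) < e / 2"
    using assms(1) \<open>e / 2 > 0\<close> unfolding has_dy_integral_def by meson
  obtain d2 where d2: "d2 > 0" "\<And>n t. is_partition a b n t \<Longrightarrow> (\<forall>i<n. t (Suc i) - t i < d2) \<Longrightarrow>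
      norm (dy_sum g z n t - J) < e / 2"
    using assms(2) \<open>e / 2 > 0\<close> unfolding has_dy_integral_def by meson
  show "\<exists>\<delta>>0. \<forall>n t. is_partition a b n t \<and> (\<forall>i<n. t (Suc i) - t i < \<delta>) \<longrightarrow>
      norm (dy_sum g (\<lambda>s. y s + z s) n t - (I + J)) < e"
  proof (intro exI[of _ "min d1 d2"] conjI allI impI)
    fix n t assume t: "is_partition a b n t \<and> (\<forall>i<n. t (Suc i) - t i < min d1 d2)"
    have "dy_sum g (\<lambda>s. y s + z s) n t = dy_sum g y n t + dy_sum g z n t"
      by (simp add: dy_sum_def sum.distrib[symmetric] blinfun.bilinear_simps algebra_simps)
    then have "dy_sum g (\<lambda>s. y s + z s) n t - (I + J) = (dy_sum g y n t - I) + (dy_sum g z n t - J)"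
      by simp
    then have "norm (dy_sum g (\<lambda>s. y s + z s) n t - (I + J)) \<le> norm (dy_sum g y n t - I) + norm (dy_sum g z n t - J)"
      by (simp only: norm_triangle_ineq)
    also have "\<dots> < e" using d1(2)[of n t] d2(2)[of n t] t by force
    finally show "norm (dy_sum g (\<lambda>s. y s + z s) n t - (I + J)) < e" .
  qed (use d1 d2 in simp)
qed

lemma has_dy_integral_minus:
  assumes "has_dy_integral g y a b I"
  shows "has_dy_integral g (\<lambda>s. - y s) a b (- I)"
proof -
  have "dy_sum g (\<lambda>s. - y s) n t - (- I) = - (dy_sum g y n t - I)" for n t
  proof -
    have "- y (t (Suc i)) - (- y (t i)) = - (y (t (Suc i)) - y (t i))" for i by simp
    then show ?thesis by (simp only: dy_sum_def blinfun.minus_right sum_negf) simp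
  qed
  then show ?thesis using assms unfolding has_dy_integral_def by (simp only: norm_minus_cancel)
qed

lemma has_dy_integral_const: "has_dy_integral g (\<lambda>s. v) a b 0"
  by (auto simp: has_dy_integral_def dy_sum_def intro: exI[of _ 1])

lemma has_dy_integral_cong:
  assumes "\<And>s. s \<in> {a..b} \<Longrightarrow> y s = z s"
  shows "has_dy_integral g y a b I \<longleftrightarrow> has_dy_integral g z a b I"
proof -
  have "dy_sum g y n t = dy_sum g z n t" if "is_partition a b n t" for n t
    unfolding dy_sum_def using assms is_partition_mem[OF that] by (intro sum.cong) auto
  then show ?thesis unfolding has_dy_integral_def by simp
qed

text \<open>Bounded Lipschitz integrands: a setting in which the integral is continuous under
  uniform convergence of the integrator.\<close>

locale lipschitz_integrand =
  fixes g :: "real \<Rightarrow> 'a::banach \<Rightarrow>\<^sub>L 'a" and a b C L :: real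
  assumes ab: "a \<le> b"
    and g_bound: "\<And>s. s \<in> {a..b} \<Longrightarrow> norm (g s) \<le> C"
    and L_nonneg: "0 \<le> L"
    and g_lip: "\<And>s t. s \<in> {a..b} \<Longrightarrow> t \<in> {a..b} \<Longrightarrow> norm (g t - g s) \<le> L * \<bar>t - s\<bar>"
begin

lemma C_nonneg: "0 \<le> C"
  using order_trans[OF norm_ge_zero g_bound[of a]] ab by simp

text \<open>After summation by parts the boundary terms cost 2C and the remaining sum at most the
  variation L(b - a) of \<open>g\<close>, each times the bound on \<open>y\<close>. Neither the
  partition nor the variation of \<open>y\<close> enters.\<close>

lemma dy_sum_bound:
  assumes t: "is_partition a b n t" and y: "\<And>s. s \<in> {a..b} \<Longrightarrow> norm (y s) \<le> B"
  shows "norm (dy_sum g y n t) \<le> (2 * C + L * (b - a)) * B"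
proof -
  have B: "0 \<le> B" using order_trans[OF norm_ge_zero y[of a]] ab by simp
  have app: "norm (g s (y s)) \<le> C * B" if "s \<in> {a..b}" for s
    by (rule order_trans[OF norm_blinfun mult_mono[OF g_bound[OF that] y[OF that] C_nonneg norm_ge_zero]])
  have "norm (\<Sum>i<n. (g (t (Suc i)) - g (t i)) (y (t (Suc i)))) \<le> (\<Sum>i<n. L * (t (Suc i) - t i) * B)"
  proof (rule sum_norm_le)
    fix i assume "i \<in> {..<n}"
    then have i: "t i \<in> {a..b}" "t (Suc i) \<in> {a..b}" "t i \<le> t (Suc i)"
      using is_partition_mem[OF t] is_partition_mono[OF t] by auto
    have "norm ((g (t (Suc i)) - g (t i)) (y (t (Suc i)))) \<le> norm (g (t (Suc i)) - g (t i)) * norm (y (t (Suc i)))"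
      by (rule norm_blinfun)
    also have "\<dots> \<le> (L * (t (Suc i) - t i)) * B"
      using g_lip[OF i(1,2)] y[OF i(2)] i L_nonneg by (intro mult_mono) auto
    finally show "norm ((g (t (Suc i)) - g (t i)) (y (t (Suc i)))) \<le> L * (t (Suc i) - t i) * B" .
  qed
  also have "\<dots> = L * (\<Sum>i<n. t (Suc i) - t i) * B"
    by (simp add: sum_distrib_left sum_distrib_right)
  also have "(\<Sum>i<n. t (Suc i) - t i) = b - a"
    using t by (simp add: sum_lessThan_telescope is_partition_def)
  finally have "norm (\<Sum>i<n. (g (t (Suc i)) - g (t i)) (y (t (Suc i)))) \<le> L * (b - a) * B" .
  moreover have "norm (g (t n) (y (t n)) - g (t 0) (y (t 0))) \<le> C * B + C * B"
    by (intro order_trans[OF norm_triangle_ineq4] add_mono app is_partition_mem[OF t]) auto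
  ultimately show ?thesis
    unfolding dy_sum_by_parts
    using norm_triangle_ineq4[of "g (t n) (y (t n)) - g (t 0) (y (t 0))" "\<Sum>i<n. (g (t (Suc i)) - g (t i)) (y (t (Suc i)))"]
    by (simp add: algebra_simps)
qed

lemma has_dy_integral_bound:
  assumes "has_dy_integral g y a b I" and y: "\<And>s. s \<in> {a..b} \<Longrightarrow> norm (y s) \<le> B"
  shows "norm I \<le> (2 * C + L * (b - a)) * B"
proof (rule field_le_epsilon)
  fix e :: real assume "e > 0"
  then obtain d where d: "d > 0" "\<And>n t. is_partition a b n t \<Longrightarrow> (\<forall>i<n. t (Suc i) - t i < d) \<Longrightarrow>
      norm (dy_sum g y n t - I) < e"
    using assms(1) unfolding has_dy_integral_def by meson
  obtain n t where t: "is_partition a b n t" "\<forall>i<n. t (Suc i) - t i < d"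
    using partition_mesh_exists[OF ab d(1)] .
  have "norm I \<le> norm (dy_sum g y n t) + norm (dy_sum g y n t - I)"
    by (metis norm_minus_commute norm_triangle_sub)
  then show "norm I \<le> (2 * C + L * (b - a)) * B + e"
    using dy_sum_bound[OF t(1), of y B, OF y] d(2)[OF t] by simp
qed

text \<open>Since \<open>dy_sum_bound\<close> is uniform in the partition, one approximant
  \<open>y' k\<close> can be fixed first and the mesh chosen for it alone.\<close>

lemma has_dy_integral_limit:
  assumes I: "\<And>n. has_dy_integral g (y' n) a b (I' n)" "I' \<longlonglongrightarrow> I"
    and y: "\<And>n s. s \<in> {a..b} \<Longrightarrow> norm (y s - y' n s) \<le> e n" "e \<longlonglongrightarrow> 0"
  shows "has_dy_integral g y a b I"
  unfolding has_dy_integral_def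
proof safe
  fix \<epsilon> :: real assume "\<epsilon> > 0"
  define M where "M = 2 * C + L * (b - a)"
  have "(\<lambda>n. M * e n + norm (I' n - I)) \<longlonglongrightarrow> M * 0 + norm (I - I)"
    by (intro tendsto_intros I y)
  then have "eventually (\<lambda>n. M * e n + norm (I' n - I) < \<epsilon> / 2) sequentially"
    using \<open>\<epsilon> > 0\<close> by (intro order_tendstoD) auto
  then obtain k where k: "M * e k + norm (I' k - I) < \<epsilon> / 2"
    by (meson eventually_sequentially order_refl)
  obtain d where d: "d > 0" "\<And>n t. is_partition a b n t \<Longrightarrow> (\<forall>i<n. t (Suc i) - t i < d) \<Longrightarrow>
      norm (dy_sum g (y' k) n t - I' k) < \<epsilon> / 2"
    using I(1)[of k] \<open>\<epsilon> > 0\<close> half_gt_zero unfolding has_dy_integral_def by meson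
  show "\<exists>\<delta>>0. \<forall>n t. is_partition a b n t \<and> (\<forall>i<n. t (Suc i) - t i < \<delta>) \<longrightarrow> norm (dy_sum g y n t - I) < \<epsilon>"
  proof (intro exI[of _ d] conjI allI impI)
    fix n t assume t: "is_partition a b n t \<and> (\<forall>i<n. t (Suc i) - t i < d)"
    have "dy_sum g y n t = dy_sum g (\<lambda>s. y s - y' k s) n t + dy_sum g (y' k) n t"
      by (simp add: dy_sum_def sum.distrib[symmetric] blinfun.bilinear_simps algebra_simps)
    then have "dy_sum g y n t - I = dy_sum g (\<lambda>s. y s - y' k s) n t + ((dy_sum g (y' k) n t - I' k) + (I' k - I))"
      by simp
    also have "norm \<dots> \<le> norm (dy_sum g (\<lambda>s. y s - y' k s) n t) + (norm (dy_sum g (y' k) n t - I' k) + norm (I' k - I))"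
      by (intro order_trans[OF norm_triangle_ineq] add_left_mono norm_triangle_ineq)
    also have "norm (dy_sum g (\<lambda>s. y s - y' k s) n t) \<le> M * e k"
      unfolding M_def using t y by (intro dy_sum_bound) auto
    finally show "norm (dy_sum g y n t - I) < \<epsilon>" using k d(2)[of n t] t by simp
  qed (rule d)
qed

text \<open>Only the cell straddling \<open>c\<close> contributes, with \<open>g\<close> taken at
  its left end point; the Lipschitz bound compares this with \<open>g c\<close> up to a multiple of
  the mesh.\<close>

lemma has_dy_integral_jump:
  assumes c: "a < c" "c \<le> b"
  shows "has_dy_integral g (\<lambda>s. if c \<le> s then v else 0) a b (g c v)"
  unfolding has_dy_integral_def
proof safe
  fix \<epsilon> :: real assume "\<epsilon> > 0"
  \<comment> \<open>The summand 1 keeps the divisor positive when \<open>L\<close> or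
    \<open>v\<close> vanishes.\<close>
  define M where "M = L * norm v + 1"
  have M: "M > 0" using L_nonneg by (auto simp: M_def intro: add_nonneg_pos)
  show "\<exists>\<delta>>0. \<forall>n t. is_partition a b n t \<and> (\<forall>i<n. t (Suc i) - t i < \<delta>) \<longrightarrow>
      norm (dy_sum g (\<lambda>s. if c \<le> s then v else 0) n t - g c v) < \<epsilon>"
  proof (intro exI[of _ "\<epsilon> / M"] conjI allI impI)
    fix n t assume t': "is_partition a b n t \<and> (\<forall>i<n. t (Suc i) - t i < \<epsilon> / M)"
    then have t: "is_partition a b n t" by simp
    define k where "k = (LEAST k. c \<le> t k)"
    have "c \<le> t n" using t c by (simp add: is_partition_def)
    then have k: "c \<le> t k" "k \<le> n" unfolding k_def by (auto intro: LeastI Least_le)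
    have "k \<noteq> 0" using k(1) t c by (auto simp: is_partition_def intro: Nat.gr0I)
    then obtain j where j: "k = Suc j" by (cases k) auto
    have jc: "t j < c" using not_less_Least[of j "\<lambda>k. c \<le> t k"] j by (simp add: k_def)
    have "dy_sum g (\<lambda>s. if c \<le> s then v else 0) n t = (\<Sum>i<n. if i = j then g (t j) v else 0)"
      unfolding dy_sum_def
    proof (rule sum.cong)
      fix i assume "i \<in> {..<n}"
      then have i: "i < n" by simp
      consider "i < j" | "i = j" | "k \<le> i" using j by linarith
      then show "g (t i) ((if c \<le> t (Suc i) then v else 0) - (if c \<le> t i then v else 0)) = (if i = j then g (t j) v else 0)"
      proof cases
        case 1
        then have "t i \<le> t j" "t (Suc i) \<le> t j" using is_partition_mono[OF t] k j by auto
        then show ?thesis using jc 1 by (simp add: blinfun.bilinear_simps)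
      next
        case 2
        then show ?thesis using jc k j by simp
      next
        case 3
        then have "t k \<le> t i" "t k \<le> t (Suc i)" using is_partition_mono[OF t] i by auto
        then show ?thesis using k 3 j by (simp add: blinfun.bilinear_simps)
      qed
    qed simp
    also have "\<dots> = g (t j) v" using k j by (simp add: sum.delta)
    finally have "norm (dy_sum g (\<lambda>s. if c \<le> s then v else 0) n t - g c v) = norm ((g (t j) - g c) v)"
      by (simp add: blinfun.bilinear_simps)
    also have "\<dots> \<le> norm (g (t j) - g c) * norm v" by (rule norm_blinfun)
    also have "\<dots> \<le> (L * \<bar>t j - c\<bar>) * norm v"
      using is_partition_mem[OF t, of j] k j c by (intro mult_right_mono g_lip) auto
    also have "\<dots> = (L * norm v) * (c - t j)" using jc by simp
    also have "\<dots> \<le> M * (c - t j)" using jc by (intro mult_right_mono) (auto simp: M_def)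
    also have "\<dots> \<le> M * (t (Suc j) - t j)" using k j M by (intro mult_left_mono) auto
    also have "\<dots> < M * (\<epsilon> / M)" using t' k j M by (intro mult_strict_left_mono) auto
    also have "\<dots> = \<epsilon>" using M by simp
    finally show "norm (dy_sum g (\<lambda>s. if c \<le> s then v else 0) n t - g c v) < \<epsilon>" .
  qed (use M \<open>\<epsilon> > 0\<close> in simp)
qed

end

text \<open>Step functions encoded by jump times and sizes instead of values on intervals: the list
  may be unsorted and repeat times, so addition is concatenation and proofs go by induction over the
  jumps.\<close>

definition jump_sum :: "(real \<times> 'a) list \<Rightarrow> real \<Rightarrow> 'a::real_normed_vector" where
  "jump_sum xs s = (\<Sum>(c, v)\<leftarrow>xs. if c \<le> s then v else 0)"

text \<open>The jumps of the indefinite integral: integrating \<open>g\<close> against a step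
  function multiplies the jump at \<open>c\<close> by \<open>g c\<close>.\<close>

definition transform_jumps ::
  "(real \<Rightarrow> 'a \<Rightarrow>\<^sub>L 'a) \<Rightarrow> (real \<times> 'a) list \<Rightarrow> (real \<times> 'a::real_normed_vector) list" where
  "transform_jumps g xs = map (\<lambda>(c, v). (c, g c v)) xs"

lemma jump_sum_simps [simp]:
  "jump_sum [] s = 0"
  "jump_sum ((c, v) # xs) s = (if c \<le> s then v else 0) + jump_sum xs s"
  "jump_sum (xs @ ys) s = jump_sum xs s + jump_sum ys s"
  by (simp_all add: jump_sum_def)

lemma transform_jumps_simps [simp]:
  "transform_jumps g [] = []"
  "transform_jumps g ((c, v) # xs) = (c, g c v) # transform_jumps g xs"
  by (simp_all add: transform_jumps_def)

lemma fst_transform_jumps [simp]: "fst ` set (transform_jumps g xs) = fst ` set xs"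
  by (force simp: transform_jumps_def)

lemma jump_sum_eq_0: "\<forall>c\<in>fst ` set xs. s < c \<Longrightarrow> jump_sum xs s = 0"
  by (induction xs) auto

lemma (in lipschitz_integrand) has_dy_integral_jump_sum:
  "has_dy_integral g (jump_sum xs) a b
     (jump_sum (transform_jumps g xs) b - jump_sum (transform_jumps g xs) a)"
proof (induction xs)
  case Nil
  show ?case using has_dy_integral_const[of g 0 a b] by simp
next
  case (Cons x xs)
  obtain c v where x: "x = (c, v)" by (cases x)
  have "has_dy_integral g (\<lambda>s. if c \<le> s then v else 0) a b
      ((if c \<le> b then g c v else 0) - (if c \<le> a then g c v else 0))"
  proof -
    consider "c \<le> a" | "a < c" "c \<le> b" | "b < c" by linarith
    then show ?thesis
    proof cases
      case 1
      then show ?thesis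
        using has_dy_integral_const[of g v a b] ab
        by (subst has_dy_integral_cong[where z = "\<lambda>_. v"]) auto
    next
      case 2
      then show ?thesis using has_dy_integral_jump by simp
    next
      case 3
      then show ?thesis
        using has_dy_integral_const[of g 0 a b] ab
        by (subst has_dy_integral_cong[where z = "\<lambda>_. 0"]) auto
    qed
  qed
  from has_dy_integral_add[OF this Cons] show ?case
    by (simp add: x algebra_simps)
qed

text \<open>Compactness of [0, K] in the form of Bolzano bisection: one-sided limits give a step
  function with small error near each time, and approximations on adjacent intervals can be
  glued.\<close>

lemma cadlag_jump_approximation:
  fixes y :: "real \<Rightarrow> 'a::real_normed_vector"
  assumes y: "cadlag y" and e: "e > 0" and "0 \<le> K"
  obtains xs where "\<forall>c\<in>fst ` set xs. 0 < c" "\<And>s. s \<in> {0..K} \<Longrightarrow> norm (y s - y 0 - jump_sum xs s) < e"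
proof -
  \<comment> \<open>The approximant starts at the exact value \<open>y a\<close> and jumps only
    after \<open>a\<close>; both are needed for gluing.\<close>
  define P where "P a b \<longleftrightarrow> (0 \<le> a \<longrightarrow> (\<exists>xs. (\<forall>c\<in>fst ` set xs. a < c) \<and>
      (\<forall>s\<in>{a..b}. norm (y s - y a - jump_sum xs s) < e)))" for a b
  have "P 0 K" using \<open>0 \<le> K\<close>
  proof (induction rule: Bolzano)
    case (trans a b c)
    show ?case
    proof (cases "a = b")
      case True
      then show ?thesis using trans by simp
    next
      case False
      then have "a < b" using trans by simp
      show ?thesis unfolding P_def
      proof
        assume "0 \<le> a"
        then obtain xs ys where xs: "\<forall>c\<in>fst ` set xs. a < c" "\<forall>s\<in>{a..b}. norm (y s - y a - jump_sum xs s) < e"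
          and ys: "\<forall>c\<in>fst ` set ys. b < c" "\<forall>s\<in>{b..c}. norm (y s - y b - jump_sum ys s) < e"
          using trans(1,2) \<open>a < b\<close> unfolding P_def by auto
        \<comment> \<open>discard the jumps of \<open>xs\<close> after \<open>b\<close> and jump to the exact value at \<open>b\<close>\<close>
        define zs where "zs = filter (\<lambda>(c, v). c < b) xs"
        have zs_less: "jump_sum zs s = jump_sum xs s" if "s < b" for s
          unfolding zs_def using that by (induction xs) auto
        have zs_ge: "jump_sum zs s = jump_sum zs b" if "b \<le> s" for s
          unfolding zs_def using that by (induction xs) auto
        define w where "w = y b - y a - jump_sum zs b"
        show "\<exists>xs. (\<forall>c\<in>fst ` set xs. a < c) \<and> (\<forall>s\<in>{a..c}. norm (y s - y a - jump_sum xs s) < e)"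
        proof (intro exI[of _ "zs @ (b, w) # ys"] conjI ballI)
          fix s assume s: "s \<in> {a..c}"
          show "norm (y s - y a - jump_sum (zs @ (b, w) # ys) s) < e"
          proof (cases "s < b")
            case True
            then show ?thesis using xs(2) s ys(1) by (simp add: zs_less jump_sum_eq_0 order.strict_trans)
          next
            case False
            then have eq: "y s - y a - jump_sum (zs @ (b, w) # ys) s = y s - y b - jump_sum ys s"
              by (simp add: zs_ge[of s] w_def)
            show ?thesis unfolding eq using ys(2) s False by simp
          qed
        next
          fix c assume "c \<in> fst ` set (zs @ (b, w) # ys)"
          then show "a < c" using xs(1) ys(1) \<open>a < b\<close> by (auto simp: zs_def)
        qed
      qed
    qed
  next
    case (local x)
    then have "0 \<le> x" by simp
    then have "(y \<longlongrightarrow> y x) (at_right x)" using y by (simp add: cadlag_def)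
    then have "eventually (\<lambda>s. dist (y s) (y x) < e) (at_right x)" using e by (rule tendstoD)
    then obtain u where u: "u > x" "\<And>s. x < s \<Longrightarrow> s < u \<Longrightarrow> dist (y s) (y x) < e"
      unfolding eventually_at_right_field by auto
    \<comment> \<open>The left limit enters as a Cauchy condition, which compares values of
      \<open>y\<close> with each other and not with the limit. At time 0 the condition is
      vacuous.\<close>
    obtain l where l: "l < x" "\<And>s t. 0 \<le> s \<Longrightarrow> l < s \<Longrightarrow> s < x \<Longrightarrow> l < t \<Longrightarrow> t < x \<Longrightarrow> dist (y s) (y t) < e"
    proof (cases "x = 0")
      case True
      then show ?thesis by (intro that[of "x - 1"]) auto
    next
      case False
      then have "0 < x" using \<open>0 \<le> x\<close> by simp
      then obtain z where "(y \<longlongrightarrow> z) (at_left x)" using y unfolding cadlag_def by blast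
      then have "eventually (\<lambda>s. dist (y s) z < e / 2) (at_left x)" using e by (intro tendstoD) auto
      then obtain l where l: "l < x" "\<And>s. l < s \<Longrightarrow> s < x \<Longrightarrow> dist (y s) z < e / 2"
        unfolding eventually_at_left_field by auto
      show ?thesis
        by (rule that[of l]) (rule l(1), rule dist_triangle_half_l[OF l(2) l(2)])
    qed
    show ?case
    proof (intro exI[of _ "min (u - x) (x - l)"] conjI allI impI)
      fix a b assume ab: "a \<le> x \<and> x \<le> b \<and> b - a < min (u - x) (x - l)"
      have right: "dist (y s) (y x) < e" if "x \<le> s" "s \<le> b" for s
        using u(2)[of s] that ab e by (cases "s = x") auto
      show "P a b" unfolding P_def
      proof (intro impI)
        assume "0 \<le> a"
        show "\<exists>xs. (\<forall>c\<in>fst ` set xs. a < c) \<and> (\<forall>s\<in>{a..b}. norm (y s - y a - jump_sum xs s) < e)"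
        proof (cases "a = x")
          case True
          then show ?thesis using right by (intro exI[of _ "[]"]) (auto simp: dist_norm)
        next
          case False
          show ?thesis
          \<comment> \<open>Constant \<open>y a\<close> before \<open>x\<close>, one jump to
            \<open>y x\<close>, constant afterwards.\<close>
          proof (intro exI[of _ "[(x, y x - y a)]"] conjI ballI)
            fix s assume s: "s \<in> {a..b}"
            show "norm (y s - y a - jump_sum [(x, y x - y a)] s) < e"
              using right[of s] l(2)[of s a] s ab \<open>0 \<le> a\<close> False
              by (cases "x \<le> s") (auto simp: dist_norm)
          qed (use ab False in auto)
        qed
      qed
    qed (use u l in auto)
  qed
  then obtain xs where "\<forall>c\<in>fst ` set xs. 0 < c" "\<forall>s\<in>{0..K}. norm (y s - y 0 - jump_sum xs s) < e"
    by (auto simp: P_def)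
  then show ?thesis by (intro that[of xs]) auto
qed

context uniformly_continuous_semigroup
begin

text \<open>A jump v at c becomes T_{t-c} T_c v = T_t v, the same operator for all jumps up to t.
  This cancellation is why the convolution integral of \<open>Y\<close> collapses to
  \<open>T t (U t)\<close>.\<close>

lemma transform_jumps_T:
  assumes "\<forall>c\<in>fst ` set xs. 0 < c"
  shows "jump_sum (transform_jumps (\<lambda>s. T (t - s)) (transform_jumps T xs)) t = T t (jump_sum xs t)"
  using assms by (induction xs) (auto simp: blinfun.bilinear_simps T_add_apply)

text \<open>The indefinite integrals of step approximations of \<open>U\<close> are uniformly Cauchy
  on [0, K] by the sup-norm bound. Their limit \<open>Y\<close> inherits both identities: in the
  first the approximated integrator is \<open>U\<close>, in the second it is \<open>Y\<close>
  itself.\<close>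

lemma cadlag_integral_upto:
  fixes U :: "real \<Rightarrow> 'a"
  assumes U: "cadlag U" "U 0 = 0" and K: "0 \<le> K"
  obtains Y where "Y 0 = 0" "\<And>a b. 0 \<le> a \<Longrightarrow> a \<le> b \<Longrightarrow> b \<le> K \<Longrightarrow> has_dy_integral T U a b (Y b - Y a)"
    "\<And>t. 0 \<le> t \<Longrightarrow> t \<le> K \<Longrightarrow> has_dy_integral (\<lambda>s. T (t - s)) Y 0 t (T t (U t))"
proof -
  obtain L where L: "L \<ge> 0" "\<And>s t. s \<in> {0..K} \<Longrightarrow> t \<in> {0..K} \<Longrightarrow> norm (T t - T s) \<le> L * \<bar>t - s\<bar>"
    using T_lipschitz[of K] by blast
  obtain C where C: "C > 0" "\<And>t. 0 \<le> t \<Longrightarrow> t \<le> K \<Longrightarrow> norm (T t) \<le> C" using T_bounded[of K] by blast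
  define e where "e n = inverse (real (Suc n))" for n
  have e_lim: "e \<longlonglongrightarrow> 0" unfolding e_def by (rule LIMSEQ_inverse_real_of_nat)
  have "\<exists>xs. (\<forall>c\<in>fst ` set xs. 0 < c) \<and> (\<forall>s\<in>{0..K}. norm (U s - jump_sum xs s) < e n)" for n
    by (rule cadlag_jump_approximation[OF U(1) _ K, of "e n"]) (auto simp: U(2) e_def)
  then obtain xs where xs: "\<And>n. \<forall>c\<in>fst ` set (xs n). 0 < c"
      "\<And>n s. s \<in> {0..K} \<Longrightarrow> norm (U s - jump_sum (xs n) s) < e n"
    by metis
  define Z where "Z n = jump_sum (transform_jumps T (xs n))" for n
  have lip: "lipschitz_integrand T a b C L" if "0 \<le> a" "a \<le> b" "b \<le> K" for a b
    using that by unfold_locales (auto intro!: C L)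
  have lip': "lipschitz_integrand (\<lambda>s. T (t - s)) 0 t C L" if "0 \<le> t" "t \<le> K" for t
  proof unfold_locales
    show "norm (T (t - r) - T (t - s)) \<le> L * \<bar>r - s\<bar>" if "s \<in> {0..t}" "r \<in> {0..t}" for s r
      using L(2)[of "t - s" "t - r"] that \<open>t \<le> K\<close> by (auto simp: abs_minus_commute)
  qed (use that in \<open>auto intro!: C L\<close>)
  have Z0: "Z n 0 = 0" for n
    unfolding Z_def using xs(1)[of n] by (intro jump_sum_eq_0) simp
  have Z_int: "has_dy_integral T (jump_sum (xs n)) a b (Z n b - Z n a)" if "0 \<le> a" "a \<le> b" "b \<le> K" for a b n
    unfolding Z_def by (rule lipschitz_integrand.has_dy_integral_jump_sum[OF lip[OF that]])
  \<comment> \<open>The constant of the sup-norm bound, made uniform over the intervals [0, t] with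
    t \<le> K.\<close>
  define M where "M = 2 * C + L * K"
  have M: "M > 0" using C L K by (auto simp: M_def intro: add_pos_nonneg)
  have Z_Cauchy: "norm (Z n t - Z m t) \<le> M * (e n + e m)" if "t \<in> {0..K}" for n m t
  proof -
    have t: "0 \<le> t" "t \<le> K" using that by auto
    have "has_dy_integral T (\<lambda>s. jump_sum (xs n) s + - jump_sum (xs m) s) 0 t (Z n t + - Z m t)"
      using has_dy_integral_add[OF Z_int[of 0 t n] has_dy_integral_minus[OF Z_int[of 0 t m]]] t by (simp add: Z0)
    then have "norm (Z n t + - Z m t) \<le> (2 * C + L * (t - 0)) * (e n + e m)"
    proof (rule lipschitz_integrand.has_dy_integral_bound[OF lip, rotated -2])
      fix s assume "s \<in> {0..t}"
      then have "norm (U s - jump_sum (xs n) s) < e n" "norm (U s - jump_sum (xs m) s) < e m"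
        using xs(2) t by auto
      then show "norm (jump_sum (xs n) s + - jump_sum (xs m) s) \<le> e n + e m"
        using norm_triangle_ineq4[of "U s - jump_sum (xs m) s" "U s - jump_sum (xs n) s"] by simp
    qed (use t in auto)
    also have "\<dots> \<le> M * (e n + e m)"
      unfolding M_def using t L by (intro mult_right_mono add_left_mono mult_left_mono) (auto simp: e_def)
    finally show ?thesis by simp
  qed
  define Y where "Y t = lim (\<lambda>n. Z n t)" for t
  have Y: "(\<lambda>n. Z n t) \<longlonglongrightarrow> Y t" if t: "t \<in> {0..K}" for t
  proof -
    have "Cauchy (\<lambda>n. Z n t)"
    proof (rule metric_CauchyI)
      fix \<epsilon> :: real assume "\<epsilon> > 0"
      then have "eventually (\<lambda>n. e n < \<epsilon> / (2 * M)) sequentially"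
        using e_lim M by (intro order_tendstoD) auto
      then obtain N where N: "\<And>n. n \<ge> N \<Longrightarrow> e n < \<epsilon> / (2 * M)" by (auto simp: eventually_sequentially)
      have "dist (Z m t) (Z n t) < \<epsilon>" if "m \<ge> N" "n \<ge> N" for m n
      proof -
        have "dist (Z m t) (Z n t) \<le> M * (e m + e n)" using Z_Cauchy[OF t] by (simp add: dist_norm)
        also have "\<dots> < M * (\<epsilon> / (2 * M) + \<epsilon> / (2 * M))"
          using N that M by (intro mult_strict_left_mono add_strict_mono) auto
        also have "\<dots> = \<epsilon>" using M by (simp add: field_simps)
        finally show ?thesis .
      qed
      then show "\<exists>N. \<forall>m\<ge>N. \<forall>n\<ge>N. dist (Z m t) (Z n t) < \<epsilon>" by blast
    qed
    then show ?thesis unfolding Y_def by (simp add: Cauchy_convergent_iff convergent_LIMSEQ_iff)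
  qed
  have YZ: "norm (Y t - Z n t) \<le> M * e n" if t: "t \<in> {0..K}" for t n
  proof (rule tendsto_le[OF sequentially_bot])
    show "(\<lambda>m. norm (Z m t - Z n t)) \<longlonglongrightarrow> norm (Y t - Z n t)" by (intro tendsto_intros Y t)
    have "(\<lambda>m. M * (e m + e n)) \<longlonglongrightarrow> M * (0 + e n)" by (intro tendsto_intros e_lim)
    then show "(\<lambda>m. M * (e m + e n)) \<longlonglongrightarrow> M * e n" by simp
    show "\<forall>\<^sub>F m in sequentially. norm (Z m t - Z n t) \<le> M * (e m + e n)"
      using Z_Cauchy[OF t] by simp
  qed
  show ?thesis
  proof (rule that[of Y])
    show "Y 0 = 0" using Y[of 0] K by (simp add: Z0 LIMSEQ_const_iff)
    show "has_dy_integral T U a b (Y b - Y a)" if "0 \<le> a" "a \<le> b" "b \<le> K" for a b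
    proof (rule lipschitz_integrand.has_dy_integral_limit[OF lip[OF that] Z_int[OF that] _ _ e_lim])
      show "(\<lambda>n. Z n b - Z n a) \<longlonglongrightarrow> Y b - Y a" using that by (intro tendsto_intros Y) auto
      show "norm (U s - jump_sum (xs n) s) \<le> e n" if "s \<in> {a..b}" for n s
        using xs(2)[of s n] that \<open>0 \<le> a\<close> \<open>b \<le> K\<close> by simp
    qed
    show "has_dy_integral (\<lambda>s. T (t - s)) Y 0 t (T t (U t))" if t: "0 \<le> t" "t \<le> K" for t
    proof (rule lipschitz_integrand.has_dy_integral_limit[OF lip'[OF t]])
      show "has_dy_integral (\<lambda>s. T (t - s)) (Z n) 0 t (T t (jump_sum (xs n) t))" for n
        using lipschitz_integrand.has_dy_integral_jump_sum[OF lip'[OF t], of "transform_jumps T (xs n)"]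
          jump_sum_eq_0[of "transform_jumps (\<lambda>s. T (t - s)) (transform_jumps T (xs n))" 0] xs(1)[of n]
        by (simp add: transform_jumps_T Z_def)
      show "(\<lambda>n. T t (jump_sum (xs n) t)) \<longlonglongrightarrow> T t (U t)"
      proof (intro blinfun.tendsto tendsto_const)
        show "(\<lambda>n. jump_sum (xs n) t) \<longlonglongrightarrow> U t"
        proof (rule Lim_null_comparison[THEN Lim_null[THEN iffD2], OF _ e_lim])
          show "\<forall>\<^sub>F n in sequentially. norm (jump_sum (xs n) t - U t) \<le> e n"
            using xs(2)[of t] t by (simp add: norm_minus_commute less_imp_le)
        qed
      qed
      show "norm (Y s - Z n s) \<le> M * e n" if "s \<in> {0..t}" for n s
        using YZ[of s n] that t by simp
      show "(\<lambda>n. M * e n) \<longlonglongrightarrow> 0" using tendsto_mult_left[OF e_lim, of M] by simp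
    qed
  qed
qed

text \<open>Subtracting the constant \<open>U a\<close> does not change the integral, so the
  increment of the integral is controlled by the oscillation of \<open>U\<close> over the same
  interval. One-sided limits of \<open>U\<close> thus pass to the integral.\<close>

lemma has_dy_integral_increment_bound:
  assumes K: "0 \<le> K"
  shows "\<exists>M>0. \<forall>U I a b B. 0 \<le> a \<and> a \<le> b \<and> b \<le> K \<and> has_dy_integral T U a b I \<and>
    (\<forall>s\<in>{a..b}. norm (U s - U a) \<le> B) \<longrightarrow> norm I \<le> M * B"
proof -
  obtain L where L: "L \<ge> 0" "\<And>s t. s \<in> {0..K} \<Longrightarrow> t \<in> {0..K} \<Longrightarrow> norm (T t - T s) \<le> L * \<bar>t - s\<bar>"
    using T_lipschitz[of K] by blast
  obtain C where C: "C > 0" "\<And>t. 0 \<le> t \<Longrightarrow> t \<le> K \<Longrightarrow> norm (T t) \<le> C" using T_bounded[of K] by blast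
  show ?thesis
  proof (intro exI[of _ "2 * C + L * K"] conjI allI impI)
    show "2 * C + L * K > 0" using C L K by (auto intro: add_pos_nonneg)
    fix U I a b B
    assume *: "0 \<le> a \<and> a \<le> b \<and> b \<le> K \<and> has_dy_integral T U a b I \<and> (\<forall>s\<in>{a..b}. norm (U s - U a) \<le> B)"
    then have abK: "0 \<le> a" "a \<le> b" "b \<le> K" and I: "has_dy_integral T U a b I"
      and B: "\<And>s. s \<in> {a..b} \<Longrightarrow> norm (U s - U a) \<le> B"
      by auto
    interpret lipschitz_integrand T a b C L
      using abK by unfold_locales (auto intro!: C L)
    have "has_dy_integral T (\<lambda>s. U s + - U a) a b (I + 0)"
      by (intro has_dy_integral_add I has_dy_integral_const)
    then have "norm (I + 0) \<le> (2 * C + L * (b - a)) * B"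
      by (rule has_dy_integral_bound) (use B in simp)
    also have "\<dots> \<le> (2 * C + L * K) * B"
      using abK L B[of a] by (intro mult_right_mono add_left_mono mult_left_mono) auto
    finally show "norm I \<le> (2 * C + L * K) * B" by simp
  qed
qed

text \<open>The constructions on [0, K] for different K fit together by uniqueness of the integral,
  which is why \<open>Y\<close> is defined as the integral itself.\<close>

lemma cadlag_integral:
  fixes U :: "real \<Rightarrow> 'a"
  assumes U: "cadlag U" "U 0 = 0"
  obtains Y where "Y 0 = 0" "cadlag Y"
    "\<And>a b. 0 \<le> a \<Longrightarrow> a \<le> b \<Longrightarrow> has_dy_integral T U a b (Y b - Y a)"
    "\<And>t. 0 \<le> t \<Longrightarrow> has_dy_integral (\<lambda>s. T (t - s)) Y 0 t (T t (U t))"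
proof -
  define Y where "Y t = (THE I. has_dy_integral T U 0 t I)" for t
  have local: "\<exists>Z. (\<forall>t\<in>{0..K}. Y t = Z t) \<and> Z 0 = 0 \<and>
      (\<forall>a b. 0 \<le> a \<and> a \<le> b \<and> b \<le> K \<longrightarrow> has_dy_integral T U a b (Z b - Z a)) \<and>
      (\<forall>t. 0 \<le> t \<and> t \<le> K \<longrightarrow> has_dy_integral (\<lambda>s. T (t - s)) Z 0 t (T t (U t)))" if K: "0 \<le> K" for K
  proof -
    obtain Z where Z: "Z 0 = 0" "\<And>a b. 0 \<le> a \<Longrightarrow> a \<le> b \<Longrightarrow> b \<le> K \<Longrightarrow> has_dy_integral T U a b (Z b - Z a)"
        "\<And>t. 0 \<le> t \<Longrightarrow> t \<le> K \<Longrightarrow> has_dy_integral (\<lambda>s. T (t - s)) Z 0 t (T t (U t))"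
      using cadlag_integral_upto[OF U K] by blast
    have "Y t = Z t" if "t \<in> {0..K}" for t
      unfolding Y_def
    proof (rule the_equality)
      show "has_dy_integral T U 0 t (Z t)" using Z(2)[of 0 t] that by (simp add: Z(1))
      then show "I = Z t" if "has_dy_integral T U 0 t I" for I
        using has_dy_integral_unique[OF _ that] \<open>t \<in> {0..K}\<close> by simp
    qed
    with Z show ?thesis by blast
  qed
  have Y0: "Y 0 = 0" using local[of 0] by auto
  have Y_int: "has_dy_integral T U a b (Y b - Y a)" if "0 \<le> a" "a \<le> b" for a b
    using local[of b] that by auto
  have Y_int': "has_dy_integral (\<lambda>s. T (t - s)) Y 0 t (T t (U t))" if t: "0 \<le> t" for t
  proof -
    obtain Z where Z: "\<forall>s\<in>{0..t}. Y s = Z s" "has_dy_integral (\<lambda>s. T (t - s)) Z 0 t (T t (U t))"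
      using local[OF t] t by blast
    show ?thesis using Z by (subst has_dy_integral_cong[where z = Z]) auto
  qed
  have "cadlag Y" unfolding cadlag_def
  proof (intro conjI allI impI)
    fix t :: real assume t: "0 \<le> t"
    obtain M where M: "M > 0" "\<forall>U I a b B. 0 \<le> a \<and> a \<le> b \<and> b \<le> t + 1 \<and> has_dy_integral T U a b I \<and>
        (\<forall>s\<in>{a..b}. norm (U s - U a) \<le> B) \<longrightarrow> norm I \<le> M * B"
      using has_dy_integral_increment_bound[of "t + 1"] t by auto
    have "(U \<longlongrightarrow> U t) (at_right t)" using U(1) t by (simp add: cadlag_def)
    show "(Y \<longlongrightarrow> Y t) (at_right t)"
    proof (rule tendstoI)
      fix e :: real assume e: "e > 0"
      then have e2: "e / (2 * M) > 0" using M by simp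
      obtain u where u: "u > t" "\<And>s. t < s \<Longrightarrow> s < u \<Longrightarrow> dist (U s) (U t) < e / (2 * M)"
        using tendstoD[OF \<open>(U \<longlongrightarrow> U t) (at_right t)\<close> e2] unfolding eventually_at_right_field by auto
      have "dist (Y s) (Y t) < e" if s: "t < s" "s < min u (t + 1)" for s
      proof -
        have "norm (Y s - Y t) \<le> M * (e / (2 * M))"
        proof (rule M(2)[rule_format, OF conjI[OF t]], intro conjI ballI)
          show "has_dy_integral T U t s (Y s - Y t)" using Y_int t s by simp
          fix r assume "r \<in> {t..s}"
          then show "norm (U r - U t) \<le> e / (2 * M)"
            using u(2)[of r] s e2 by (cases "r = t") (auto simp: dist_norm)
        qed (use s in auto)
        also have "\<dots> < e" using M e by simp
        finally show ?thesis by (simp add: dist_norm)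
      qed
      then show "eventually (\<lambda>s. dist (Y s) (Y t) < e) (at_right t)"
        unfolding eventually_at_right_field using u by (intro exI[of _ "min u (t + 1)"]) auto
    qed
  next
    fix t :: real assume t: "0 < t"
    obtain M where M: "M > 0" "\<forall>U I a b B. 0 \<le> a \<and> a \<le> b \<and> b \<le> t \<and> has_dy_integral T U a b I \<and>
        (\<forall>s\<in>{a..b}. norm (U s - U a) \<le> B) \<longrightarrow> norm I \<le> M * B"
      using has_dy_integral_increment_bound[of "t"] t by auto
    obtain l where l: "(U \<longlongrightarrow> l) (at_left t)" using U(1) t by (auto simp: cadlag_def)
    show "\<exists>l. (Y \<longlongrightarrow> l) (at_left t)"
    proof (rule Cauchy_filter_limit[of "at_left t" Y])
      fix e :: real assume e: "e > 0"
      then have e2: "e / (2 * M) / 2 > 0" using M by simp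
      obtain u where u: "u < t" "\<And>s. u < s \<Longrightarrow> s < t \<Longrightarrow> dist (U s) l < e / (2 * M) / 2"
        using tendstoD[OF l e2] unfolding eventually_at_left_field by auto
      have *: "dist (Y a) (Y b) < e" if "max u 0 < a" "a \<le> b" "b < t" for a b
      proof -
        have "norm (Y b - Y a) \<le> M * (e / (2 * M))"
        proof (rule M(2)[rule_format], intro conjI ballI)
          show "has_dy_integral T U a b (Y b - Y a)" using Y_int that by simp
          fix r assume "r \<in> {a..b}"
          then show "norm (U r - U a) \<le> e / (2 * M)"
            using dist_triangle_half_l[OF u(2)[of r] u(2)[of a]] that by (simp add: dist_norm)
        qed (use that in auto)
        also have "\<dots> < e" using M e by simp
        finally show ?thesis by (simp add: dist_norm norm_minus_commute)
      qed
      have "dist (Y a) (Y b) < e" if "max u 0 < a \<and> a < t" "max u 0 < b \<and> b < t" for a b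
        using *[of a b] *[of b a] that by (cases "a \<le> b") (auto simp: dist_commute)
      moreover have "eventually (\<lambda>s. max u 0 < s \<and> s < t) (at_left t)"
        unfolding eventually_at_left_field using u t by (intro exI[of _ "max u 0"]) auto
      ultimately show "\<exists>P. eventually P (at_left t) \<and> (\<forall>x y. P x \<and> P y \<longrightarrow> dist (Y x) (Y y) < e)"
        by blast
    qed (auto intro: trivial_limit_at_left_real)
  qed
  from Y0 this Y_int Y_int' show ?thesis by (rule that)
qed

end

section \<open>Additive processes with prescribed increments\<close>

instance prod :: ("{complete_space, second_countable_topology}", "{complete_space, second_countable_topology}") polish_space ..

text \<open>
  The projective limit theorem of the library is stated for the class \<^class>\<open>polish_space\<close>, of which
  a type variable of sort \<open>{complete_space, second_countable_topology}\<close> is not an instance. It is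
  therefore applied to the pairs \<open>(x, 0)\<close> in the product with the real line.
\<close>

lemma projective_limit_exists:
  fixes P :: "'i set \<Rightarrow> ('i \<Rightarrow> 'a::{complete_space, second_countable_topology}) measure"
  assumes "projective_family I P (\<lambda>_. borel)"
  obtains M :: "('i \<Rightarrow> 'a) measure" where "prob_space M" "sets M = sets (PiM I (\<lambda>_. borel))"
    "\<And>J. finite J \<Longrightarrow> J \<subseteq> I \<Longrightarrow> distr M (PiM J (\<lambda>_. borel)) (\<lambda>f. restrict f J) = P J"
proof -
  interpret P: projective_family I P "\<lambda>_. borel" by fact
  define emb where "emb J f = (\<lambda>i\<in>J. (f i, 0 :: real))" for J :: "'i set" and f :: "'i \<Rightarrow> 'a"
  define proj where "proj J h = (\<lambda>i\<in>J. fst (h i))" for J :: "'i set" and h :: "'i \<Rightarrow> 'a \<times> real"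
  let ?E = "\<lambda>J. PiM J (\<lambda>_. borel :: 'a measure)"
  let ?F = "\<lambda>J. PiM J (\<lambda>_. borel :: ('a \<times> real) measure)"
  have emb_meas [measurable]: "emb J \<in> ?E J \<rightarrow>\<^sub>M ?F J" for J
    unfolding emb_def by measurable
  have proj_meas [measurable]: "proj J \<in> ?F H \<rightarrow>\<^sub>M ?E J" if "J \<subseteq> H" for J H
    unfolding proj_def
  proof (rule measurable_restrict)
    fix i assume "i \<in> J"
    then have "i \<in> H" using that by auto
    have "fst \<in> borel_measurable (borel :: ('a \<times> real) measure)"
      by (intro borel_measurable_continuous_onI continuous_intros)
    with measurable_component_singleton[OF \<open>i \<in> H\<close>]
    show "(\<lambda>h. fst (h i)) \<in> ?F H \<rightarrow>\<^sub>M borel" by (rule measurable_compose)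
  qed
  define P' where "P' J = distr (P J) (?F J) (emb J)" for J
  have emb_P: "emb J \<in> P J \<rightarrow>\<^sub>M ?F J" if "finite J" "J \<subseteq> I" for J
    by (subst measurable_cong_sets[OF P.sets_P[OF that] refl]) (rule emb_meas)
  have P': "polish_projective I P'"
    unfolding polish_projective_def
  proof (rule projective_family.intro)
    fix J H assume JH: "J \<subseteq> H" "finite H" "H \<subseteq> I"
    then have J: "finite J" "J \<subseteq> I" by (auto intro: finite_subset)
    have r1: "(\<lambda>f. restrict f J) \<in> P H \<rightarrow>\<^sub>M ?E J"
      by (subst measurable_cong_sets[OF P.sets_P[OF JH(2,3)] refl]) (rule measurable_restrict_subset[OF JH(1)])
    have "P' J = distr (distr (P H) (?E J) (\<lambda>f. restrict f J)) (?F J) (emb J)"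
      unfolding P'_def by (subst P.P[OF JH]) simp
    also have "\<dots> = distr (P H) (?F J) (emb J \<circ> (\<lambda>f. restrict f J))"
      by (rule distr_distr[OF emb_meas r1])
    also have "emb J \<circ> (\<lambda>f. restrict f J) = (\<lambda>f. restrict f J) \<circ> emb H"
      using JH(1) by (auto simp: emb_def fun_eq_iff restrict_def)
    also have "distr (P H) (?F J) ((\<lambda>f. restrict f J) \<circ> emb H) = distr (P' H) (?F J) (\<lambda>f. restrict f J)"
      unfolding P'_def by (rule distr_distr[symmetric, OF measurable_restrict_subset[OF JH(1)] emb_P[OF JH(2,3)]])
    finally show "P' J = distr (P' H) (?F J) (\<lambda>f. restrict f J)" .
  next
    fix J assume J: "finite J" "J \<subseteq> I"
    show "prob_space (P' J)"
      unfolding P'_def by (rule prob_space.prob_space_distr[OF P.prob_space_P[OF J] emb_P[OF J]])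
  qed
  interpret P': polish_projective I P' by (rule P')
  define M where "M = distr P'.lim (?E I) (proj I)"
  have proj_lim: "proj I \<in> P'.lim \<rightarrow>\<^sub>M ?E I"
    by (subst measurable_cong_sets[OF P'.sets_lim refl]) (rule proj_meas[OF order_refl])
  show ?thesis
  proof (rule that)
    show "prob_space M" unfolding M_def by (rule P'.P.prob_space_distr[OF proj_lim])
    show "sets M = sets (?E I)" by (simp add: M_def)
    fix J assume J: "finite J" "J \<subseteq> I"
    have rJ: "(\<lambda>h. restrict h J) \<in> P'.lim \<rightarrow>\<^sub>M ?F J"
      by (subst measurable_cong_sets[OF P'.sets_lim refl]) (rule measurable_restrict_subset[OF J(2)])
    have lim_J: "distr P'.lim (?F J) (\<lambda>h. restrict h J) = P' J"
    proof (rule measure_eqI)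
      show "sets (distr P'.lim (?F J) (\<lambda>h. restrict h J)) = sets (P' J)"
        using P'.sets_P[OF J] by simp
      fix A assume "A \<in> sets (distr P'.lim (?F J) (\<lambda>h. restrict h J))"
      then have A: "A \<in> sets (?F J)" by simp
      then have "emeasure (distr P'.lim (?F J) (\<lambda>h. restrict h J)) A = emeasure P'.lim ((\<lambda>h. restrict h J) -` A \<inter> space P'.lim)"
        by (rule emeasure_distr[OF rJ])
      also have "(\<lambda>h. restrict h J) -` A \<inter> space P'.lim = prod_emb I (\<lambda>_. borel) J A"
        by (auto simp: prod_emb_def space_PiM)
      also have "emeasure P'.lim \<dots> = emeasure (P' J) A"
        by (rule P'.emeasure_lim_emb[OF J(2,1) A])
      finally show "emeasure (distr P'.lim (?F J) (\<lambda>h. restrict h J)) A = emeasure (P' J) A" .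
    qed
    have "distr M (?E J) (\<lambda>f. restrict f J) = distr P'.lim (?E J) ((\<lambda>f. restrict f J) \<circ> proj I)"
      unfolding M_def by (rule distr_distr[OF measurable_restrict_subset[OF J(2)] proj_lim])
    also have "(\<lambda>f. restrict f J) \<circ> proj I = proj J \<circ> (\<lambda>h. restrict h J)"
      using J(2) by (auto simp: proj_def fun_eq_iff restrict_def)
    also have "distr P'.lim (?E J) (proj J \<circ> (\<lambda>h. restrict h J)) = distr (P' J) (?E J) (proj J)"
      using distr_distr[OF proj_meas[OF order_refl] rJ] by (simp add: lim_J)
    also have "\<dots> = distr (P J) (?E J) (proj J \<circ> emb J)"
      unfolding P'_def by (rule distr_distr[OF proj_meas[OF order_refl] emb_P[OF J]])
    also have "\<dots> = distr (P J) (P J) (\<lambda>x. x)"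
    proof (rule distr_cong)
      fix f assume "f \<in> space (P J)"
      then have "f \<in> extensional J" using P.space_P[OF J] by (simp add: space_PiM PiE_def)
      then show "(proj J \<circ> emb J) f = f" by (simp add: proj_def emb_def fun_eq_iff extensional_def)
    qed (simp_all add: P.sets_P[OF J])
    also have "\<dots> = P J" by (rule distr_id)
    finally show "distr M (?E J) (\<lambda>f. restrict f J) = P J" .
  qed
qed

text \<open>A convolution hemigroup, the family of increment laws of an additive process; a
  convolution semigroup is the case in which \<open>\<nu> s t\<close> depends on t - s
  alone.\<close>

locale hemigroup =
  fixes \<nu> :: "real \<Rightarrow> real \<Rightarrow> 'a::{banach, second_countable_topology} measure"
  assumes prob_\<nu>: "\<And>s t. 0 \<le> s \<Longrightarrow> s \<le> t \<Longrightarrow> prob_space (\<nu> s t)"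
    and sets_\<nu>: "\<And>s t. 0 \<le> s \<Longrightarrow> s \<le> t \<Longrightarrow> sets (\<nu> s t) = sets borel"
    and conv_\<nu>: "\<And>s t u. 0 \<le> s \<Longrightarrow> s < t \<Longrightarrow> t < u \<Longrightarrow>
      distr (\<nu> s t \<Otimes>\<^sub>M \<nu> t u) borel (\<lambda>(x, y). x + y) = \<nu> s u"
begin

text \<open>Inserting 0 makes the maximum exist and lets the first increment start at time 0, where
  the process is to vanish.\<close>

definition pred_time :: "real set \<Rightarrow> real \<Rightarrow> real" where
  "pred_time J t = Max (insert 0 {s\<in>J. s < t})"

lemma pred_time:
  assumes "finite J" "J \<subseteq> {0<..}"
  shows "0 \<le> pred_time J t" "pred_time J t \<in> insert 0 J" "s \<in> J \<Longrightarrow> s < t \<Longrightarrow> s \<le> pred_time J t"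
    "0 < t \<Longrightarrow> pred_time J t < t"
proof -
  let ?A = "insert 0 {s\<in>J. s < t}"
  have fin: "finite ?A" using assms by simp
  show "0 \<le> pred_time J t" unfolding pred_time_def by (rule Max_ge[OF fin]) simp
  show "s \<in> J \<Longrightarrow> s < t \<Longrightarrow> s \<le> pred_time J t" unfolding pred_time_def by (rule Max_ge[OF fin]) simp
  have in_A: "pred_time J t \<in> ?A" unfolding pred_time_def by (rule Max_in[OF fin]) simp
  then show "pred_time J t \<in> insert 0 J" by auto
  show "0 < t \<Longrightarrow> pred_time J t < t" using in_A by auto
qed

definition incr_law :: "real set \<Rightarrow> (real \<Rightarrow> 'a) measure" where
  "incr_law J = PiM J (\<lambda>t. \<nu> (pred_time J t) t)"

definition partial_sums :: "real set \<Rightarrow> (real \<Rightarrow> 'a) \<Rightarrow> real \<Rightarrow> 'a" where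
  "partial_sums J x = (\<lambda>t\<in>J. \<Sum>s | s \<in> J \<and> s \<le> t. x s)"

definition fdd :: "real set \<Rightarrow> (real \<Rightarrow> 'a) measure" where
  "fdd J = distr (incr_law J) (PiM J (\<lambda>_. borel)) (partial_sums J)"

context
  fixes J :: "real set"
  assumes J: "finite J" "J \<subseteq> {0<..}"
begin

lemma prob_pred: "t \<in> J \<Longrightarrow> prob_space (\<nu> (pred_time J t) t)"
  using pred_time(1,4)[OF J, of t] J(2) by (intro prob_\<nu>) auto

lemma sets_pred: "t \<in> J \<Longrightarrow> sets (\<nu> (pred_time J t) t) = sets borel"
  using pred_time(1,4)[OF J, of t] J(2) by (intro sets_\<nu>) auto

lemma prob_incr_law: "prob_space (incr_law J)"
  unfolding incr_law_def by (rule prob_space_PiM) (rule prob_pred)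

lemma sets_incr_law: "sets (incr_law J) = sets (PiM J (\<lambda>_. borel))"
  unfolding incr_law_def by (rule sets_PiM_cong) (auto simp: sets_pred)

lemma component_measurable: "t \<in> J \<Longrightarrow> (\<lambda>x. x t) \<in> borel_measurable (incr_law J)"
  by (subst measurable_cong_sets[OF sets_incr_law refl]) (rule measurable_component_singleton[of t J "\<lambda>_. borel"])

lemma distr_component: "t \<in> J \<Longrightarrow> distr (incr_law J) borel (\<lambda>x. x t) = \<nu> (pred_time J t) t"
proof -
  assume t: "t \<in> J"
  have "distr (incr_law J) borel (\<lambda>x. x t) = distr (incr_law J) (\<nu> (pred_time J t) t) (\<lambda>x. x t)"
    using sets_pred[OF t] by (intro distr_cong) auto
  also have "\<dots> = \<nu> (pred_time J t) t"
    unfolding incr_law_def using t by (intro distr_PiM_component prob_pred)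
  finally show ?thesis .
qed

lemma indep_components: "J \<noteq> {} \<Longrightarrow> prob_space.indep_vars (incr_law J) (\<lambda>_. borel) (\<lambda>t x. x t) J"
proof -
  assume ne: "J \<noteq> {}"
  interpret prob_space "incr_law J" by (rule prob_incr_law)
  have "distr (incr_law J) (PiM J (\<lambda>_. borel)) (\<lambda>x. \<lambda>i\<in>J. x i) = distr (incr_law J) (incr_law J) (\<lambda>x. x)"
  proof (rule distr_cong)
    fix x assume "x \<in> space (incr_law J)"
    then have "x \<in> extensional J" by (simp add: incr_law_def space_PiM PiE_def)
    then show "(\<lambda>i\<in>J. x i) = x" by (simp add: extensional_restrict)
  qed (simp_all add: sets_incr_law)
  also have "\<dots> = incr_law J" by (rule distr_id)
  also have "\<dots> = PiM J (\<lambda>i. distr (incr_law J) borel (\<lambda>x. x i))"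
    unfolding incr_law_def[of J]
    by (rule PiM_cong) (simp_all add: distr_component incr_law_def[symmetric])
  finally show ?thesis
    by (subst indep_vars_iff_distr_eq_PiM'[OF ne]) (auto intro: component_measurable)
qed

lemma partial_sums_measurable: "partial_sums J \<in> incr_law J \<rightarrow>\<^sub>M PiM J (\<lambda>_. borel)"
  unfolding partial_sums_def by (intro measurable_restrict borel_measurable_sum component_measurable) auto

text \<open>Induction over the number of time points up to \<open>t\<close>: the last increment is
  independent of the preceding block, and the hemigroup law convolves the two.\<close>

lemma distr_block_sum:
  assumes "p \<in> insert 0 J" "t \<in> J" "p < t"
  shows "distr (incr_law J) borel (\<lambda>x. \<Sum>s | s \<in> J \<and> p < s \<and> s \<le> t. x s) = \<nu> p t"
  using assms(2,3)
proof (induction "card {s\<in>J. s \<le> t}" arbitrary: t rule: less_induct)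
  case (less t)
  interpret prob_space "incr_law J" by (rule prob_incr_law)
  define q where "q = pred_time J t"
  have t0: "0 < t" using less J by auto
  have p0: "0 \<le> p" using assms(1) J by auto
  have q: "q < t" "q \<in> insert 0 J" "0 \<le> q" "\<And>s. s \<in> J \<Longrightarrow> s < t \<Longrightarrow> s \<le> q"
    using pred_time[OF J] t0 by (auto simp: q_def)
  have pq: "p \<le> q" using assms(1) q less.prems by auto
  show ?case
  proof (cases "p = q")
    case True
    have "{s \<in> J. p < s \<and> s \<le> t} = {t}"
      using q True less.prems by (force simp: order_le_less)
    then show ?thesis using distr_component[OF less.prems(1)] True by (simp add: q_def)
  next
    case False
    then have pq': "p < q" "q \<in> J" using pq q p0 by auto
    let ?A = "{s \<in> J. p < s \<and> s \<le> q}"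
    have split: "{s \<in> J. p < s \<and> s \<le> t} = insert t ?A" "t \<notin> ?A"
      using q less.prems by (force simp: order_le_less)+
    have fin: "finite ?A" using J by simp
    have IH: "distr (incr_law J) borel (\<lambda>x. \<Sum>s\<in>?A. x s) = \<nu> p q"
    proof (rule less.hyps)
      show "card {s \<in> J. s \<le> q} < card {s \<in> J. s \<le> t}"
      proof (rule psubset_card_mono)
        have "t \<in> {s \<in> J. s \<le> t}" "t \<notin> {s \<in> J. s \<le> q}" "{s \<in> J. s \<le> q} \<subseteq> {s \<in> J. s \<le> t}"
          using q(1) less.prems by auto
        then show "{s \<in> J. s \<le> q} \<subset> {s \<in> J. s \<le> t}" by blast
      qed (use J in simp)
    qed fact+
    have "indep_var (PiM ?A (\<lambda>_. borel)) (\<lambda>x. restrict (\<lambda>i. x i) ?A) (PiM {t} (\<lambda>_. borel)) (\<lambda>x. restrict (\<lambda>i. x i) {t})"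
      using less.prems split(2) by (intro indep_var_restrict[OF indep_components]) auto
    then have "indep_var borel ((\<lambda>y. \<Sum>s\<in>?A. y s) \<circ> (\<lambda>x. restrict (\<lambda>i. x i) ?A)) borel ((\<lambda>y. y t) \<circ> (\<lambda>x. restrict (\<lambda>i. x i) {t}))"
      by (rule indep_var_compose) measurable
    also have "(\<lambda>y. \<Sum>s\<in>?A. y s) \<circ> (\<lambda>x. restrict (\<lambda>i. x i) ?A) = (\<lambda>x. \<Sum>s\<in>?A. x s :: 'a)"
      by (auto simp: fun_eq_iff intro!: sum.cong)
    also have "(\<lambda>y. y t) \<circ> (\<lambda>x. restrict (\<lambda>i. x i) {t}) = (\<lambda>x. x t :: 'a)"
      by (auto simp: fun_eq_iff)
    finally have indep: "indep_var borel (\<lambda>x. \<Sum>s\<in>?A. x s) borel (\<lambda>x. x t :: 'a)" .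
    have eq: "(\<lambda>x. \<Sum>s | s \<in> J \<and> p < s \<and> s \<le> t. x s :: 'a) = (\<lambda>(x, y). x + y) \<circ> (\<lambda>x. (\<Sum>s\<in>?A. x s, x t))"
      unfolding split(1) using fin split(2) by (auto simp: fun_eq_iff add.commute)
    have m: "(\<lambda>x. (\<Sum>s\<in>?A. x s, x t :: 'a)) \<in> incr_law J \<rightarrow>\<^sub>M borel \<Otimes>\<^sub>M borel"
      using less.prems by (intro measurable_Pair borel_measurable_sum component_measurable) auto
    have "distr (incr_law J) borel (\<lambda>x. \<Sum>s | s \<in> J \<and> p < s \<and> s \<le> t. x s)
        = distr (distr (incr_law J) (borel \<Otimes>\<^sub>M borel) (\<lambda>x. (\<Sum>s\<in>?A. x s, x t))) borel (\<lambda>(x, y). x + y)"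
      unfolding eq by (subst distr_distr[OF _ m]) simp_all
    also have "distr (incr_law J) (borel \<Otimes>\<^sub>M borel) (\<lambda>x. (\<Sum>s\<in>?A. x s, x t)) = \<nu> p q \<Otimes>\<^sub>M \<nu> q t"
      using indep IH distr_component[OF less.prems(1)] unfolding indep_var_distribution_eq by (simp add: q_def)
    also have "distr \<dots> borel (\<lambda>(x, y). x + y) = \<nu> p t"
      by (rule conv_\<nu>[OF p0 pq'(1) q(1)])
    finally show ?thesis .
  qed
qed

end

text \<open>Deleting time points merges increments. The sums over the blocks of \<open>H\<close>
  between consecutive points of \<open>J\<close> are independent with the laws prescribed by
  \<open>incr_law J\<close>, and their partial sums are the old ones at the times in
  \<open>J\<close>.\<close>

lemma projective_family_fdd: "projective_family {0<..} fdd (\<lambda>_. borel)"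
proof (rule projective_family.intro)
  fix H :: "real set" assume H: "finite H" "H \<subseteq> {0<..}"
  show "prob_space (fdd H)"
    unfolding fdd_def by (rule prob_space.prob_space_distr[OF prob_incr_law[OF H] partial_sums_measurable[OF H]])
next
  fix J H :: "real set" assume JH: "J \<subseteq> H" and H: "finite H" "H \<subseteq> {0<..}"
  then have J: "finite J" "J \<subseteq> {0<..}" by (auto intro: finite_subset)
  let ?B = "\<lambda>J. PiM J (\<lambda>_. borel :: 'a measure)"
  interpret prob_space "incr_law H" by (rule prob_incr_law[OF H])
  have r: "(\<lambda>f. restrict f J) \<in> ?B H \<rightarrow>\<^sub>M ?B J" by (rule measurable_restrict_subset[OF JH])
  have rhs: "distr (fdd H) (?B J) (\<lambda>f. restrict f J) = distr (incr_law H) (?B J) ((\<lambda>f. restrict f J) \<circ> partial_sums H)"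
    unfolding fdd_def by (rule distr_distr[OF r partial_sums_measurable[OF H]])
  show "fdd J = distr (fdd H) (?B J) (\<lambda>f. restrict f J)"
  \<comment> \<open>The product characterisation of independence is applied with a nonempty index
    set; over the empty one the product space is a single point.\<close>
  proof (cases "J = {}")
    case True
    have "prob_space (fdd {})" "prob_space (distr (incr_law H) (?B J) ((\<lambda>f. restrict f J) \<circ> partial_sums H))"
      unfolding fdd_def
      by (rule prob_space.prob_space_distr[OF prob_incr_law partial_sums_measurable]; simp)
         (rule prob_space_distr[OF measurable_comp[OF partial_sums_measurable[OF H] r]])
    note p = this
    show ?thesis unfolding rhs
    proof (rule measure_eqI)
      show "sets (fdd J) = sets (distr (incr_law H) (?B J) ((\<lambda>f. restrict f J) \<circ> partial_sums H))" by (simp add: fdd_def)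
      fix A assume "A \<in> sets (fdd J)"
      then have "A \<subseteq> {\<lambda>_. undefined}" using True by (simp add: fdd_def PiM_empty)
      then have A: "A \<in> {{}, {\<lambda>_. undefined}}" by blast
      have sp: "space (fdd {}) = {\<lambda>_. undefined}"
        "space (distr (incr_law H) (?B J) ((\<lambda>f. restrict f J) \<circ> partial_sums H)) = {\<lambda>_. undefined}"
        using True by (simp_all add: fdd_def PiM_empty)
      show "emeasure (fdd J) A = emeasure (distr (incr_law H) (?B J) ((\<lambda>f. restrict f J) \<circ> partial_sums H)) A"
        using A prob_space.emeasure_space_1[OF p(1)] prob_space.emeasure_space_1[OF p(2)] True
        unfolding sp by auto
    qed
  next
    case ne: False
    define K where "K t = {s \<in> H. pred_time J t < s \<and> s \<le> t}" for t
    define z where "z t x = (\<Sum>s\<in>K t. x s)" for t and x :: "real \<Rightarrow> 'a"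
    have z_meas: "z t \<in> borel_measurable (incr_law H)" for t
      unfolding z_def by (intro borel_measurable_sum component_measurable[OF H]) (auto simp: K_def)
    have "indep_vars (\<lambda>j. PiM (K j) (\<lambda>_. borel)) (\<lambda>j x. restrict (\<lambda>i. x i) (K j)) J"
    proof (rule indep_vars_restrict[OF indep_components[OF H]])
      show "H \<noteq> {}" using ne JH by auto
      show "disjoint_family_on K J"
        unfolding disjoint_family_on_def
      proof (intro ballI impI)
        fix t u assume tu: "t \<in> J" "u \<in> J" "t \<noteq> u"
        have "K s \<inter> K r = {}" if "s \<in> J" "r \<in> J" "s < r" for s r
          using pred_time(3)[OF J, of s r] that by (auto simp: K_def)
        then show "K t \<inter> K u = {}" using tu by (metis Int_commute linorder_less_linear)
      qed
    qed (auto simp: K_def)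
    then have "indep_vars (\<lambda>_. borel) (\<lambda>j x. \<Sum>s\<in>K j. restrict (\<lambda>i. x i) (K j) s) J"
      by (rule indep_vars_compose2) measurable
    also have "(\<lambda>j x. \<Sum>s\<in>K j. restrict (\<lambda>i. x i) (K j) s :: 'a) = z"
      by (auto simp: z_def fun_eq_iff intro!: sum.cong)
    finally have indep: "indep_vars (\<lambda>_. borel) z J" .
    have z_law: "distr (incr_law H) borel (z t) = \<nu> (pred_time J t) t" if t: "t \<in> J" for t
    proof -
      have "pred_time J t \<in> insert 0 H" "pred_time J t < t" "t \<in> H"
        using pred_time[OF J, of t] JH t J by auto
      then show ?thesis using distr_block_sum[OF H, of "pred_time J t" t] unfolding z_def K_def by simp
    qed
    have "incr_law J = PiM J (\<lambda>t. distr (incr_law H) borel (z t))"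
      unfolding incr_law_def[of J] by (rule PiM_cong) (simp_all add: z_law)
    also have "\<dots> = distr (incr_law H) (?B J) (\<lambda>x. \<lambda>t\<in>J. z t x)"
      using indep indep_vars_iff_distr_eq_PiM'[OF ne, where X = z and M' = "\<lambda>_. borel"] z_meas by simp
    finally have law: "incr_law J = distr (incr_law H) (?B J) (\<lambda>x. \<lambda>t\<in>J. z t x)" .
    have m: "(\<lambda>x. \<lambda>t\<in>J. z t x) \<in> incr_law H \<rightarrow>\<^sub>M ?B J" by (intro measurable_restrict z_meas)
    have m': "partial_sums J \<in> ?B J \<rightarrow>\<^sub>M ?B J"
      by (subst measurable_cong_sets[OF sets_incr_law[OF J, symmetric] refl]) (rule partial_sums_measurable[OF J])
    have "fdd J = distr (incr_law H) (?B J) (partial_sums J \<circ> (\<lambda>x. \<lambda>t\<in>J. z t x))"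
      unfolding fdd_def law by (rule distr_distr[OF m' m])
    also have "partial_sums J \<circ> (\<lambda>x. \<lambda>t\<in>J. z t x) = (\<lambda>f. restrict f J) \<circ> partial_sums H"
    proof
      fix x
      have "(\<Sum>s | s \<in> J \<and> s \<le> t. z s x) = (\<Sum>s | s \<in> H \<and> s \<le> t. x s)" if t: "t \<in> J" for t
      proof -
        have "(\<Sum>s | s \<in> J \<and> s \<le> t. z s x) = (\<Sum>s\<in>(\<Union>r\<in>{s\<in>J. s \<le> t}. K r). x s)"
          unfolding z_def
        proof (rule sum.UNION_disjoint[symmetric])
          show "\<forall>i\<in>{s \<in> J. s \<le> t}. \<forall>j\<in>{s \<in> J. s \<le> t}. i \<noteq> j \<longrightarrow> K i \<inter> K j = {}"
          proof (intro ballI impI)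
            fix i j assume "i \<in> {s \<in> J. s \<le> t}" "j \<in> {s \<in> J. s \<le> t}" "i \<noteq> j"
            moreover have "K s \<inter> K r = {}" if "s \<in> J" "r \<in> J" "s < r" for s r
              using pred_time(3)[OF J, of s r] that by (auto simp: K_def)
            ultimately show "K i \<inter> K j = {}" by (metis (mono_tags) Int_commute linorder_less_linear mem_Collect_eq)
          qed
        qed (use J H in \<open>auto simp: K_def\<close>)
        also have "(\<Union>r\<in>{s\<in>J. s \<le> t}. K r) = {s\<in>H. s \<le> t}"
        proof (intro equalityI subsetI)
          fix s assume s: "s \<in> {s\<in>H. s \<le> t}"
          \<comment> \<open>The block containing \<open>s\<close> ends at the first point of
            \<open>J\<close> that is not before \<open>s\<close>.\<close>
          define r where "r = Min {r\<in>J. s \<le> r}"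
          have fin: "finite {r\<in>J. s \<le> r}" "{r\<in>J. s \<le> r} \<noteq> {}" using J s t by auto
          have r: "r \<in> J" "s \<le> r" "r \<le> t"
            using Min_in[OF fin] Min_le[OF fin(1), of t] s t by (auto simp: r_def)
          have "pred_time J r < s"
          proof (rule ccontr)
            assume "\<not> pred_time J r < s"
            moreover have "s > 0" using s H by auto
            ultimately have "pred_time J r \<in> {r\<in>J. s \<le> r}" using pred_time(2)[OF J, of r] by auto
            then have "r \<le> pred_time J r" unfolding r_def by (rule Min_le[OF fin(1)])
            then show False using pred_time(4)[OF J, of r] r J by force
          qed
          then show "s \<in> (\<Union>r\<in>{s\<in>J. s \<le> t}. K r)" using r s by (auto simp: K_def)
        qed (auto simp: K_def)
        finally show ?thesis .
      qed
      then show "(partial_sums J \<circ> (\<lambda>x. \<lambda>t\<in>J. z t x)) x = ((\<lambda>f. restrict f J) \<circ> partial_sums H) x"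
        using JH by (auto simp: partial_sums_def fun_eq_iff intro!: sum.cong)
    qed
    finally show ?thesis unfolding rhs .
  qed
qed

text \<open>The coordinate process over the positive times, with the value 0 put in by hand at time
  0 so that it starts there everywhere. The joint law of the increments is given as a product
  measure, from which independence and marginal laws can both be read off.\<close>

lemma additive_process_exists:
  obtains M :: "(real \<Rightarrow> 'a) measure" and V :: "real \<Rightarrow> (real \<Rightarrow> 'a) \<Rightarrow> 'a"
  where "prob_space M" "\<And>t. V t \<in> borel_measurable M" "\<And>\<omega>. V 0 \<omega> = 0"
    "\<And>n t. 0 \<le> t 0 \<Longrightarrow> (\<And>i. i < n \<Longrightarrow> t i < t (Suc i)) \<Longrightarrow>
      distr M (PiM {..<n} (\<lambda>_. borel)) (\<lambda>\<omega>. \<lambda>i\<in>{..<n}. V (t (Suc i)) \<omega> - V (t i) \<omega>)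
        = PiM {..<n} (\<lambda>i. \<nu> (t i) (t (Suc i)))"
proof -
  obtain M :: "(real \<Rightarrow> 'a) measure" where M: "prob_space M" "sets M = sets (PiM {0<..} (\<lambda>_. borel))"
    and M_fdd: "\<And>J. finite J \<Longrightarrow> J \<subseteq> {0<..} \<Longrightarrow> distr M (PiM J (\<lambda>_. borel)) (\<lambda>f. restrict f J) = fdd J"
    by (rule projective_limit_exists[OF projective_family_fdd]) blast
  define V :: "real \<Rightarrow> (real \<Rightarrow> 'a) \<Rightarrow> 'a" where "V t \<omega> = (if 0 < t then \<omega> t else 0)" for t \<omega>
  show ?thesis
  proof (rule that[OF M(1), of V])
    show "V t \<in> borel_measurable M" for t
    proof (cases "0 < t")
      case True
      have "(\<lambda>\<omega>. \<omega> t) \<in> borel_measurable M"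
        by (subst measurable_cong_sets[OF M(2) refl]) (rule measurable_component_singleton, use True in simp)
      then show ?thesis using True by (simp add: V_def[abs_def])
    qed (simp add: V_def[abs_def])
    show "V 0 \<omega> = 0" for \<omega> by (simp add: V_def)
    fix n and t :: "nat \<Rightarrow> real" assume t0: "0 \<le> t 0" and step: "\<And>i. i < n \<Longrightarrow> t i < t (Suc i)"
    let ?B = "\<lambda>J :: real set. PiM J (\<lambda>_. borel :: 'a measure)"
    have mono: "t i < t j" if "i < j" "j \<le> n" for i j
      using that
    proof (induction j)
      case (Suc j)
      then show ?case using step[of j] by (cases "i = j") auto
    qed simp
    have t_nonneg: "0 \<le> t i" if "i \<le> n" for i using mono[of 0 i] t0 that by (cases "i = 0") auto
    have inj: "t i = t j \<longleftrightarrow> i = j" if "i \<le> n" "j \<le> n" for i j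
      using mono[of i j] mono[of j i] that by (metis less_irrefl linorder_neqE_nat)
    have tpos: "0 < t (Suc i)" if "i < n" for i using mono[of i "Suc i"] t_nonneg[of i] that by auto
    define J where "J = t ` {..n} - {0}"
    have J: "finite J" "J \<subseteq> {0<..}"
    proof -
      show "finite J" by (simp add: J_def)
      show "J \<subseteq> {0<..}"
      proof
        fix s assume "s \<in> J"
        then obtain i where "i \<le> n" "s = t i" "s \<noteq> 0" by (auto simp: J_def)
        then show "s \<in> {0<..}" using t_nonneg[of i] by simp
      qed
    qed
    have tJ: "t (Suc i) \<in> J" if "i < n" for i using tpos[OF that] that by (auto simp: J_def)
    have pred: "pred_time J (t (Suc i)) = t i" if i: "i < n" for i
      unfolding pred_time_def
    proof (rule Max_eqI)
      fix s assume "s \<in> insert 0 {s \<in> J. s < t (Suc i)}"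
      then show "s \<le> t i"
      proof
        assume "s \<in> {s \<in> J. s < t (Suc i)}"
        then obtain j where j: "j \<le> n" "s = t j" "t j < t (Suc i)" by (auto simp: J_def)
        then have "j \<le> i" using mono[of "Suc i" j] i by (metis less_asym not_less_eq_eq order_le_less less_irrefl)
        then show "s \<le> t i" using mono[of j i] i j by (cases "j = i") auto
      qed (use t_nonneg i in auto)
    qed (use J i step[OF i] in \<open>auto simp: J_def\<close>)
    \<comment> \<open>Undoes \<open>partial_sums\<close> along the times \<open>t i\<close>; the
      conditional covers a first time equal to 0, which is not a coordinate in
      \<open>J\<close>.\<close>
    define incr where "incr v = (\<lambda>i\<in>{..<n}. v (t (Suc i)) - (if 0 < t i then v (t i) else 0))" for v :: "real \<Rightarrow> 'a"
    have incr_meas: "incr \<in> ?B J \<rightarrow>\<^sub>M PiM {..<n} (\<lambda>_. borel)"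
      unfolding incr_def
    proof (intro measurable_restrict borel_measurable_diff)
      fix i assume i: "i \<in> {..<n}"
      then show "(\<lambda>v. v (t (Suc i))) \<in> borel_measurable (?B J)"
        by (intro measurable_component_singleton tJ) simp
      show "(\<lambda>v. if 0 < t i then v (t i) else 0) \<in> borel_measurable (?B J)"
        using i by (cases "0 < t i") (auto intro!: measurable_component_singleton simp: J_def)
    qed
    have r: "(\<lambda>f. restrict f J) \<in> M \<rightarrow>\<^sub>M ?B J"
      by (subst measurable_cong_sets[OF M(2) refl]) (rule measurable_restrict_subset[OF J(2)])
    have V_eq: "(\<lambda>\<omega>. \<lambda>i\<in>{..<n}. V (t (Suc i)) \<omega> - V (t i) \<omega>) = incr \<circ> (\<lambda>f. restrict f J)"
      using tpos tJ by (auto simp: V_def incr_def fun_eq_iff J_def)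
    have sums: "incr (partial_sums J x) = (\<lambda>i\<in>{..<n}. x (t (Suc i)))" for x
    proof
      fix i
      show "incr (partial_sums J x) i = (\<lambda>i\<in>{..<n}. x (t (Suc i))) i"
      proof (cases "i < n")
        case i: True
        have "{s \<in> J. s \<le> t (Suc i)} = insert (t (Suc i)) {s \<in> J. s \<le> t i}"
          using pred_time(3)[OF J, of _ "t (Suc i)"] pred[OF i] tJ[OF i] step[OF i] by (force simp: order_le_less)
        moreover have "t (Suc i) \<notin> {s \<in> J. s \<le> t i}" using step[OF i] by auto
        ultimately have eq: "(\<Sum>s | s \<in> J \<and> s \<le> t (Suc i). x s) = x (t (Suc i)) + (\<Sum>s | s \<in> J \<and> s \<le> t i. x s)"
          using J by simp
        have prev: "(if 0 < t i then partial_sums J x (t i) else 0) = (\<Sum>s | s \<in> J \<and> s \<le> t i. x s)"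
        proof (cases "0 < t i")
          case True
          then show ?thesis using i by (auto simp: partial_sums_def J_def)
        next
          case False
          then have "{s \<in> J. s \<le> t i} = {}" using J by auto
          then show ?thesis using False by (simp only: if_False sum.empty)
        qed
        have "incr (partial_sums J x) i =
            partial_sums J x (t (Suc i)) - (if 0 < t i then partial_sums J x (t i) else 0)"
          using i by (simp add: incr_def)
        also have "partial_sums J x (t (Suc i)) = (\<Sum>s | s \<in> J \<and> s \<le> t (Suc i). x s)"
          using tJ[OF i] by (simp add: partial_sums_def)
        finally show ?thesis unfolding prev eq using i by simp
      qed (simp add: incr_def)
    qed
    have "distr M (PiM {..<n} (\<lambda>_. borel)) (\<lambda>\<omega>. \<lambda>i\<in>{..<n}. V (t (Suc i)) \<omega> - V (t i) \<omega>)
        = distr (distr M (?B J) (\<lambda>f. restrict f J)) (PiM {..<n} (\<lambda>_. borel)) incr"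
      unfolding V_eq by (rule distr_distr[symmetric, OF incr_meas r])
    also have "\<dots> = distr (incr_law J) (PiM {..<n} (\<lambda>_. borel)) (incr \<circ> partial_sums J)"
      unfolding M_fdd[OF J] fdd_def by (rule distr_distr[OF incr_meas partial_sums_measurable[OF J]])
    also have "\<dots> = distr (incr_law J) (PiM {..<n} (\<lambda>i. \<nu> (pred_time J (t (Suc i))) (t (Suc i)))) (\<lambda>x. \<lambda>i\<in>{..<n}. x (t (Suc i)))"
      using tJ by (intro distr_cong refl sets_PiM_cong) (auto simp: sums sets_pred[OF J])
    also have "\<dots> = PiM {..<n} (\<lambda>i. \<nu> (pred_time J (t (Suc i))) (t (Suc i)))"
      unfolding incr_law_def
    proof (rule distr_PiM_reindex[of J "\<lambda>s. \<nu> (pred_time J s) s" "\<lambda>i. t (Suc i)" "{..<n}"])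
      show "inj_on (\<lambda>i. t (Suc i)) {..<n}" using inj by (auto intro!: inj_onI)
      show "(\<lambda>i. t (Suc i)) \<in> {..<n} \<rightarrow> J" using tJ by auto
    qed (rule prob_pred[OF J])
    also have "\<dots> = PiM {..<n} (\<lambda>i. \<nu> (t i) (t (Suc i)))"
      by (rule PiM_cong) (simp_all add: pred)
    finally show "distr M (PiM {..<n} (\<lambda>_. borel)) (\<lambda>\<omega>. \<lambda>i\<in>{..<n}. V (t (Suc i)) \<omega> - V (t i) \<omega>)
        = PiM {..<n} (\<lambda>i. \<nu> (t i) (t (Suc i)))" .
  qed
qed

end

section \<open>Cadlag modifications of additive processes\<close>

definition exits_at :: "real \<Rightarrow> real set \<Rightarrow> real \<Rightarrow> real \<Rightarrow> (real \<Rightarrow> 'a::real_normed_vector) \<Rightarrow> bool" where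
  "exits_at \<eta> F s u y \<longleftrightarrow> s < u \<and> norm (y u - y s) > \<eta> \<and> (\<forall>r\<in>F. s < r \<and> r < u \<longrightarrow> norm (y r - y s) \<le> \<eta>)"

text \<open>
  A greedy chain restarts at each exit time, so for independent increments the probability of a chain
  of length \<open>n\<close> decays geometrically. An arbitrary sequence of \<open>n\<close> oscillations of size \<open>2 * \<eta>\<close> forces a
  greedy chain of length \<open>n\<close> with threshold \<open>\<eta>\<close>.
\<close>

fun greedy_chain :: "real \<Rightarrow> real set \<Rightarrow> nat \<Rightarrow> real \<Rightarrow> (real \<Rightarrow> 'a::real_normed_vector) \<Rightarrow> bool" where
  "greedy_chain \<eta> F 0 s y = True"
| "greedy_chain \<eta> F (Suc n) s y = (\<exists>u\<in>F. exits_at \<eta> F s u y \<and> greedy_chain \<eta> F n u y)"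

fun oscillates :: "real \<Rightarrow> real set \<Rightarrow> nat \<Rightarrow> real \<Rightarrow> (real \<Rightarrow> 'a::real_normed_vector) \<Rightarrow> bool" where
  "oscillates \<eta> F 0 s y = True"
| "oscillates \<eta> F (Suc n) s y =
     (\<exists>u\<in>F. \<exists>v\<in>F. s \<le> u \<and> u < v \<and> norm (y v - y u) > 2 * \<eta> \<and> oscillates \<eta> F n v y)"

lemma oscillates_SucI:
  "u \<in> F \<Longrightarrow> v \<in> F \<Longrightarrow> s \<le> u \<Longrightarrow> u < v \<Longrightarrow> norm (y v - y u) > 2 * \<eta> \<Longrightarrow>
    oscillates \<eta> F n v y \<Longrightarrow> oscillates \<eta> F (Suc n) s y"
  by auto

lemma exits_at_exists:
  assumes "finite F" "u \<in> F" "s < u" "norm (y u - y s) > \<eta>"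
  obtains w where "w \<in> F" "w \<le> u" "exits_at \<eta> F s w y"
proof -
  define W where "W = {w\<in>F. s < w \<and> norm (y w - y s) > \<eta>}"
  have W: "finite W" "u \<in> W" using assms by (auto simp: W_def)
  then have m: "Min W \<in> W" "Min W \<le> u" by (auto intro: Min_in)
  have "norm (y r - y s) \<le> \<eta>" if "r \<in> F" "s < r" "r < Min W" for r
  proof (rule ccontr)
    assume "\<not> norm (y r - y s) \<le> \<eta>"
    then have "r \<in> W" using that by (simp add: W_def)
    then show False using Min_le[OF W(1)] that(3) by force
  qed
  with m show ?thesis by (intro that[of "Min W"]) (auto simp: W_def exits_at_def)
qed

lemma exits_at_unique:
  "exits_at \<eta> F s u y \<Longrightarrow> exits_at \<eta> F s v y \<Longrightarrow> u \<in> F \<Longrightarrow> v \<in> F \<Longrightarrow> u = v"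
  unfolding exits_at_def by (metis linorder_neqE_linordered_idom not_less)

text \<open>Only increments at and after \<open>s\<close> matter, so a path may be replaced by its
  increments after an exit time, which for the random path are independent of the past.\<close>

lemma greedy_chain_cong:
  assumes "\<And>r. r \<in> insert s F \<Longrightarrow> s \<le> r \<Longrightarrow> y r = z r + c"
  shows "greedy_chain \<eta> F n s y \<longleftrightarrow> greedy_chain \<eta> F n s z"
  using assms
proof (induction n arbitrary: s)
  case (Suc n)
  have "exits_at \<eta> F s u y \<and> greedy_chain \<eta> F n u y \<longleftrightarrow> exits_at \<eta> F s u z \<and> greedy_chain \<eta> F n u z"
    if u: "u \<in> F" for u
  proof (cases "s < u")
    case True
    have diff: "y r - y s = z r - z s" if "r \<in> F" "s < r" for r
      using Suc.prems[of r] Suc.prems[of s] that by simp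
    have "greedy_chain \<eta> F n u y \<longleftrightarrow> greedy_chain \<eta> F n u z"
      using u True by (intro Suc.IH) (auto intro!: Suc.prems)
    moreover have "exits_at \<eta> F s u y \<longleftrightarrow> exits_at \<eta> F s u z"
      using diff u True by (auto simp: exits_at_def)
    ultimately show ?thesis by simp
  qed (simp add: exits_at_def)
  then show ?case by auto
qed simp

lemma oscillates_start:
  "oscillates \<eta> F n s y \<Longrightarrow> (\<And>u. u \<in> F \<Longrightarrow> s \<le> u \<Longrightarrow> r \<le> u) \<Longrightarrow> oscillates \<eta> F n r y"
  by (cases n) auto

lemma oscillates_mono:
  "oscillates \<eta> F n s y \<Longrightarrow> F \<subseteq> G \<Longrightarrow> oscillates \<eta> G n s y"
proof (induction n arbitrary: s)
  case (Suc n)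
  then obtain u v where "u \<in> F" "v \<in> F" "s \<le> u" "u < v" "norm (y v - y u) > 2 * \<eta>" "oscillates \<eta> F n v y"
    by auto
  then show ?case using Suc by auto
qed simp

lemma oscillates_finite_subset:
  "oscillates \<eta> F n s y \<Longrightarrow> \<exists>G. finite G \<and> G \<subseteq> F \<and> oscillates \<eta> G n s y"
proof (induction n arbitrary: s)
  case (Suc n)
  then obtain u v where uv: "u \<in> F" "v \<in> F" "s \<le> u" "u < v" "norm (y v - y u) > 2 * \<eta>" "oscillates \<eta> F n v y"
    by auto
  obtain G where "finite G" "G \<subseteq> F" "oscillates \<eta> G n v y" using Suc.IH[OF uv(6)] by blast
  then show ?case
    using uv oscillates_mono[of \<eta> G n v y "insert u (insert v G)"]
    by (intro exI[of _ "insert u (insert v G)"]) auto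
qed auto

text \<open>If the greedy chain stands at r \<le> u, an oscillation larger than 2\<eta> from u to v
  puts the path further than \<eta> from \<open>y r\<close> at u or at v. So the next greedy exit
  happens no later than v, where the remaining oscillations begin.\<close>

lemma oscillates_imp_greedy_chain:
  assumes "finite F" "r \<in> F" "r \<le> s" "oscillates \<eta> F n s y" "\<eta> > 0"
  shows "greedy_chain \<eta> F n r y"
  using assms(2-4)
proof (induction n arbitrary: r s)
  case (Suc n)
  then obtain u v where uv: "u \<in> F" "v \<in> F" "s \<le> u" "u < v" "norm (y v - y u) > 2 * \<eta>" "oscillates \<eta> F n v y"
    by auto
  have "\<exists>x\<in>F. r < x \<and> x \<le> v \<and> norm (y x - y r) > \<eta>"
  proof (cases "norm (y v - y r) > \<eta>")
    case True
    then show ?thesis using uv Suc.prems by (intro bexI[of _ v]) auto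
  next
    case False
    then have gt: "norm (y u - y r) > \<eta>"
      using uv(5) norm_triangle_ineq4[of "y v - y r" "y u - y r"] by simp
    then have "u \<noteq> r" using \<open>\<eta> > 0\<close> by auto
    then show ?thesis using gt uv Suc.prems by (intro bexI[of _ u]) auto
  qed
  then obtain x where x: "x \<in> F" "r < x" "x \<le> v" "norm (y x - y r) > \<eta>" by blast
  obtain w where "w \<in> F" "w \<le> x" "exits_at \<eta> F r w y"
    using exits_at_exists[OF assms(1) x(1,2,4)] .
  then show ?case using Suc.IH[of w v] uv x by auto
qed simp

text \<open>If the Cauchy criterion fails from the right, there are oscillating pairs arbitrarily
  close to \<open>t\<close>; prepending ever closer pairs builds oscillation sequences of any length
  inside the window.\<close>

lemma right_limit_of_finite_oscillation:
  fixes y :: "real \<Rightarrow> 'a::banach"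
  assumes osc: "\<And>e. e > 0 \<Longrightarrow> \<exists>\<eta> q r n. 2 * \<eta> < e \<and> q < t \<and> t < r \<and> \<not> oscillates \<eta> (D \<inter> {q..r}) n q y"
    and D: "\<And>u. u > t \<Longrightarrow> \<exists>x\<in>D. t < x \<and> x < u"
  shows "\<exists>l. (y \<longlongrightarrow> l) (at t within D \<inter> {t<..})"
proof (rule Cauchy_filter_limit[of "at t within D \<inter> {t<..}" y])
  show "at t within D \<inter> {t<..} \<noteq> bot"
    unfolding trivial_limit_within islimpt_approachable
  proof safe
    fix e :: real assume "e > 0"
    then obtain x where "x \<in> D" "t < x" "x < t + e" using D[of "t + e"] by auto
    then show "\<exists>x'\<in>D \<inter> {t<..}. x' \<noteq> t \<and> dist x' t < e"
      by (intro bexI[of _ x]) (auto simp: dist_real_def)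
  qed
  fix e :: real assume "e > 0"
  then obtain \<eta> q r n where *: "2 * \<eta> < e" "q < t" "t < r" "\<not> oscillates \<eta> (D \<inter> {q..r}) n q y"
    using osc by blast
  show "\<exists>P. eventually P (at t within D \<inter> {t<..}) \<and> (\<forall>x z. P x \<and> P z \<longrightarrow> dist (y x) (y z) < e)"
  proof (rule ccontr)
    assume neg: "\<not> ?thesis"
    have pair: "\<exists>u\<in>D. \<exists>v\<in>D. t < u \<and> u < v \<and> v < b \<and> norm (y v - y u) > 2 * \<eta>" if b: "b > t" for b
    proof -
      have "eventually (\<lambda>x. x \<in> D \<and> t < x \<and> x < b) (at t within D \<inter> {t<..})"
        unfolding eventually_at using b by (intro exI[of _ "b - t"]) (auto simp: dist_real_def)
      then obtain x z where xz: "x \<in> D" "t < x" "x < b" "z \<in> D" "t < z" "z < b" "dist (y x) (y z) \<ge> e"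
        using neg by (metis (mono_tags, lifting) not_less)
      then have n: "norm (y x - y z) > 2 * \<eta>" "norm (y z - y x) > 2 * \<eta>" using *(1) by (auto simp: dist_norm norm_minus_commute)
      have "x \<noteq> z" using xz(7) \<open>e > 0\<close> by auto
      then show ?thesis using xz n by (cases "x < z") (force+)
    qed
    have "\<exists>b>t. b < r \<and> oscillates \<eta> (D \<inter> {q..r}) k b y" for k
    proof (induction k)
      case 0
      show ?case using dense[OF *(3)] by auto
    next
      case (Suc k)
      then obtain b where b: "b > t" "b < r" "oscillates \<eta> (D \<inter> {q..r}) k b y" by blast
      obtain u v where uv: "u \<in> D" "v \<in> D" "t < u" "u < v" "v < b" "norm (y v - y u) > 2 * \<eta>"
        using pair[OF b(1)] by blast
      have "oscillates \<eta> (D \<inter> {q..r}) k v y" using b(3) by (rule oscillates_start) (use uv in auto)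
      then have "oscillates \<eta> (D \<inter> {q..r}) (Suc k) u y"
        by (rule oscillates_SucI[rotated -1]) (use uv b *(2) in auto)
      then show ?case using uv b by (intro exI[of _ u]) auto
    qed
    then obtain b where "b > t" "oscillates \<eta> (D \<inter> {q..r}) n b y" by blast
    then have "oscillates \<eta> (D \<inter> {q..r}) n q y" by (elim oscillates_start) auto
    with *(4) show False by simp
  qed
qed (rule exI)

text \<open>Mirror image of the right-hand case, except that the sequence now grows forward in time:
  each pair is followed by further ones closer to \<open>t\<close>.\<close>

lemma left_limit_of_finite_oscillation:
  fixes y :: "real \<Rightarrow> 'a::banach"
  assumes osc: "\<And>e. e > 0 \<Longrightarrow> \<exists>\<eta> q r n. 2 * \<eta> < e \<and> q < t \<and> t < r \<and> \<not> oscillates \<eta> (D \<inter> {q..r}) n q y"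
    and D: "\<And>u. u < t \<Longrightarrow> \<exists>x\<in>D. u < x \<and> x < t"
  shows "\<exists>l. (y \<longlongrightarrow> l) (at t within D \<inter> {..<t})"
proof (rule Cauchy_filter_limit[of "at t within D \<inter> {..<t}" y])
  show "at t within D \<inter> {..<t} \<noteq> bot"
    unfolding trivial_limit_within islimpt_approachable
  proof safe
    fix e :: real assume "e > 0"
    then obtain x where "x \<in> D" "x < t" "t - e < x" using D[of "t - e"] by auto
    then show "\<exists>x'\<in>D \<inter> {..<t}. x' \<noteq> t \<and> dist x' t < e"
      by (intro bexI[of _ x]) (auto simp: dist_real_def)
  qed
  fix e :: real assume "e > 0"
  then obtain \<eta> q r n where *: "2 * \<eta> < e" "q < t" "t < r" "\<not> oscillates \<eta> (D \<inter> {q..r}) n q y"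
    using osc by blast
  show "\<exists>P. eventually P (at t within D \<inter> {..<t}) \<and> (\<forall>x z. P x \<and> P z \<longrightarrow> dist (y x) (y z) < e)"
  proof (rule ccontr)
    assume neg: "\<not> ?thesis"
    have pair: "\<exists>u\<in>D. \<exists>v\<in>D. b < u \<and> u < v \<and> v < t \<and> norm (y v - y u) > 2 * \<eta>" if b: "b < t" for b
    proof -
      have "eventually (\<lambda>x. x \<in> D \<and> b < x \<and> x < t) (at t within D \<inter> {..<t})"
        unfolding eventually_at using b by (intro exI[of _ "t - b"]) (auto simp: dist_real_def)
      then obtain x z where xz: "x \<in> D" "b < x" "x < t" "z \<in> D" "b < z" "z < t" "dist (y x) (y z) \<ge> e"
        using neg by (metis (mono_tags, lifting) not_less)
      then have n: "norm (y x - y z) > 2 * \<eta>" "norm (y z - y x) > 2 * \<eta>" using *(1) by (auto simp: dist_norm norm_minus_commute)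
      have "x \<noteq> z" using xz(7) \<open>e > 0\<close> by auto
      then show ?thesis using xz n by (cases "x < z") (force+)
    qed
    have "oscillates \<eta> (D \<inter> {q..r}) k b y" if "q \<le> b" "b < t" for k b
      using that
    proof (induction k arbitrary: b)
      case (Suc k)
      obtain u v where uv: "u \<in> D" "v \<in> D" "b < u" "u < v" "v < t" "norm (y v - y u) > 2 * \<eta>"
        using pair[OF Suc.prems(2)] by blast
      then have "oscillates \<eta> (D \<inter> {q..r}) k v y" using Suc by simp
      then show ?case
        by (rule oscillates_SucI[rotated -1]) (use uv Suc.prems * in auto)
    qed simp
    with *(2,4) show False by blast
  qed
qed (rule exI)

text \<open>Stochastic continuity is expressed by the truncated first moment, which metrizes
  convergence in probability, and uniformly on bounded time intervals.\<close>

locale stochastically_continuous_additive = prob_space M for M :: "'w measure" +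
  fixes V :: "real \<Rightarrow> 'w \<Rightarrow> 'a::{banach, second_countable_topology}"
  assumes V_meas [measurable]: "\<And>t. V t \<in> borel_measurable M"
    and V_0: "\<And>\<omega>. V 0 \<omega> = 0"
    and indep_increments: "\<And>n t. 0 \<le> t 0 \<Longrightarrow> (\<And>i. i < n \<Longrightarrow> t i < t (Suc i)) \<Longrightarrow>
      indep_vars (\<lambda>_. borel) (\<lambda>i \<omega>. V (t (Suc i)) \<omega> - V (t i) \<omega>) {..<n}"
    and stochastically_continuous: "\<And>K e. e > 0 \<Longrightarrow>
      \<exists>h>0. \<forall>s t. 0 \<le> s \<and> s \<le> t \<and> t \<le> K \<and> t - s \<le> h \<longrightarrow> (\<integral>\<omega>. min 1 (norm (V t \<omega> - V s \<omega>)) \<partial>M) \<le> e"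
begin

text \<open>Both random vectors are indexed by all of \<open>F\<close>: clamping times with
  \<open>min\<close> and \<open>max\<close> makes them functions of the increments before and after
  \<open>u\<close>, so predicates on paths over \<open>F\<close> apply to either side.\<close>

lemma indep_past_future:
  assumes F: "finite F" "F \<subseteq> {0..}" and u: "u \<in> F"
  shows "indep_var (PiM F (\<lambda>_. borel)) (\<lambda>\<omega>. \<lambda>r\<in>F. V (min r u) \<omega> - V u \<omega>)
      (PiM F (\<lambda>_. borel)) (\<lambda>\<omega>. \<lambda>r\<in>F. V (max r u) \<omega> - V u \<omega>)"
proof -
  define t where "t i = sorted_list_of_set F ! i" for i
  define n where "n = card F - 1"
  have "card F > 0" using F u by (auto simp: card_gt_0_iff)
  then have card: "card F = Suc n" by (simp add: n_def)
  have mono: "t i < t j \<longleftrightarrow> i < j" if "i \<le> n" "j \<le> n" for i j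
  proof -
    have "t i < t j" if "i < j" "j \<le> n" for i j
      using that strict_sorted_list_of_set[of F] F card
      unfolding t_def by (intro sorted_wrt_nth_less[where P = "(<)"]) auto
    from this[of i j] this[of j i] that show ?thesis
      by (metis less_asym less_irrefl linorder_neqE_nat)
  qed
  have t_mem: "t i \<in> F" if "i \<le> n" for i
    using nth_mem[of i "sorted_list_of_set F"] that F card by (simp add: t_def)
  have t_surj: "\<exists>i\<le>n. s = t i" if "s \<in> F" for s
    using that F card by (metis in_set_conv_nth length_sorted_list_of_set less_Suc_eq_le set_sorted_list_of_set t_def)
  have mono_le: "t i \<le> t j \<longleftrightarrow> i \<le> j" if "i \<le> n" "j \<le> n" for i j
    using mono[OF that(2,1)] by (simp add: not_less[symmetric])
  obtain k where k: "k \<le> n" "u = t k" using t_surj[OF u] by blast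
  define \<xi> where "\<xi> i \<omega> = V (t (Suc i)) \<omega> - V (t i) \<omega>" for i \<omega>
  have sum_\<xi>: "(\<Sum>i\<in>{i..<j}. \<xi> i \<omega>) = V (t j) \<omega> - V (t i) \<omega>" if "i \<le> j" for i j \<omega>
    unfolding \<xi>_def using that by (rule sum_Suc_diff')
  have "indep_vars (\<lambda>_. borel) \<xi> {..<n}"
    unfolding \<xi>_def using t_mem[of 0] F mono by (intro indep_increments) auto
  then have "indep_var (PiM {..<k} (\<lambda>_. borel)) (\<lambda>\<omega>. restrict (\<lambda>i. \<xi> i \<omega>) {..<k})
      (PiM {k..<n} (\<lambda>_. borel)) (\<lambda>\<omega>. restrict (\<lambda>i. \<xi> i \<omega>) {k..<n})"
    by (rule indep_var_restrict) (use k in auto)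
  \<comment> \<open>Seen from \<open>u\<close>, the past path is minus the sum of the intervening
    increments, hence the sign.\<close>
  then have "indep_var (PiM F (\<lambda>_. borel))
        ((\<lambda>x. \<lambda>r\<in>F. - (\<Sum>i | i < k \<and> r \<le> t i. x i)) \<circ> (\<lambda>\<omega>. restrict (\<lambda>i. \<xi> i \<omega>) {..<k}))
      (PiM F (\<lambda>_. borel))
        ((\<lambda>x. \<lambda>r\<in>F. \<Sum>i | k \<le> i \<and> i < n \<and> t i < r. x i) \<circ> (\<lambda>\<omega>. restrict (\<lambda>i. \<xi> i \<omega>) {k..<n}))"
  proof (rule indep_var_compose)
    show "(\<lambda>x. \<lambda>r\<in>F. - (\<Sum>i | i < k \<and> r \<le> t i. x i)) \<in> PiM {..<k} (\<lambda>_. borel :: 'a measure) \<rightarrow>\<^sub>M PiM F (\<lambda>_. borel)"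
      by (intro measurable_restrict borel_measurable_uminus borel_measurable_sum measurable_component_singleton) auto
    show "(\<lambda>x. \<lambda>r\<in>F. \<Sum>i | k \<le> i \<and> i < n \<and> t i < r. x i) \<in> PiM {k..<n} (\<lambda>_. borel :: 'a measure) \<rightarrow>\<^sub>M PiM F (\<lambda>_. borel)"
      by (intro measurable_restrict borel_measurable_sum measurable_component_singleton) auto
  qed
  also have "(\<lambda>x. \<lambda>r\<in>F. - (\<Sum>i | i < k \<and> r \<le> t i. x i)) \<circ> (\<lambda>\<omega>. restrict (\<lambda>i. \<xi> i \<omega>) {..<k})
      = (\<lambda>\<omega>. \<lambda>r\<in>F. V (min r u) \<omega> - V u \<omega>)"
  proof (intro ext)
    fix \<omega> r
    show "((\<lambda>x. \<lambda>r\<in>F. - (\<Sum>i | i < k \<and> r \<le> t i. x i)) \<circ> (\<lambda>\<omega>. restrict (\<lambda>i. \<xi> i \<omega>) {..<k})) \<omega> r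
        = (\<lambda>r\<in>F. V (min r u) \<omega> - V u \<omega>) r"
    proof (cases "r \<in> F")
      case True
      then obtain j where j: "j \<le> n" "r = t j" using t_surj by blast
      have "(\<Sum>i | i < k \<and> r \<le> t i. restrict (\<lambda>i. \<xi> i \<omega>) {..<k} i) = (\<Sum>i\<in>{min j k..<k}. \<xi> i \<omega>)"
        using j k mono_le by (intro sum.cong) auto
      also have "\<dots> = V (t k) \<omega> - V (t (min j k)) \<omega>" by (rule sum_\<xi>) simp
      also have "t (min j k) = min r u" using j k mono_le[of j k] mono_le[of k j] by (auto simp: min_def)
      finally show ?thesis using True k by simp
    qed simp
  qed
  also have "(\<lambda>x. \<lambda>r\<in>F. \<Sum>i | k \<le> i \<and> i < n \<and> t i < r. x i) \<circ> (\<lambda>\<omega>. restrict (\<lambda>i. \<xi> i \<omega>) {k..<n})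
      = (\<lambda>\<omega>. \<lambda>r\<in>F. V (max r u) \<omega> - V u \<omega>)"
  proof (intro ext)
    fix \<omega> r
    show "((\<lambda>x. \<lambda>r\<in>F. \<Sum>i | k \<le> i \<and> i < n \<and> t i < r. x i) \<circ> (\<lambda>\<omega>. restrict (\<lambda>i. \<xi> i \<omega>) {k..<n})) \<omega> r
        = (\<lambda>r\<in>F. V (max r u) \<omega> - V u \<omega>) r"
    proof (cases "r \<in> F")
      case True
      then obtain j where j: "j \<le> n" "r = t j" using t_surj by blast
      have "(\<Sum>i | k \<le> i \<and> i < n \<and> t i < r. restrict (\<lambda>i. \<xi> i \<omega>) {k..<n} i) = (\<Sum>i\<in>{k..<max j k}. \<xi> i \<omega>)"
        using j k mono by (intro sum.cong) auto
      also have "\<dots> = V (t (max j k)) \<omega> - V (t k) \<omega>" by (rule sum_\<xi>) simp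
      also have "t (max j k) = max r u" using j k mono_le[of j k] mono_le[of k j] by (auto simp: max_def)
      finally show ?thesis using True k by simp
    qed simp
  qed
  finally show ?thesis .
qed

lemma prob_past_future:
  assumes F: "finite F" "F \<subseteq> {0..}" and u: "u \<in> F"
    and P [measurable]: "Measurable.pred (PiM F (\<lambda>_. borel)) P"
    and Q [measurable]: "Measurable.pred (PiM F (\<lambda>_. borel)) Q"
    and P': "\<And>\<omega>. P (\<lambda>r\<in>F. V (min r u) \<omega> - V u \<omega>) \<longleftrightarrow> P' \<omega>"
    and Q': "\<And>\<omega>. Q (\<lambda>r\<in>F. V (max r u) \<omega> - V u \<omega>) \<longleftrightarrow> Q' \<omega>"
  shows "prob {\<omega>\<in>space M. P' \<omega> \<and> Q' \<omega>} = prob {\<omega>\<in>space M. P' \<omega>} * prob {\<omega>\<in>space M. Q' \<omega>}"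
proof -
  let ?B = "PiM F (\<lambda>_. borel :: 'a measure)"
  let ?X = "\<lambda>\<omega>. \<lambda>r\<in>F. V (min r u) \<omega> - V u \<omega>" and ?Y = "\<lambda>\<omega>. \<lambda>r\<in>F. V (max r u) \<omega> - V u \<omega>"
  have XY: "?X \<in> M \<rightarrow>\<^sub>M ?B" "?Y \<in> M \<rightarrow>\<^sub>M ?B" by measurable
  have sets: "{x\<in>space ?B. P x} \<in> sets ?B" "{x\<in>space ?B. Q x} \<in> sets ?B" by measurable
  have "prob (((\<lambda>\<omega>. (?X \<omega>, ?Y \<omega>)) -` ({x\<in>space ?B. P x} \<times> {x\<in>space ?B. Q x})) \<inter> space M)
      = prob (?X -` {x\<in>space ?B. P x} \<inter> space M) * prob (?Y -` {x\<in>space ?B. Q x} \<inter> space M)"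
    by (rule indep_varD[OF indep_past_future[OF F u] sets])
  moreover have "?X -` {x\<in>space ?B. P x} \<inter> space M = {\<omega>\<in>space M. P' \<omega>}"
    using measurable_space[OF XY(1)] P' by auto
  moreover have "?Y -` {x\<in>space ?B. Q x} \<inter> space M = {\<omega>\<in>space M. Q' \<omega>}"
    using measurable_space[OF XY(2)] Q' by auto
  moreover have "((\<lambda>\<omega>. (?X \<omega>, ?Y \<omega>)) -` ({x\<in>space ?B. P x} \<times> {x\<in>space ?B. Q x})) \<inter> space M = {\<omega>\<in>space M. P' \<omega> \<and> Q' \<omega>}"
    using measurable_space[OF XY(1)] measurable_space[OF XY(2)] P' Q' by auto
  ultimately show ?thesis by simp
qed

section \<open>Measurability of exit, chain and oscillation events\<close>

lemma pred_exits_at [measurable]: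
  assumes "finite F" "s \<in> F" "u \<in> F"
  shows "Measurable.pred (PiM F (\<lambda>_. borel)) (\<lambda>y :: real \<Rightarrow> 'a. exits_at \<eta> F s u y)"
  unfolding exits_at_def
proof -
  have c [measurable]: "(\<lambda>y. y r) \<in> borel_measurable (PiM F (\<lambda>_. borel :: 'a measure))" if "r \<in> F" for r
    using that by (rule measurable_component_singleton)
  have m: "Measurable.pred (PiM F (\<lambda>_. borel :: 'a measure)) (\<lambda>y. \<eta> < norm (y a - y b))" if "a \<in> F" "b \<in> F" for a b
    using that by measurable
  have m': "Measurable.pred (PiM F (\<lambda>_. borel :: 'a measure)) (\<lambda>y. norm (y a - y b) \<le> \<eta>)" if "a \<in> F" "b \<in> F" for a b
    using that by measurable
  show "Measurable.pred (PiM F (\<lambda>_. borel :: 'a measure))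
      (\<lambda>y. s < u \<and> \<eta> < norm (y u - y s) \<and> (\<forall>r\<in>F. s < r \<and> r < u \<longrightarrow> norm (y r - y s) \<le> \<eta>))"
    using assms by (intro pred_intros_logic pred_intros_finite m m') auto
qed

lemma pred_greedy_chain [measurable]:
  assumes "finite F" "s \<in> F"
  shows "Measurable.pred (PiM F (\<lambda>_. borel)) (\<lambda>y :: real \<Rightarrow> 'a. greedy_chain \<eta> F n s y)"
  using assms(2)
proof (induction n arbitrary: s)
  case (Suc n)
  show ?case unfolding greedy_chain.simps[abs_def]
    using assms(1) Suc by (intro pred_intros_finite pred_intros_logic pred_exits_at) auto
qed (simp add: greedy_chain.simps(1)[abs_def])

lemma exits_at_cong:
  assumes "\<And>r. r \<in> {s, u} \<union> F \<Longrightarrow> s \<le> r \<Longrightarrow> r \<le> u \<Longrightarrow> y r = z r + c"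
  shows "exits_at \<eta> F s u y \<longleftrightarrow> exits_at \<eta> F s u z"
proof (cases "s < u")
  case True
  have "y r - y s = z r - z s" if "r \<in> insert u F" "s < r" "r \<le> u" for r
    using assms[of r] assms[of s] that True by auto
  then show ?thesis using True by (auto simp: exits_at_def)
qed (simp add: exits_at_def)

lemma exits_at_event [measurable]:
  assumes "finite F"
  shows "{\<omega>\<in>space M. exits_at \<eta> F s u (\<lambda>r. V r \<omega>)} \<in> events"
proof -
  have "Measurable.pred M (\<lambda>\<omega>. exits_at \<eta> F s u (\<lambda>r. V r \<omega>))"
    unfolding exits_at_def using assms by (intro pred_intros_finite pred_intros_logic) measurable
  then show ?thesis by simp
qed

lemma greedy_chain_event [measurable]:
  assumes "finite F"
  shows "{\<omega>\<in>space M. greedy_chain \<eta> F n s (\<lambda>r. V r \<omega>)} \<in> events"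
proof -
  have "Measurable.pred M (\<lambda>\<omega>. greedy_chain \<eta> F n s (\<lambda>r. V r \<omega>))"
  proof (induction n arbitrary: s)
    case (Suc n)
    have e: "Measurable.pred M (\<lambda>\<omega>. exits_at \<eta> F s u (\<lambda>r. V r \<omega>))" for u
      using exits_at_event[OF assms] by (simp add: pred_def)
    show ?case unfolding greedy_chain.simps
      using assms by (intro pred_intros_finite pred_intros_logic e Suc)
  qed simp
  then show ?thesis by simp
qed

lemma pred_oscillates [measurable]:
  assumes "countable F"
  shows "Measurable.pred M (\<lambda>\<omega>. oscillates \<eta> F n s (\<lambda>r. V r \<omega>))"
proof (induction n arbitrary: s)
  case (Suc n)
  show ?case unfolding oscillates.simps
  proof (intro measurable_pred_countable assms pred_intros_logic)
    show "Measurable.pred M (\<lambda>\<omega>. oscillates \<eta> F n v (\<lambda>r. V r \<omega>))" for v by (rule Suc)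
    show "Measurable.pred M (\<lambda>\<omega>. 2 * \<eta> < norm (V v \<omega> - V u \<omega>))" for u v by measurable
  qed measurable
qed simp

section \<open>Geometric tail of the oscillation count\<close>

lemma prob_exit_sum:
  assumes F: "finite F"
  shows "(\<Sum>u\<in>F. prob {\<omega>\<in>space M. exits_at \<eta> F s u (\<lambda>r. V r \<omega>)})
    = prob {\<omega>\<in>space M. \<exists>u\<in>F. s < u \<and> norm (V u \<omega> - V s \<omega>) > \<eta>}"
proof -
  have "(\<Sum>u\<in>F. prob {\<omega>\<in>space M. exits_at \<eta> F s u (\<lambda>r. V r \<omega>)})
      = prob (\<Union>u\<in>F. {\<omega>\<in>space M. exits_at \<eta> F s u (\<lambda>r. V r \<omega>)})"
  proof (rule finite_measure_finite_Union[symmetric])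
    show "disjoint_family_on (\<lambda>u. {\<omega>\<in>space M. exits_at \<eta> F s u (\<lambda>r. V r \<omega>)}) F"
      unfolding disjoint_family_on_def using exits_at_unique by blast
    show "(\<lambda>u. {\<omega>\<in>space M. exits_at \<eta> F s u (\<lambda>r. V r \<omega>)}) ` F \<subseteq> events"
      using exits_at_event[OF F] by blast
  qed fact
  also have "(\<Union>u\<in>F. {\<omega>\<in>space M. exits_at \<eta> F s u (\<lambda>r. V r \<omega>)})
      = {\<omega>\<in>space M. \<exists>u\<in>F. s < u \<and> norm (V u \<omega> - V s \<omega>) > \<eta>}"
  proof (intro equalityI subsetI)
    fix \<omega> assume "\<omega> \<in> {\<omega>\<in>space M. \<exists>u\<in>F. s < u \<and> norm (V u \<omega> - V s \<omega>) > \<eta>}"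
    then obtain u where "\<omega> \<in> space M" "u \<in> F" "s < u" "norm (V u \<omega> - V s \<omega>) > \<eta>" by blast
    then show "\<omega> \<in> (\<Union>u\<in>F. {\<omega>\<in>space M. exits_at \<eta> F s u (\<lambda>r. V r \<omega>)})"
      using exits_at_exists[OF F, of u s \<eta> "\<lambda>r. V r \<omega>"] by blast
  qed (auto simp: exits_at_def)
  finally show ?thesis .
qed

text \<open>Decompose by the first exit time u from the ball of radius 2a. The increment from u to
  the last time m is independent of the exit and at most a with probability at least 3/4; then V_m
  is further than a from V_s. So 3/4 of the exit probability is at most 1/4, and 1/3 \<le>
  1/2.\<close>

lemma ottaviani_inequality:
  assumes F: "finite F" "F \<subseteq> {0..}" and s: "s \<in> F"
    and small: "\<And>u v. u \<in> F \<Longrightarrow> v \<in> F \<Longrightarrow> u \<le> v \<Longrightarrow> prob {\<omega>\<in>space M. norm (V v \<omega> - V u \<omega>) > a} \<le> 1/4"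
  shows "prob {\<omega>\<in>space M. \<exists>u\<in>F. s < u \<and> norm (V u \<omega> - V s \<omega>) > 2 * a} \<le> 1/2"
proof -
  define m where "m = Max F"
  have m: "m \<in> F" "\<And>u. u \<in> F \<Longrightarrow> u \<le> m" using F s by (auto simp: m_def intro: Max_in)
  let ?E = "\<lambda>u. {\<omega>\<in>space M. exits_at (2 * a) F s u (\<lambda>r. V r \<omega>)}"
  let ?G = "\<lambda>u. {\<omega>\<in>space M. exits_at (2 * a) F s u (\<lambda>r. V r \<omega>) \<and> norm (V m \<omega> - V u \<omega>) \<le> a}"
  have lower: "3/4 * prob (?E u) \<le> prob (?G u)" if u: "u \<in> F" for u
  proof -
    have c [measurable]: "(\<lambda>y. y m) \<in> borel_measurable (PiM F (\<lambda>_. borel :: 'a measure))"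
      using m(1) by (rule measurable_component_singleton)
    have "prob (?G u) = prob (?E u) * prob {\<omega>\<in>space M. norm (V m \<omega> - V u \<omega>) \<le> a}"
    proof (rule prob_past_future[OF F u pred_exits_at[OF F(1) s u]])
      show "Measurable.pred (PiM F (\<lambda>_. borel)) (\<lambda>y :: real \<Rightarrow> 'a. norm (y m) \<le> a)" by measurable
      show "norm ((\<lambda>r\<in>F. V (max r u) \<omega> - V u \<omega>) m) \<le> a \<longleftrightarrow> norm (V m \<omega> - V u \<omega>) \<le> a" for \<omega>
        using m u by (simp add: max_absorb1)
      show "exits_at (2 * a) F s u (\<lambda>r\<in>F. V (min r u) \<omega> - V u \<omega>) \<longleftrightarrow> exits_at (2 * a) F s u (\<lambda>r. V r \<omega>)" for \<omega>
        by (rule exits_at_cong[where c = "- V u \<omega>"]) (use s u in auto)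
    qed
    also have "prob {\<omega>\<in>space M. norm (V m \<omega> - V u \<omega>) \<le> a} = 1 - prob {\<omega>\<in>space M. norm (V m \<omega> - V u \<omega>) > a}"
      using prob_neg[of "\<lambda>\<omega>. norm (V m \<omega> - V u \<omega>) > a"] by (simp add: not_less)
    finally have "prob (?G u) = prob (?E u) * (1 - prob {\<omega>\<in>space M. norm (V m \<omega> - V u \<omega>) > a})" .
    moreover have "prob (?E u) * (3/4) \<le> prob (?E u) * (1 - prob {\<omega>\<in>space M. norm (V m \<omega> - V u \<omega>) > a})"
      using small[OF u m(1) m(2)[OF u]] by (intro mult_left_mono) auto
    ultimately show ?thesis by simp
  qed
  have "3/4 * prob {\<omega>\<in>space M. \<exists>u\<in>F. s < u \<and> norm (V u \<omega> - V s \<omega>) > 2 * a} = (\<Sum>u\<in>F. 3/4 * prob (?E u))"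
    by (simp only: prob_exit_sum[OF F(1), symmetric] sum_distrib_left)
  also have "\<dots> \<le> (\<Sum>u\<in>F. prob (?G u))" by (rule sum_mono) (rule lower)
  also have "\<dots> = prob (\<Union>u\<in>F. ?G u)"
  proof (rule finite_measure_finite_Union[symmetric])
    show "disjoint_family_on ?G F"
      unfolding disjoint_family_on_def using exits_at_unique by blast
    have "?G u = ?E u \<inter> {\<omega>\<in>space M. norm (V m \<omega> - V u \<omega>) \<le> a}" for u by auto
    moreover have "{\<omega>\<in>space M. norm (V m \<omega> - V u \<omega>) \<le> a} \<in> events" for u by measurable
    ultimately have "?G u \<in> events" for u using exits_at_event[OF F(1)] by auto
    then show "?G ` F \<subseteq> events" by blast
  qed fact
  also have "\<dots> \<le> prob {\<omega>\<in>space M. norm (V m \<omega> - V s \<omega>) > a}"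
  proof (rule finite_measure_mono)
    show "(\<Union>u\<in>F. ?G u) \<subseteq> {\<omega>\<in>space M. norm (V m \<omega> - V s \<omega>) > a}"
    proof safe
      fix u \<omega> assume "exits_at (2 * a) F s u (\<lambda>r. V r \<omega>)" "norm (V m \<omega> - V u \<omega>) \<le> a"
      then show "a < norm (V m \<omega> - V s \<omega>)"
        using norm_triangle_ineq4[of "V m \<omega> - V s \<omega>" "V m \<omega> - V u \<omega>"] by (simp add: exits_at_def)
    qed
  qed measurable
  also have "\<dots> \<le> 1/4" using small[OF s m(1) m(2)[OF s]] .
  finally show ?thesis by simp
qed

text \<open>A discrete strong Markov argument: decompose by the first exit u; the rest of the chain
  depends only on increments after u. Each link costs one exit probability, at most 1/2 by
  Ottaviani.\<close>

lemma greedy_chain_prob: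
  assumes F: "finite F" "F \<subseteq> {0..}" and s: "s \<in> F"
    and small: "\<And>u v. u \<in> F \<Longrightarrow> v \<in> F \<Longrightarrow> u \<le> v \<Longrightarrow> prob {\<omega>\<in>space M. norm (V v \<omega> - V u \<omega>) > a} \<le> 1/4"
  shows "prob {\<omega>\<in>space M. greedy_chain (2 * a) F n s (\<lambda>r. V r \<omega>)} \<le> (1/2) ^ n"
  using s
proof (induction n arbitrary: s)
  case (Suc n)
  let ?E = "\<lambda>u. {\<omega>\<in>space M. exits_at (2 * a) F s u (\<lambda>r. V r \<omega>)}"
  let ?G = "\<lambda>u. {\<omega>\<in>space M. exits_at (2 * a) F s u (\<lambda>r. V r \<omega>) \<and> greedy_chain (2 * a) F n u (\<lambda>r. V r \<omega>)}"
  have G: "?G u \<in> events" for u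
  proof -
    have "?G u = ?E u \<inter> {\<omega>\<in>space M. greedy_chain (2 * a) F n u (\<lambda>r. V r \<omega>)}" by auto
    then show ?thesis using exits_at_event[OF F(1)] greedy_chain_event[OF F(1)] by auto
  qed
  have step: "prob (?G u) \<le> prob (?E u) * (1/2) ^ n" if u: "u \<in> F" for u
  proof -
    have "prob (?G u) = prob (?E u) * prob {\<omega>\<in>space M. greedy_chain (2 * a) F n u (\<lambda>r. V r \<omega>)}"
    proof (rule prob_past_future[OF F u pred_exits_at[OF F(1) Suc.prems u] pred_greedy_chain[OF F(1) u]])
      show "exits_at (2 * a) F s u (\<lambda>r\<in>F. V (min r u) \<omega> - V u \<omega>) \<longleftrightarrow> exits_at (2 * a) F s u (\<lambda>r. V r \<omega>)" for \<omega>
        by (rule exits_at_cong[where c = "- V u \<omega>"]) (use Suc.prems u in auto)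
      show "greedy_chain (2 * a) F n u (\<lambda>r\<in>F. V (max r u) \<omega> - V u \<omega>) \<longleftrightarrow> greedy_chain (2 * a) F n u (\<lambda>r. V r \<omega>)" for \<omega>
        by (rule greedy_chain_cong[where c = "- V u \<omega>"]) (use u in auto)
    qed
    also have "\<dots> \<le> prob (?E u) * (1/2) ^ n" using Suc.IH[OF u] by (intro mult_left_mono) auto
    finally show ?thesis .
  qed
  have "prob {\<omega>\<in>space M. greedy_chain (2 * a) F (Suc n) s (\<lambda>r. V r \<omega>)} = prob (\<Union>u\<in>F. ?G u)"
    by (rule arg_cong[where f = prob]) auto
  also have "\<dots> \<le> (\<Sum>u\<in>F. prob (?G u))"
    using G by (intro finite_measure_subadditive_finite F) auto
  also have "\<dots> \<le> (\<Sum>u\<in>F. prob (?E u) * (1/2) ^ n)" by (rule sum_mono) (rule step)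
  also have "\<dots> = prob {\<omega>\<in>space M. \<exists>u\<in>F. s < u \<and> norm (V u \<omega> - V s \<omega>) > 2 * a} * (1/2) ^ n"
    by (simp only: prob_exit_sum[OF F(1), symmetric] sum_distrib_right)
  also have "\<dots> \<le> 1/2 * (1/2) ^ n"
    by (intro mult_right_mono ottaviani_inequality F Suc.prems small) auto
  finally show ?case by simp
qed simp

text \<open>The bound on chains does not depend on the finite time set, so it passes to a countable
  one along an increasing exhaustion. Letting the length tend to infinity excludes paths with
  oscillation sequences of every length.\<close>

lemma AE_finite_oscillation:
  assumes W: "countable W" "W \<subseteq> {0..}" and a: "a > 0"
    and small: "\<And>u v. u \<in> W \<Longrightarrow> v \<in> W \<Longrightarrow> u \<le> v \<Longrightarrow> prob {\<omega>\<in>space M. norm (V v \<omega> - V u \<omega>) > a} \<le> 1/4"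
  shows "AE \<omega> in M. \<exists>n. \<not> oscillates (2 * a) W n q (\<lambda>r. V r \<omega>)"
proof -
  have bound: "prob {\<omega>\<in>space M. oscillates (2 * a) W n q (\<lambda>r. V r \<omega>)} \<le> (1/2) ^ n" for n
  proof (cases "W = {} \<or> n = 0")
    case True
    then show ?thesis by (cases n) auto
  next
    case False
    then have W_range: "range (from_nat_into W) = W" using W by (simp add: range_from_nat_into)
    define F where "F k = from_nat_into W ` {..k}" for k
    have F: "finite (F k)" "F k \<subseteq> W" "F k \<noteq> {}" for k using W_range by (auto simp: F_def)
    let ?Z = "\<lambda>k. {\<omega>\<in>space M. oscillates (2 * a) (F k) n q (\<lambda>r. V r \<omega>)}"
    have Z_meas: "?Z k \<in> events" for k
      using pred_oscillates[OF countable_finite[OF F(1)[of k]]] by (simp add: pred_def)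
    have inc: "incseq ?Z"
    proof (intro monoI subsetI CollectI)
      fix k l \<omega> assume "k \<le> l" "\<omega> \<in> ?Z k"
      moreover have "F k \<subseteq> F l" using \<open>k \<le> l\<close> by (auto simp: F_def)
      ultimately show "\<omega> \<in> space M \<and> oscillates (2 * a) (F l) n q (\<lambda>r. V r \<omega>)"
        using oscillates_mono by blast
    qed
    have "prob (?Z k) \<le> (1/2) ^ n" for k
    proof -
      define r where "r = Min (F k)"
      have r: "r \<in> F k" "\<And>u. u \<in> F k \<Longrightarrow> r \<le> u" using F by (auto simp: r_def)
      have "?Z k \<subseteq> {\<omega>\<in>space M. greedy_chain (2 * a) (F k) n r (\<lambda>r. V r \<omega>)}"
      proof safe
        fix \<omega> assume "oscillates (2 * a) (F k) n q (\<lambda>r. V r \<omega>)"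
        then have "oscillates (2 * a) (F k) n r (\<lambda>r. V r \<omega>)" by (rule oscillates_start) (use r in auto)
        then show "greedy_chain (2 * a) (F k) n r (\<lambda>r. V r \<omega>)"
          by (rule oscillates_imp_greedy_chain[OF F(1) r(1) order_refl]) (use a in simp)
      qed
      then have "prob (?Z k) \<le> prob {\<omega>\<in>space M. greedy_chain (2 * a) (F k) n r (\<lambda>r. V r \<omega>)}"
        by (rule finite_measure_mono) (rule greedy_chain_event[OF F(1)])
      also have "\<dots> \<le> (1/2) ^ n"
      proof (rule greedy_chain_prob[OF F(1) _ r(1)])
        show "F k \<subseteq> {0..}" using F(2)[of k] W(2) by blast
      qed (rule small, use F(2)[of k] in auto)
      finally show ?thesis .
    qed
    moreover have "(\<lambda>k. prob (?Z k)) \<longlonglongrightarrow> prob (\<Union>k. ?Z k)"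
      using Z_meas by (intro finite_Lim_measure_incseq inc) auto
    ultimately have le: "prob (\<Union>k. ?Z k) \<le> (1/2) ^ n"
      by (intro LIMSEQ_le_const2) auto
    have "{\<omega>\<in>space M. oscillates (2 * a) W n q (\<lambda>r. V r \<omega>)} \<subseteq> (\<Union>k. ?Z k)"
    proof safe
      fix \<omega> assume \<omega>: "\<omega> \<in> space M" "oscillates (2 * a) W n q (\<lambda>r. V r \<omega>)"
      then obtain G where G: "finite G" "G \<subseteq> W" "oscillates (2 * a) G n q (\<lambda>r. V r \<omega>)"
        using oscillates_finite_subset[OF \<omega>(2)] by auto
      have "G \<subseteq> range (from_nat_into W)" using G(2) W_range by simp
      then obtain N where N: "finite N" "G = from_nat_into W ` N"
        using G(1) finite_subset_image[of G "from_nat_into W" UNIV] by auto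
      then obtain k where "N \<subseteq> {..k}" by (meson finite_nat_iff_bounded_le)
      then have "G \<subseteq> F k" using N by (auto simp: F_def)
      then have "oscillates (2 * a) (F k) n q (\<lambda>r. V r \<omega>)" using oscillates_mono[OF G(3)] by simp
      then show "\<omega> \<in> (\<Union>k. ?Z k)" using \<omega> by blast
    qed
    then have "prob {\<omega>\<in>space M. oscillates (2 * a) W n q (\<lambda>r. V r \<omega>)} \<le> prob (\<Union>k. ?Z k)"
      by (rule finite_measure_mono) (use Z_meas in auto)
    with le show ?thesis by simp
  qed
  have [measurable]: "Measurable.pred M (\<lambda>\<omega>. oscillates (2 * a) W n q (\<lambda>r. V r \<omega>))" for n
    using W(1) by (rule pred_oscillates)
  have "prob {\<omega>\<in>space M. \<forall>n. oscillates (2 * a) W n q (\<lambda>r. V r \<omega>)} \<le> (1/2) ^ n" for n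
    by (rule order_trans[OF _ bound[of n]], rule finite_measure_mono) auto
  moreover have "(\<lambda>n. (1/2 :: real) ^ n) \<longlonglongrightarrow> 0" by (rule LIMSEQ_power_zero) simp
  ultimately have "prob {\<omega>\<in>space M. \<forall>n. oscillates (2 * a) W n q (\<lambda>r. V r \<omega>)} \<le> 0"
    by (intro LIMSEQ_le_const) auto
  then have "prob {\<omega>\<in>space M. \<forall>n. oscillates (2 * a) W n q (\<lambda>r. V r \<omega>)} = 0"
    by (simp add: measure_le_0_iff)
  then have "AE \<omega> in M. \<not> (\<forall>n. oscillates (2 * a) W n q (\<lambda>r. V r \<omega>))"
    by (subst (asm) prob_eq_0) auto
  then show ?thesis by simp
qed

text \<open>Markov's inequality applied to stochastic continuity. The end points are rational so
  that countably many windows serve all times \<open>t\<close>.\<close>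

lemma small_increments:
  assumes "0 \<le> t" "a > 0"
  obtains q r where "q \<in> \<rat>" "r \<in> \<rat>" "q < t" "t < r"
    "\<And>u v. u \<in> {0..} \<inter> {q..r} \<Longrightarrow> v \<in> {0..} \<inter> {q..r} \<Longrightarrow> u \<le> v \<Longrightarrow> prob {\<omega>\<in>space M. norm (V v \<omega> - V u \<omega>) > a} \<le> 1/4"
proof -
  \<comment> \<open>The truncated norm never exceeds 1, so the threshold is truncated as
    well.\<close>
  define b where "b = min 1 a"
  have b: "b > 0" using assms by (simp add: b_def)
  obtain h where h: "h > 0" "\<And>s u. 0 \<le> s \<Longrightarrow> s \<le> u \<Longrightarrow> u \<le> t + 1 \<Longrightarrow> u - s \<le> h \<Longrightarrow>
      (\<integral>\<omega>. min 1 (norm (V u \<omega> - V s \<omega>)) \<partial>M) \<le> b / 4"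
    using stochastically_continuous[of "b / 4" "t + 1"] b by auto
  obtain q where q: "q \<in> \<rat>" "t - h / 2 < q" "q < t" using Rats_dense_in_real[of "t - h / 2" t] h by auto
  obtain r where r: "r \<in> \<rat>" "t < r" "r < t + min 1 (h / 2)"
    using Rats_dense_in_real[of t "t + min 1 (h / 2)"] h by auto
  show ?thesis
  proof (rule that[OF q(1) r(1) q(3) r(2)])
    fix u v assume u: "u \<in> {0..} \<inter> {q..r}" and v: "v \<in> {0..} \<inter> {q..r}" and uv: "u \<le> v"
    have "prob {\<omega>\<in>space M. norm (V v \<omega> - V u \<omega>) > a} \<le> prob {\<omega>\<in>space M. min 1 (norm (V v \<omega> - V u \<omega>)) \<ge> b}"
      by (rule finite_measure_mono) (auto simp: b_def)
    also have "\<dots> \<le> (\<integral>\<omega>. min 1 (norm (V v \<omega> - V u \<omega>)) \<partial>M) / b"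
    proof (rule integral_Markov_inequality_measure[where A = "space M"])
      show "integrable M (\<lambda>\<omega>. min 1 (norm (V v \<omega> - V u \<omega>)))"
        by (rule integrable_const_bound[where B = 1]) auto
    qed (use b in auto)
    also have "\<dots> \<le> (b / 4) / b"
      using u v uv q r b by (intro divide_right_mono h) auto
    finally show "prob {\<omega>\<in>space M. norm (V v \<omega> - V u \<omega>) > a} \<le> 1/4" using b by simp
  qed
qed

text \<open>The regular version is the right limit of \<open>V\<close> along the rationals. Almost
  surely the oscillation counts over all suitable rational windows are finite, so one-sided limits
  along the rationals exist at every time simultaneously; stochastic continuity identifies the right
  limit with \<open>V t\<close> almost surely for each fixed \<open>t\<close>.\<close>

lemma cadlag_modification:
  obtains U :: "real \<Rightarrow> 'w \<Rightarrow> 'a"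
  where "\<And>t. U t \<in> borel_measurable M" "\<And>\<omega>. cadlag (\<lambda>t. U t \<omega>)" "\<And>\<omega>. U 0 \<omega> = 0"
    "\<And>t. 0 \<le> t \<Longrightarrow> AE \<omega> in M. U t \<omega> = V t \<omega>"
proof -
  define D where "D = \<rat> \<inter> {0 :: real..}"
  have D: "countable D" "D \<subseteq> {0..}" using countable_rat by (auto simp: D_def)
  \<comment> \<open>A deterministic condition on the window, so the exceptional set is a countable
    union over \<open>p\<close>, \<open>q\<close>, \<open>r\<close> although it has to serve
    uncountably many times.\<close>
  define good where "good p q r \<longleftrightarrow> (\<forall>u v. u \<in> {0..} \<inter> {q..r} \<longrightarrow> v \<in> {0..} \<inter> {q..r} \<longrightarrow> u \<le> v \<longrightarrow>
      prob {\<omega>\<in>space M. norm (V v \<omega> - V u \<omega>) > inverse (real (Suc p))} \<le> 1/4)" for p q r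
  define tame where "tame \<omega> \<longleftrightarrow> (\<forall>p. \<forall>q\<in>\<rat>. \<forall>r\<in>\<rat>. good p q r \<longrightarrow>
      (\<exists>n. \<not> oscillates (2 * inverse (real (Suc p))) (D \<inter> {q..r}) n q (\<lambda>t. V t \<omega>)))" for \<omega>
  have cD: "countable (D \<inter> {q..r})" for q r using D(1) by simp
  have tame_meas [measurable]: "Measurable.pred M tame"
    unfolding tame_def[abs_def]
    by (intro pred_intros_countable measurable_pred_countable countable_rat pred_intros_logic pred_oscillates cD) simp
  have tame_AE: "AE \<omega> in M. tame \<omega>"
    unfolding tame_def
  proof (subst AE_all_countable, intro allI, subst AE_ball_countable[OF countable_rat], intro ballI,
         subst AE_ball_countable[OF countable_rat], intro ballI)
    fix p :: nat and q r :: real assume "q \<in> \<rat>" "r \<in> \<rat>"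
    show "AE \<omega> in M. good p q r \<longrightarrow>
        (\<exists>n. \<not> oscillates (2 * inverse (real (Suc p))) (D \<inter> {q..r}) n q (\<lambda>t. V t \<omega>))"
    proof (cases "good p q r")
      case True
      have "AE \<omega> in M. \<exists>n. \<not> oscillates (2 * inverse (real (Suc p))) (D \<inter> {q..r}) n q (\<lambda>t. V t \<omega>)"
      proof (rule AE_finite_oscillation[OF cD])
        fix u v assume "u \<in> D \<inter> {q..r}" "v \<in> D \<inter> {q..r}" "u \<le> v"
        then show "prob {\<omega>\<in>space M. norm (V v \<omega> - V u \<omega>) > inverse (real (Suc p))} \<le> 1/4"
          using True D(2) unfolding good_def by blast
      qed (use D(2) in auto)
      then show ?thesis by simp
    qed simp
  qed
  have osc: "\<exists>\<eta> q r n. 2 * \<eta> < e \<and> q < t \<and> t < r \<and> \<not> oscillates \<eta> (D \<inter> {q..r}) n q (\<lambda>t. V t \<omega>)"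
    if "tame \<omega>" "0 \<le> t" "e > 0" for \<omega> t e
  proof -
    obtain p where p: "inverse (real (Suc p)) < e / 4" using reals_Archimedean[of "e / 4"] \<open>e > 0\<close> by auto
    obtain q r where qr: "q \<in> \<rat>" "r \<in> \<rat>" "q < t" "t < r"
      "\<And>u v. u \<in> {0..} \<inter> {q..r} \<Longrightarrow> v \<in> {0..} \<inter> {q..r} \<Longrightarrow> u \<le> v \<Longrightarrow>
        prob {\<omega>\<in>space M. norm (V v \<omega> - V u \<omega>) > inverse (real (Suc p))} \<le> 1/4"
      using small_increments[OF \<open>0 \<le> t\<close>, of "inverse (real (Suc p))"] by auto
    then have "good p q r" unfolding good_def by blast
    then obtain n where "\<not> oscillates (2 * inverse (real (Suc p))) (D \<inter> {q..r}) n q (\<lambda>t. V t \<omega>)"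
      using \<open>tame \<omega>\<close> qr unfolding tame_def by blast
    then show ?thesis using p qr by (intro exI[of _ "2 * inverse (real (Suc p))"] exI) auto
  qed
  have "\<exists>d :: nat \<Rightarrow> real. \<forall>n. d n \<in> \<rat> \<and> t < d n \<and> d n < t + inverse (real (Suc n))" for t :: real
    by (rule choice) (metis Rats_dense_in_real inverse_positive_iff_positive less_add_same_cancel1 of_nat_0_less_iff zero_less_Suc)
  then obtain d :: "real \<Rightarrow> nat \<Rightarrow> real"
    where d: "\<And>t n. d t n \<in> \<rat>" "\<And>t n. t < d t n" "\<And>t n. d t n < t + inverse (real (Suc n))"
    by metis
  have d_lim: "d t \<longlonglongrightarrow> t" for t
  proof (rule tendsto_sandwich)
    show "\<forall>\<^sub>F n in sequentially. t \<le> d t n" "\<forall>\<^sub>F n in sequentially. d t n \<le> t + inverse (real (Suc n))"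
      by (intro always_eventually allI less_imp_le d)+
    show "(\<lambda>n. t + inverse (real (Suc n))) \<longlonglongrightarrow> t"
      using tendsto_add[OF tendsto_const LIMSEQ_inverse_real_of_nat, of t] by simp
  qed simp
  have dD: "d t n \<in> D" if "0 \<le> t" for t n using d(1,2)[of t n] that by (simp add: D_def)
  have d_filter: "filterlim (d t) (at t within D \<inter> {t<..}) sequentially" if "0 \<le> t" for t
    unfolding filterlim_at using d_lim dD[OF that] d(2) by (auto intro!: always_eventually simp: less_imp_neq[symmetric])
  have D_dense: "\<exists>x\<in>D. s < x \<and> x < u" if "0 \<le> s" "s < u" for s u
    using Rats_dense_in_real[OF that(2)] that by (auto simp: D_def)
  \<comment> \<open>The limit is taken along one fixed sequence for each \<open>t\<close>, which
    makes \<open>R t\<close> measurable.\<close>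
  define R where "R t \<omega> = lim (\<lambda>n. V (d t n) \<omega>)" for t \<omega>
  have R_meas [measurable]: "R t \<in> borel_measurable M" for t
    unfolding R_def by measurable
  have right: "((\<lambda>s. V s \<omega>) \<longlongrightarrow> R t \<omega>) (at t within D \<inter> {t<..})" "(\<lambda>n. V (d t n) \<omega>) \<longlonglongrightarrow> R t \<omega>"
    if tame: "tame \<omega>" "0 \<le> t" for t \<omega>
  proof -
    obtain l where l: "((\<lambda>s. V s \<omega>) \<longlongrightarrow> l) (at t within D \<inter> {t<..})"
      using right_limit_of_finite_oscillation[OF osc[OF tame] D_dense[OF tame(2)]] by blast
    have "(\<lambda>n. V (d t n) \<omega>) \<longlonglongrightarrow> l" by (rule filterlim_compose[OF l d_filter[OF tame(2)]])
    moreover from this have "R t \<omega> = l" unfolding R_def by (rule limI)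
    ultimately show "((\<lambda>s. V s \<omega>) \<longlongrightarrow> R t \<omega>) (at t within D \<inter> {t<..})" "(\<lambda>n. V (d t n) \<omega>) \<longlonglongrightarrow> R t \<omega>"
      using l by simp_all
  qed
  have R_near: "dist (R s \<omega>) l \<le> e"
    if "tame \<omega>" "0 \<le> s" "s < b" "\<And>x. x \<in> D \<Longrightarrow> s < x \<Longrightarrow> x < b \<Longrightarrow> dist (V x \<omega>) l \<le> e" for s b l e \<omega>
  proof (rule tendsto_le[OF sequentially_bot tendsto_const])
    show "(\<lambda>n. dist (V (d s n) \<omega>) l) \<longlonglongrightarrow> dist (R s \<omega>) l"
      by (intro tendsto_intros right(2) that)
    have "\<forall>\<^sub>F n in sequentially. d s n < b" using d_lim that(3) by (rule order_tendstoD)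
    then show "\<forall>\<^sub>F n in sequentially. dist (V (d s n) \<omega>) l \<le> e"
      by eventually_elim (use that dD d(2) in auto)
  qed
  have R_cadlag: "cadlag (\<lambda>t. R t \<omega>)" if \<omega>: "tame \<omega>" for \<omega>
    unfolding cadlag_def
  proof (intro conjI allI impI)
    fix t :: real assume t: "0 \<le> t"
    show "((\<lambda>t. R t \<omega>) \<longlongrightarrow> R t \<omega>) (at_right t)"
    proof (rule tendstoI)
      fix e :: real assume e: "e > 0"
      then have "\<forall>\<^sub>F x in at t within D \<inter> {t<..}. dist (V x \<omega>) (R t \<omega>) < e / 2"
        by (intro tendstoD right(1) \<omega> t) simp
      then obtain \<delta> where \<delta>: "\<delta> > 0" "\<And>x. x \<in> D \<Longrightarrow> t < x \<Longrightarrow> x < t + \<delta> \<Longrightarrow> dist (V x \<omega>) (R t \<omega>) < e / 2"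
        unfolding eventually_at by (auto simp: dist_real_def)
      have "dist (R s \<omega>) (R t \<omega>) < e" if "t < s" "s < t + \<delta>" for s
      proof -
        have "dist (R s \<omega>) (R t \<omega>) \<le> e / 2"
        proof (rule R_near[OF \<omega>, of s "t + \<delta>"])
          show "dist (V x \<omega>) (R t \<omega>) \<le> e / 2" if "x \<in> D" "s < x" "x < t + \<delta>" for x
            using that \<open>t < s\<close> by (intro less_imp_le \<delta>(2)) auto
        qed (use that t in auto)
        then show ?thesis using e by simp
      qed
      then show "\<forall>\<^sub>F s in at_right t. dist (R s \<omega>) (R t \<omega>) < e"
        unfolding eventually_at_right_field using \<delta>(1) by (intro exI[of _ "t + \<delta>"]) auto
    qed
  next
    fix t :: real assume t: "0 < t"
    have "\<exists>l. ((\<lambda>s. V s \<omega>) \<longlongrightarrow> l) (at t within D \<inter> {..<t})"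
    proof (rule left_limit_of_finite_oscillation[OF osc[OF \<omega>]])
      fix u assume "u < t"
      then show "\<exists>x\<in>D. u < x \<and> x < t" using D_dense[of "max u 0" t] t by auto
    qed (use t in auto)
    then obtain l where l: "((\<lambda>s. V s \<omega>) \<longlongrightarrow> l) (at t within D \<inter> {..<t})" by blast
    have "((\<lambda>t. R t \<omega>) \<longlongrightarrow> l) (at_left t)"
    proof (rule tendstoI)
      fix e :: real assume e: "e > 0"
      then have "\<forall>\<^sub>F x in at t within D \<inter> {..<t}. dist (V x \<omega>) l < e / 2"
        by (intro tendstoD[OF l]) simp
      then obtain \<delta> where \<delta>: "\<delta> > 0" "\<And>x. x \<in> D \<Longrightarrow> t - \<delta> < x \<Longrightarrow> x < t \<Longrightarrow> dist (V x \<omega>) l < e / 2"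
        unfolding eventually_at by (auto simp: dist_real_def)
      have "dist (R s \<omega>) l < e" if "max 0 (t - \<delta>) < s" "s < t" for s
      proof -
        have "dist (R s \<omega>) l \<le> e / 2"
        proof (rule R_near[OF \<omega>, of s t])
          show "dist (V x \<omega>) l \<le> e / 2" if "x \<in> D" "s < x" "x < t" for x
            using that \<open>max 0 (t - \<delta>) < s\<close> by (intro less_imp_le \<delta>(2)) auto
        qed (use that in auto)
        then show ?thesis using e by simp
      qed
      then show "\<forall>\<^sub>F s in at_left t. dist (R s \<omega>) l < e"
        unfolding eventually_at_left_field using \<delta>(1) t by (intro exI[of _ "max 0 (t - \<delta>)"]) auto
    qed
    then show "\<exists>l. ((\<lambda>t. R t \<omega>) \<longlongrightarrow> l) (at_left t)" by blast
  qed
  have R_V: "AE \<omega> in M. R t \<omega> = V t \<omega>" if t: "0 \<le> t" for t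
  proof -
    let ?f = "\<lambda>n \<omega>. min 1 (norm (V (d t n) \<omega> - V t \<omega>))"
    have "(\<lambda>n. \<integral>\<omega>. ?f n \<omega> \<partial>M) \<longlonglongrightarrow> (\<integral>\<omega>. min 1 (norm (R t \<omega> - V t \<omega>)) \<partial>M)"
    proof (rule integral_dominated_convergence[where w = "\<lambda>_. 1"])
      show "AE \<omega> in M. (\<lambda>n. ?f n \<omega>) \<longlonglongrightarrow> min 1 (norm (R t \<omega> - V t \<omega>))"
        using tame_AE by eventually_elim (intro tendsto_intros right(2) t)
    qed auto
    moreover have "(\<lambda>n. \<integral>\<omega>. ?f n \<omega> \<partial>M) \<longlonglongrightarrow> 0"
    proof (rule tendstoI)
      fix e :: real assume e: "e > 0"
      then obtain h where h: "h > 0" "\<And>s u. 0 \<le> s \<Longrightarrow> s \<le> u \<Longrightarrow> u \<le> t + 1 \<Longrightarrow> u - s \<le> h \<Longrightarrow>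
          (\<integral>\<omega>. min 1 (norm (V u \<omega> - V s \<omega>)) \<partial>M) \<le> e / 2"
        using stochastically_continuous[of "e / 2" "t + 1"] by auto
      have "\<forall>\<^sub>F n in sequentially. d t n < t + min 1 h" using d_lim h(1) by (intro order_tendstoD) auto
      then show "\<forall>\<^sub>F n in sequentially. dist (\<integral>\<omega>. ?f n \<omega> \<partial>M) 0 < e"
      proof eventually_elim
        case (elim n)
        have "0 \<le> (\<integral>\<omega>. ?f n \<omega> \<partial>M)" by (rule Bochner_Integration.integral_nonneg) simp
        moreover have "(\<integral>\<omega>. ?f n \<omega> \<partial>M) \<le> e / 2"
          using elim t d(2)[of t n] by (intro h) auto
        ultimately show ?case using e by (simp add: dist_real_def)
      qed
    qed
    ultimately have "(\<integral>\<omega>. min 1 (norm (R t \<omega> - V t \<omega>)) \<partial>M) = 0" by (rule LIMSEQ_unique)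
    moreover have "integrable M (\<lambda>\<omega>. min 1 (norm (R t \<omega> - V t \<omega>)))"
      by (rule integrable_const_bound[where B = 1]) auto
    ultimately have "AE \<omega> in M. min 1 (norm (R t \<omega> - V t \<omega>)) = 0"
      by (subst (asm) integral_nonneg_eq_0_iff_AE) auto
    then show ?thesis by eventually_elim (auto simp: min_def split: if_splits)
  qed
  \<comment> \<open>\<open>R 0\<close> is a right limit and equals \<open>V 0 = 0\<close> only
    almost surely. Where it does not, or where the path is not tame, the zero path is substituted,
    so that every path is cadlag and starts at 0.\<close>
  define U where "U t \<omega> = (if tame \<omega> \<and> R 0 \<omega> = 0 then R t \<omega> else 0)" for t \<omega>
  show ?thesis
  proof (rule that[of U])
    show "U t \<in> borel_measurable M" for t unfolding U_def by measurable
    show "cadlag (\<lambda>t. U t \<omega>)" for \<omega>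
    proof (cases "tame \<omega> \<and> R 0 \<omega> = 0")
      case True
      then show ?thesis using R_cadlag[of \<omega>] by (simp add: U_def)
    next
      case False
      then have "(\<lambda>t. U t \<omega>) = (\<lambda>_. 0)" by (auto simp: U_def)
      then show ?thesis by (auto simp: cadlag_def)
    qed
    show "U 0 \<omega> = 0" for \<omega> by (simp add: U_def)
    show "AE \<omega> in M. U t \<omega> = V t \<omega>" if "0 \<le> t" for t
      using tame_AE R_V[OF order_refl] R_V[OF that] by eventually_elim (simp add: U_def V_0)
  qed
qed

end

section \<open>The Levy process of a generalized Mehler semigroup\<close>

lemma borel_measurable_blinfun_apply [measurable]: "blinfun_apply A \<in> borel_measurable borel"
  by (intro borel_measurable_continuous_onI linear_continuous_on blinfun.bounded_linear_right)

lemma (in prob_space) indep_vars_of_distr_eq_PiM: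
  fixes X :: "'i \<Rightarrow> 'a \<Rightarrow> 'b::topological_space"
  assumes X [measurable]: "\<And>i. i \<in> I \<Longrightarrow> X i \<in> borel_measurable M"
    and \<kappa>: "\<And>i. i \<in> I \<Longrightarrow> prob_space (\<kappa> i)" "\<And>i. i \<in> I \<Longrightarrow> sets (\<kappa> i) = sets borel"
    and joint: "distr M (PiM I (\<lambda>_. borel)) (\<lambda>\<omega>. \<lambda>i\<in>I. X i \<omega>) = PiM I \<kappa>"
  shows "indep_vars (\<lambda>_. borel) X I" "\<And>i. i \<in> I \<Longrightarrow> distr M borel (X i) = \<kappa> i"
proof -
  show law: "distr M borel (X i) = \<kappa> i" if i: "i \<in> I" for i
  proof -
    have "distr M borel (X i) = distr (distr M (PiM I (\<lambda>_. borel)) (\<lambda>\<omega>. \<lambda>i\<in>I. X i \<omega>)) borel (\<lambda>x. x i)"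
      using i by (subst distr_distr) (auto simp: comp_def intro!: measurable_component_singleton measurable_restrict X)
    also have "\<dots> = distr (PiM I \<kappa>) (\<kappa> i) (\<lambda>x. x i)"
      unfolding joint using \<kappa>(2)[OF i] by (intro distr_cong) auto
    also have "\<dots> = \<kappa> i" using i by (intro distr_PiM_component \<kappa>)
    finally show ?thesis .
  qed
  show "indep_vars (\<lambda>_. borel) X I"
  proof (cases "I = {}")
    case True
    then show ?thesis by (simp add: indep_vars_def indep_sets_def)
  next
    case False
    have "PiM I \<kappa> = PiM I (\<lambda>i. distr M borel (X i))" by (rule PiM_cong) (simp_all add: law)
    then show ?thesis
      using joint by (subst indep_vars_iff_distr_eq_PiM'[OF False]) (auto intro: X)
  qed
qed

lemma (in prob_space) distr_eq_PiM_of_indep_vars: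
  fixes X :: "'i \<Rightarrow> 'a \<Rightarrow> 'b::topological_space"
  assumes "I \<noteq> {}" "indep_vars (\<lambda>_. borel) X I" and law: "\<And>i. i \<in> I \<Longrightarrow> distr M borel (X i) = \<kappa> i"
  shows "distr M (PiM I (\<lambda>_. borel)) (\<lambda>\<omega>. \<lambda>i\<in>I. X i \<omega>) = PiM I \<kappa>"
proof -
  have X: "X i \<in> borel_measurable M" if "i \<in> I" for i using assms(2) that by (simp add: indep_vars_def)
  have "distr M (PiM I (\<lambda>_. borel)) (\<lambda>\<omega>. \<lambda>i\<in>I. X i \<omega>) = PiM I (\<lambda>i. distr M borel (X i))"
    using assms(2) by (subst (asm) indep_vars_iff_distr_eq_PiM'[OF assms(1)]) (auto intro: X)
  also have "\<dots> = PiM I \<kappa>" by (rule PiM_cong) (simp_all add: law)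
  finally show ?thesis .
qed

text \<open>One sequence of partitions, the same for all paths, turns pathwise integrals into limits
  of finite sums of increments; measurability, independence and laws can then be computed on these
  sums.\<close>

lemma has_dy_integral_uniform_limit:
  assumes "has_dy_integral g y a b I" "a < b"
  shows "(\<lambda>m. dy_sum g y (Suc m) (\<lambda>i. a + real i * ((b - a) / real (Suc m)))) \<longlonglongrightarrow> I"
proof (rule LIMSEQ_I)
  fix e :: real assume "e > 0"
  then obtain d where d: "d > 0" "\<And>n t. is_partition a b n t \<Longrightarrow> (\<forall>i<n. t (Suc i) - t i < d) \<Longrightarrow>
      norm (dy_sum g y n t - I) < e"
    using assms(1) unfolding has_dy_integral_def by meson
  obtain N where N: "real N * d > b - a" using reals_Archimedean3[OF d(1)] by blast
  have "norm (dy_sum g y (Suc m) (\<lambda>i. a + real i * ((b - a) / real (Suc m))) - I) < e" if "m \<ge> N" for m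
  proof (rule d(2))
    show "is_partition a b (Suc m) (\<lambda>i. a + real i * ((b - a) / real (Suc m)))"
      by (rule is_partition_uniform[OF assms(2)]) simp
    have "b - a < real (Suc m) * d"
      by (rule less_le_trans[OF N mult_right_mono]) (use that d(1) in auto)
    then have "(b - a) / real (Suc m) < d" by (simp add: pos_divide_less_eq mult.commute del: of_nat_Suc)
    then show "\<forall>i<Suc m. a + real (Suc i) * ((b - a) / real (Suc m)) - (a + real i * ((b - a) / real (Suc m))) < d"
      unfolding uniform_partition_step by blast
  qed
  then show "\<exists>no. \<forall>m\<ge>no. norm (dy_sum g y (Suc m) (\<lambda>i. a + real i * ((b - a) / real (Suc m))) - I) < e"
    by blast
qed

lemma random_integral_eq:
  assumes "a \<le> b" "has_dy_integral g (\<lambda>t. Y t \<omega>) a b I"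
  shows "random_integral g Y a b \<omega> = I" "dg_integrable g (\<lambda>t. Y t \<omega>) a b"
proof -
  have dg: "has_dg_integral g (\<lambda>t. Y t \<omega>) a b (g b (Y b \<omega>) - g a (Y a \<omega>) - I)"
    using assms(2) by (simp add: has_dy_integral_iff_dg)
  then show "dg_integrable g (\<lambda>t. Y t \<omega>) a b" by (auto simp: dg_integrable_def)
  have "dg_integral g (\<lambda>t. Y t \<omega>) a b = g b (Y b \<omega>) - g a (Y a \<omega>) - I"
    unfolding dg_integral_def using dg has_dg_integral_unique[OF assms(1)] by (intro the_equality) auto
  then show "random_integral g Y a b \<omega> = I" by (simp add: random_integral_def)
qed

locale uniformly_continuous_mehler = uniformly_continuous_semigroup T
  for T :: "real \<Rightarrow> 'a::{banach, second_countable_topology} \<Rightarrow>\<^sub>L 'a" +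
  fixes \<rho> :: "real \<Rightarrow> 'a measure" and P :: "real \<Rightarrow> ('a \<Rightarrow>\<^sub>C real) \<Rightarrow> ('a \<Rightarrow>\<^sub>C real)"
  assumes mehler: "generalized_mehler_semigroup T \<rho> P"
    and weakly_continuous: "weakly_continuous_at_zero \<rho>"
begin

lemma prob_\<rho>: "0 \<le> t \<Longrightarrow> prob_space (\<rho> t)"
  and sets_\<rho>: "0 \<le> t \<Longrightarrow> sets (\<rho> t) = sets borel"
  and P_eq: "0 \<le> t \<Longrightarrow> P t f x = (\<integral>y. f (T t x + y) \<partial>\<rho> t)"
  and P_comp: "0 \<le> s \<Longrightarrow> 0 \<le> t \<Longrightarrow> P t (P s f) = P (t + s) f"
  using mehler unfolding generalized_mehler_semigroup_def by (auto simp: fun_eq_iff)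

lemma measurable_\<rho>: "0 \<le> t \<Longrightarrow> f \<in> measurable (\<rho> t) N \<longleftrightarrow> f \<in> measurable borel N"
  using measurable_cong_sets[OF sets_\<rho> refl] by auto

text \<open>The semigroup law evaluated at x = 0: P_t P_s f (0) is the double integral of f(T_s y +
  z) over y with law \<rho>_t and z with law \<rho>_s.\<close>

lemma skew_convolution:
  assumes "0 \<le> s" "0 \<le> t"
  shows "distr (\<rho> t \<Otimes>\<^sub>M \<rho> s) borel (\<lambda>(y, z). T s y + z) = \<rho> (t + s)"
proof -
  interpret t: prob_space "\<rho> t" using assms by (intro prob_\<rho>)
  interpret s: prob_space "\<rho> s" using assms by (intro prob_\<rho>)
  interpret ts: pair_prob_space "\<rho> t" "\<rho> s" ..
  note [measurable_cong] = sets_\<rho>[OF assms(1)] sets_\<rho>[OF assms(2)]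
  show ?thesis
  proof (rule prob_eqI_bcontfun)
    show "prob_space (distr (\<rho> t \<Otimes>\<^sub>M \<rho> s) borel (\<lambda>(y, z). T s y + z))"
      by (rule ts.P.prob_space_distr) measurable
    show "prob_space (\<rho> (t + s))" "sets (\<rho> (t + s)) = sets borel"
      using assms by (simp_all add: prob_\<rho> sets_\<rho>)
    fix f :: "'a \<Rightarrow>\<^sub>C real"
    have int: "integrable (\<rho> t \<Otimes>\<^sub>M \<rho> s) (\<lambda>z. f (T s (fst z) + snd z))"
      by (rule ts.P.integrable_bcontfun) measurable
    have "(\<integral>x. f x \<partial>distr (\<rho> t \<Otimes>\<^sub>M \<rho> s) borel (\<lambda>(y, z). T s y + z))
        = (\<integral>z. f (case z of (y, z) \<Rightarrow> T s y + z) \<partial>(\<rho> t \<Otimes>\<^sub>M \<rho> s))"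
      by (rule Bochner_Integration.integral_distr) measurable
    also have "\<dots> = (\<integral>z. f (T s (fst z) + snd z) \<partial>(\<rho> t \<Otimes>\<^sub>M \<rho> s))" by (simp add: case_prod_beta)
    also have "\<dots> = (\<integral>y. \<integral>z. f (T s y + z) \<partial>\<rho> s \<partial>\<rho> t)"
      using ts.integral_fst'[OF int] by simp
    also have "\<dots> = P t (P s f) 0" using assms by (simp add: P_eq blinfun.zero_right)
    also have "\<dots> = P (t + s) f 0" using assms by (simp add: P_comp)
    also have "\<dots> = (\<integral>x. f x \<partial>\<rho> (t + s))" using assms by (simp add: P_eq blinfun.zero_right)
    finally show "(\<integral>x. f x \<partial>distr (\<rho> t \<Otimes>\<^sub>M \<rho> s) borel (\<lambda>(y, z). T s y + z)) = (\<integral>x. f x \<partial>\<rho> (t + s))" .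
  qed simp
qed

lemma \<rho>_0: "AE x in \<rho> 0. x = 0"
proof (rule prob_idempotent_convolution_imp_AE_zero)
  show "distr (\<rho> 0 \<Otimes>\<^sub>M \<rho> 0) borel (\<lambda>(x, y). x + y) = \<rho> 0"
    using skew_convolution[of 0 0] by (simp add: T_0)
qed (simp_all add: prob_\<rho> sets_\<rho>)

text \<open>Continuity at zero is tested on this bounded continuous function, whose integral over
  \<open>\<rho> 0\<close> is 0. The factor \<open>C\<close> will absorb the norms of the inverse
  operators.\<close>

lemma small_time:
  assumes "0 \<le> C" "0 < e"
  shows "\<exists>h>0. \<forall>t. 0 \<le> t \<and> t \<le> h \<longrightarrow> (\<integral>x. min 1 (C * norm x) \<partial>\<rho> t) \<le> e"
proof -
  define f where "f = Bcontfun (\<lambda>x :: 'a. min 1 (C * norm x))"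
  have "(\<lambda>x :: 'a. min 1 (C * norm x)) \<in> bcontfun"
  proof (rule bcontfun_normI[where b = 1])
    show "norm (min 1 (C * norm x)) \<le> 1" for x :: 'a using assms by simp
  qed (intro continuous_intros)
  then have f: "apply_bcontfun f = (\<lambda>x. min 1 (C * norm x))" by (simp add: f_def Bcontfun_inverse)
  have "(\<integral>x. f x \<partial>\<rho> 0) = (\<integral>x. 0 \<partial>\<rho> 0)"
  proof (rule integral_cong_AE)
    show "AE x in \<rho> 0. f x = 0" using \<rho>_0 by eventually_elim (simp add: f)
    show "apply_bcontfun f \<in> borel_measurable (\<rho> 0)" by (simp add: measurable_\<rho>)
  qed simp
  then have f0: "(\<integral>x. f x \<partial>\<rho> 0) = 0" by simp
  have "((\<lambda>t. \<integral>x. f x \<partial>\<rho> t) \<longlongrightarrow> 0) (at 0 within {0..})"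
    using weakly_continuous f0 unfolding weakly_continuous_at_zero_def by metis
  then have "\<forall>\<^sub>F t in at 0 within {0..}. (\<integral>x. f x \<partial>\<rho> t) < e" using assms(2) by (rule order_tendstoD)
  then obtain h where h: "h > 0" "\<And>t. 0 \<le> t \<Longrightarrow> t \<noteq> 0 \<Longrightarrow> t < h \<Longrightarrow> (\<integral>x. f x \<partial>\<rho> t) < e"
    unfolding eventually_at by (auto simp: dist_real_def)
  have "(\<integral>x. min 1 (C * norm x) \<partial>\<rho> t) \<le> e" if "0 \<le> t" "t \<le> h / 2" for t
    using h(1) h(2)[of t] f0 that assms(2) by (cases "t = 0") (auto simp: f)
  then show ?thesis using h(1) by (intro exI[of _ "h / 2"]) auto
qed

lemma mehler_levy_representation:
  "\<exists>(M :: (real \<Rightarrow> 'a) measure) Y. levy_process M Y \<and> mehler_representation T P M Y"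
proof -
  obtain R :: "real \<Rightarrow> 'a \<Rightarrow>\<^sub>L 'a" where TR: "\<And>t x. 0 \<le> t \<Longrightarrow> T t (R t x) = x"
    and RT: "\<And>t x. 0 \<le> t \<Longrightarrow> R t (T t x) = x"
    and R_bound: "\<And>K. \<exists>C. \<forall>t. 0 \<le> t \<and> t \<le> K \<longrightarrow> norm (R t) \<le> C"
    using T_inverse by metis
  \<comment> \<open>With \<open>R t\<close> read as T_{-t}, these are instances of the group
    law.\<close>
  have RT_add: "R (t + s) (T s x) = R t x" "T t (R (t + s) x) = R s x" if "0 \<le> s" "0 \<le> t" for s t x
  proof -
    have "R (t + s) (T s x) = R (t + s) (T (s + t) (R t x))"
      using TR[OF that(2)] T_add_apply[OF that(2,1)] by metis
    then show "R (t + s) (T s x) = R t x" using RT[of "t + s" "R t x"] that by (simp add: add.commute)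
    have "T s (T t (R (t + s) x)) = x" using T_add_apply[OF that(2,1)] TR[of "t + s" x] that by (simp add: add.commute)
    then show "T t (R (t + s) x) = R s x" using RT[OF that(1)] by metis
  qed
  \<comment> \<open>the law of the increment \<open>U t - U s\<close> of \<open>U t = T (- t) X t\<close>, where \<open>X\<close> is the Markov process
    with transition semigroup \<open>P\<close> started at 0\<close>
  define \<nu> where "\<nu> s t = distr (\<rho> (t - s)) borel (R t)" for s t
  have \<nu>_prob: "prob_space (\<nu> s t)" if "0 \<le> s" "s \<le> t" for s t
    unfolding \<nu>_def using that
    by (intro prob_space.prob_space_distr prob_\<rho>) (auto simp: measurable_\<rho>)
  have \<nu>_sets: "sets (\<nu> s t) = sets borel" for s t by (simp add: \<nu>_def)
  interpret hemigroup \<nu>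
  proof (rule hemigroup.intro[OF \<nu>_prob \<nu>_sets])
    fix s t u :: real assume stu: "0 \<le> s" "s < t" "t < u"
    have nonneg: "0 \<le> t - s" "0 \<le> u - t" using stu by auto
    note [measurable_cong] = sets_\<rho>[OF nonneg(1)] sets_\<rho>[OF nonneg(2)]
    interpret tu: prob_space "\<nu> t u" using stu by (intro \<nu>_prob) auto
    have sf: "sigma_finite_measure (distr (\<rho> (u - t)) borel (R u))"
      using tu.sigma_finite_measure_axioms by (simp add: \<nu>_def)
    have "\<nu> s t \<Otimes>\<^sub>M \<nu> t u = distr (\<rho> (t - s) \<Otimes>\<^sub>M \<rho> (u - t)) (borel \<Otimes>\<^sub>M borel) (\<lambda>(y, z). (R t y, R u z))"
      unfolding \<nu>_def by (rule pair_measure_distr[OF _ _ sf]) measurable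
    then have "distr (\<nu> s t \<Otimes>\<^sub>M \<nu> t u) borel (\<lambda>(x, y). x + y)
        = distr (\<rho> (t - s) \<Otimes>\<^sub>M \<rho> (u - t)) borel ((\<lambda>(x, y). x + y) \<circ> (\<lambda>(y, z). (R t y, R u z)))"
      by (simp add: distr_distr)
    \<comment> \<open>R_t y + R_u z = R_u (T_{u-t} y + z): the pull-back converts the skew
      convolution of \<rho> into an ordinary one.\<close>
    also have "(\<lambda>(x, y). x + y) \<circ> (\<lambda>(y, z). (R t y, R u z)) = R u \<circ> (\<lambda>(y, z). T (u - t) y + z)"
      using RT_add(1)[of "u - t" t] stu by (auto simp: fun_eq_iff blinfun.bilinear_simps)
    also have "distr (\<rho> (t - s) \<Otimes>\<^sub>M \<rho> (u - t)) borel (R u \<circ> (\<lambda>(y, z). T (u - t) y + z))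
        = distr (distr (\<rho> (t - s) \<Otimes>\<^sub>M \<rho> (u - t)) borel (\<lambda>(y, z). T (u - t) y + z)) borel (R u)"
      by (rule distr_distr[symmetric]) measurable
    also have "\<dots> = \<nu> s u"
      unfolding \<nu>_def by (subst skew_convolution[OF nonneg(2,1)]) simp
    finally show "distr (\<nu> s t \<Otimes>\<^sub>M \<nu> t u) borel (\<lambda>(x, y). x + y) = \<nu> s u" .
  qed
  obtain M :: "(real \<Rightarrow> 'a) measure" and V :: "real \<Rightarrow> (real \<Rightarrow> 'a) \<Rightarrow> 'a"
    where M: "prob_space M" and V_meas: "\<And>t. V t \<in> borel_measurable M" and V_0: "\<And>\<omega>. V 0 \<omega> = 0"
    and V_joint: "\<And>n t. 0 \<le> t 0 \<Longrightarrow> (\<And>i. i < n \<Longrightarrow> t i < t (Suc i)) \<Longrightarrow>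
      distr M (PiM {..<n} (\<lambda>_. borel)) (\<lambda>\<omega>. \<lambda>i\<in>{..<n}. V (t (Suc i)) \<omega> - V (t i) \<omega>)
        = PiM {..<n} (\<lambda>i. \<nu> (t i) (t (Suc i)))"
    by (rule additive_process_exists) blast
  interpret prob_space M by (rule M)
  note [measurable] = V_meas
  \<comment> \<open>Stated for an arbitrary modification \<open>W\<close> of \<open>V\<close>: it is
    applied to \<open>V\<close> itself for stochastic continuity and later to \<open>U\<close>.
    Finitely many times meet only a null set.\<close>
  have incr_law: "indep_vars (\<lambda>_. borel) (\<lambda>i \<omega>. W (t (Suc i)) \<omega> - W (t i) \<omega>) {..<n}"
    "\<And>i. i < n \<Longrightarrow> distr M borel (\<lambda>\<omega>. W (t (Suc i)) \<omega> - W (t i) \<omega>) = \<nu> (t i) (t (Suc i))"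
    if t: "0 \<le> t 0" "\<And>i. i < n \<Longrightarrow> t i < t (Suc i)" and W: "\<And>t. W t \<in> borel_measurable M"
      "\<And>t. 0 \<le> t \<Longrightarrow> AE \<omega> in M. W t \<omega> = V t \<omega>" for n t W
  proof -
    have t_nonneg: "0 \<le> t i" if "i \<le> n" for i
      using that
    proof (induction i)
      case (Suc i)
      then show ?case using t(2)[of i] by simp
    qed (use t in simp)
    have joint: "distr M (PiM {..<n} (\<lambda>_. borel)) (\<lambda>\<omega>. \<lambda>i\<in>{..<n}. W (t (Suc i)) \<omega> - W (t i) \<omega>)
        = PiM {..<n} (\<lambda>i. \<nu> (t i) (t (Suc i)))"
    proof (subst V_joint[OF t, symmetric])
      show "distr M (PiM {..<n} (\<lambda>_. borel)) (\<lambda>\<omega>. \<lambda>i\<in>{..<n}. W (t (Suc i)) \<omega> - W (t i) \<omega>)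
        = distr M (PiM {..<n} (\<lambda>_. borel)) (\<lambda>\<omega>. \<lambda>i\<in>{..<n}. V (t (Suc i)) \<omega> - V (t i) \<omega>)"
      proof (rule distr_cong_AE)
        have "AE \<omega> in M. \<forall>i\<in>{..n}. W (t i) \<omega> = V (t i) \<omega>"
          using W(2) t_nonneg by (intro AE_finite_allI) auto
        then show "AE \<omega> in M. (\<lambda>i\<in>{..<n}. W (t (Suc i)) \<omega> - W (t i) \<omega>) = (\<lambda>i\<in>{..<n}. V (t (Suc i)) \<omega> - V (t i) \<omega>)"
          by eventually_elim (auto simp: restrict_def fun_eq_iff)
      qed (auto intro!: measurable_restrict borel_measurable_diff W(1) V_meas)
    qed auto
    have p: "prob_space (\<nu> (t i) (t (Suc i)))" if "i \<in> {..<n}" for i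
      using that t_nonneg[of i] t(2)[of i] by (intro \<nu>_prob) auto
    show "indep_vars (\<lambda>_. borel) (\<lambda>i \<omega>. W (t (Suc i)) \<omega> - W (t i) \<omega>) {..<n}"
      by (rule indep_vars_of_distr_eq_PiM(1)[OF _ p \<nu>_sets joint]) (intro borel_measurable_diff W)
    show "distr M borel (\<lambda>\<omega>. W (t (Suc i)) \<omega> - W (t i) \<omega>) = \<nu> (t i) (t (Suc i))" if "i < n" for i
      by (rule indep_vars_of_distr_eq_PiM(2)[OF _ p \<nu>_sets joint]) (use that in \<open>auto intro!: borel_measurable_diff W\<close>)
  qed
  interpret V: stochastically_continuous_additive M V
  proof unfold_locales
    fix K e :: real assume e: "e > 0"
    obtain C where C: "\<And>t. 0 \<le> t \<Longrightarrow> t \<le> K \<Longrightarrow> norm (R t) \<le> C" using R_bound[of K] by blast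
    \<comment> \<open>The maximum with 0 covers \<open>K < 0\<close>, where no time is bounded and
      \<open>C\<close> may be negative.\<close>
    obtain h where h: "h > 0" "\<And>t. 0 \<le> t \<Longrightarrow> t \<le> h \<Longrightarrow> (\<integral>x. min 1 (max 0 C * norm x) \<partial>\<rho> t) \<le> e"
      using small_time[of "max 0 C" e] e by auto
    show "\<exists>h>0. \<forall>s t. 0 \<le> s \<and> s \<le> t \<and> t \<le> K \<and> t - s \<le> h \<longrightarrow> (\<integral>\<omega>. min 1 (norm (V t \<omega> - V s \<omega>)) \<partial>M) \<le> e"
    proof (intro exI[of _ h] conjI allI impI)
      fix s t assume *: "0 \<le> s \<and> s \<le> t \<and> t \<le> K \<and> t - s \<le> h"
      show "(\<integral>\<omega>. min 1 (norm (V t \<omega> - V s \<omega>)) \<partial>M) \<le> e"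
      proof (cases "s = t")
        case False
        then have st: "0 \<le> s" "s < t" "0 \<le> t - s" using * by auto
        interpret ts: prob_space "\<rho> (t - s)" using st by (intro prob_\<rho>) simp
        note [measurable_cong] = sets_\<rho>[OF st(3)]
        define \<tau> where "\<tau> i = (if i = 0 then s else t)" for i :: nat
        have "distr M borel (\<lambda>\<omega>. V (\<tau> (Suc 0)) \<omega> - V (\<tau> 0) \<omega>) = \<nu> (\<tau> 0) (\<tau> (Suc 0))"
          by (rule incr_law(2)[of \<tau> 1]) (use st V_meas in \<open>auto simp: \<tau>_def\<close>)
        then have law: "distr M borel (\<lambda>\<omega>. V t \<omega> - V s \<omega>) = \<nu> s t" by (simp add: \<tau>_def)
        have "(\<integral>\<omega>. min 1 (norm (V t \<omega> - V s \<omega>)) \<partial>M) = (\<integral>x. min 1 (norm x) \<partial>\<nu> s t)"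
          unfolding law[symmetric] by (rule Bochner_Integration.integral_distr[symmetric]) measurable
        also have "\<dots> = (\<integral>x. min 1 (norm (R t x)) \<partial>\<rho> (t - s))"
          unfolding \<nu>_def by (rule Bochner_Integration.integral_distr) measurable
        also have "\<dots> \<le> (\<integral>x. min 1 (max 0 C * norm x) \<partial>\<rho> (t - s))"
        proof (rule Bochner_Integration.integral_mono)
          show "integrable (\<rho> (t - s)) (\<lambda>x. min 1 (norm (R t x)))"
            by (rule ts.integrable_const_bound[where B = 1]) auto
          show "integrable (\<rho> (t - s)) (\<lambda>x. min 1 (max 0 C * norm x))"
            by (rule ts.integrable_const_bound[where B = 1]) auto
          have "norm (R t x) \<le> max 0 C * norm x" for x
            by (rule order_trans[OF norm_blinfun mult_right_mono]) (use C[of t] * st in auto)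
          then show "min 1 (norm (R t x)) \<le> min 1 (max 0 C * norm x)" for x by (rule min.mono[OF order_refl])
        qed
        also have "\<dots> \<le> e" using * by (intro h) auto
        finally show ?thesis .
      qed (use e in simp)
    qed (rule h)
  next
    show "indep_vars (\<lambda>_. borel) (\<lambda>i \<omega>. V (t (Suc i)) \<omega> - V (t i) \<omega>) {..<n}"
      if "0 \<le> t 0" "\<And>i. i < n \<Longrightarrow> t i < t (Suc i)" for n t
      by (rule incr_law(1)[OF that]) (auto intro: V_meas)
  qed (simp_all add: V_meas V_0)
  obtain U :: "real \<Rightarrow> (real \<Rightarrow> 'a) \<Rightarrow> 'a"
    where U_meas [measurable]: "\<And>t. U t \<in> borel_measurable M" and U_cadlag: "\<And>\<omega>. cadlag (\<lambda>t. U t \<omega>)"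
    and U_0: "\<And>\<omega>. U 0 \<omega> = 0" and U_V: "\<And>t. 0 \<le> t \<Longrightarrow> AE \<omega> in M. U t \<omega> = V t \<omega>"
    by (rule V.cadlag_modification) blast
  have "\<exists>y. y 0 = 0 \<and> cadlag y \<and> (\<forall>a b. 0 \<le> a \<longrightarrow> a \<le> b \<longrightarrow> has_dy_integral T (\<lambda>t. U t \<omega>) a b (y b - y a)) \<and>
      (\<forall>t\<ge>0. has_dy_integral (\<lambda>s. T (t - s)) y 0 t (T t (U t \<omega>)))" for \<omega>
    by (rule cadlag_integral[of "\<lambda>t. U t \<omega>"]) (auto simp: U_cadlag U_0)
  then obtain Y' where Y': "\<And>\<omega>. Y' \<omega> 0 = 0" "\<And>\<omega>. cadlag (Y' \<omega>)"
      "\<And>\<omega> a b. 0 \<le> a \<Longrightarrow> a \<le> b \<Longrightarrow> has_dy_integral T (\<lambda>t. U t \<omega>) a b (Y' \<omega> b - Y' \<omega> a)"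
      "\<And>\<omega> t. 0 \<le> t \<Longrightarrow> has_dy_integral (\<lambda>s. T (t - s)) (Y' \<omega>) 0 t (T t (U t \<omega>))"
    by metis
  define Y where "Y t \<omega> = Y' \<omega> t" for t \<omega>
  \<comment> \<open>Riemann sums for the integral of \<open>T\<close> against \<open>U\<close>, over
    m + 1 equal cells so that the partition is never empty.\<close>
  define S where "S m a b \<omega> = (\<Sum>i<Suc m. T (a + real i * ((b - a) / real (Suc m)))
      (U (a + real (Suc i) * ((b - a) / real (Suc m))) \<omega> - U (a + real i * ((b - a) / real (Suc m))) \<omega>))"
    for m a b \<omega>
  have S_meas [measurable]: "S m a b \<in> borel_measurable M" for m a b
    unfolding S_def by measurable
  have S_lim: "(\<lambda>m. S m a b \<omega>) \<longlonglongrightarrow> Y b \<omega> - Y a \<omega>" if "0 \<le> a" "a < b" for a b \<omega>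
    using has_dy_integral_uniform_limit[OF Y'(3)[of a b \<omega>]] that by (simp add: S_def dy_sum_def Y_def)
  have Y_meas [measurable]: "Y t \<in> borel_measurable M" if "0 \<le> t" for t
  proof (cases "t = 0")
    case True
    then show ?thesis by (simp add: Y_def[abs_def] Y'(1))
  next
    case False
    have "(\<lambda>m. S m 0 t \<omega>) \<longlonglongrightarrow> Y t \<omega>" for \<omega>
      using S_lim[of 0 t \<omega>] that False by (simp add: Y_def Y'(1))
    then show ?thesis by (intro borel_measurable_LIMSEQ_metric[OF S_meas])
  qed
  \<comment> \<open>All intervals are cut into the same number of cells; the fine increments of
    \<open>U\<close> form one independent family, of which each \<open>S\<close> uses its own
    block.\<close>
  have S_indep: "indep_vars (\<lambda>_. borel) (\<lambda>i. S m (t i) (t (Suc i))) {..<n}"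
    if t: "0 \<le> t 0" "\<And>i. i < n \<Longrightarrow> t i < t (Suc i)" for m n t
  proof -
    define N where "N = Suc m"
    have N: "N > 0" by (simp add: N_def)
    define p where "p i j = t i + real j * ((t (Suc i) - t i) / real N)" for i j
    \<comment> \<open>Consecutive numbering of all cells: \<open>i * N + j\<close> is cell
      \<open>j\<close> of interval \<open>i\<close>, and \<open>p_N\<close> says that the end of one
      interval is the start of the next.\<close>
    define \<tau> where "\<tau> k = p (k div N) (k mod N)" for k
    have p_N: "p i N = p (Suc i) 0" for i using N by (simp add: p_def)
    have \<tau>: "\<tau> (i * N + j) = p i j" if "j \<le> N" for i j
      using that N p_N[of i] by (cases "j = N") (auto simp: \<tau>_def)
    have p_Suc: "p i j < p i (Suc j)" if "i < n" for i j
      using t(2)[OF that] N by (simp add: p_def divide_strict_right_mono mult_strict_right_mono)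
    have \<tau>_step: "\<tau> k < \<tau> (Suc k)" if k: "k < n * N" for k
    proof -
      define i j where "i = k div N" and "j = k mod N"
      have ij: "k = i * N + j" "j < N" "i < n"
        using N k by (auto simp: i_def j_def less_mult_imp_div_less)
      have "\<tau> (Suc k) = p i (Suc j)" using \<tau>[of "Suc j" i] ij by simp
      moreover have "\<tau> k = p i j" using \<tau>[of j i] ij by simp
      ultimately show ?thesis using p_Suc[OF ij(3)] by simp
    qed
    have "0 \<le> \<tau> 0" using t(1) by (simp add: \<tau>_def p_def)
    then have indep: "indep_vars (\<lambda>_. borel) (\<lambda>k \<omega>. U (\<tau> (Suc k)) \<omega> - U (\<tau> k) \<omega>) {..<n * N}"
      by (rule incr_law(1)[of \<tau> "n * N" U, OF _ \<tau>_step U_meas U_V])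
    define K where "K i = {i * N ..< Suc i * N}" for i
    have "indep_vars (\<lambda>i. PiM (K i) (\<lambda>_. borel)) (\<lambda>i \<omega>. restrict (\<lambda>k. U (\<tau> (Suc k)) \<omega> - U (\<tau> k) \<omega>) (K i)) {..<n}"
    proof (rule indep_vars_restrict[OF indep])
      show "K i \<subseteq> {..<n * N}" if "i \<in> {..<n}" for i
      proof -
        have "Suc i * N \<le> n * N" using that by (intro mult_right_mono) auto
        then show ?thesis by (auto simp: K_def)
      qed
      have "K i \<inter> K j = {}" if "i < j" for i j
      proof -
        have "Suc i * N \<le> j * N" using that by (intro mult_right_mono) auto
        then show ?thesis by (auto simp: K_def)
      qed
      then show "disjoint_family_on K {..<n}"
        unfolding disjoint_family_on_def by (metis Int_commute linorder_neqE_nat)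
    qed
    then have "indep_vars (\<lambda>_. borel) (\<lambda>i \<omega>. \<Sum>j<N. T (p i j) (restrict (\<lambda>k. U (\<tau> (Suc k)) \<omega> - U (\<tau> k) \<omega>) (K i) (i * N + j))) {..<n}"
    proof (rule indep_vars_compose2)
      fix i
      show "(\<lambda>x. \<Sum>j<N. T (p i j) (x (i * N + j))) \<in> borel_measurable (PiM (K i) (\<lambda>_. borel))"
      proof (rule borel_measurable_sum)
        fix j assume "j \<in> {..<N}"
        then have "(\<lambda>x. x (i * N + j)) \<in> PiM (K i) (\<lambda>_. borel :: 'a measure) \<rightarrow>\<^sub>M borel"
          by (intro measurable_component_singleton) (simp add: K_def)
        then show "(\<lambda>x. T (p i j) (x (i * N + j))) \<in> borel_measurable (PiM (K i) (\<lambda>_. borel))"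
          by (rule measurable_compose) (rule borel_measurable_blinfun_apply)
      qed
    qed
    moreover have "(\<Sum>j<N. T (p i j) (restrict (\<lambda>k. U (\<tau> (Suc k)) \<omega> - U (\<tau> k) \<omega>) (K i) (i * N + j))) = S m (t i) (t (Suc i)) \<omega>" for i \<omega>
      unfolding S_def N_def[symmetric]
    proof (rule sum.cong)
      fix j assume "j \<in> {..<N}"
      then have j: "j < N" by simp
      have "\<tau> (Suc (i * N + j)) = p i (Suc j)" "\<tau> (i * N + j) = p i j" using \<tau>[of "Suc j" i] \<tau>[of j i] j by simp_all
      then show "T (p i j) (restrict (\<lambda>k. U (\<tau> (Suc k)) \<omega> - U (\<tau> k) \<omega>) (K i) (i * N + j))
          = T (t i + real j * ((t (Suc i) - t i) / real N))
             (U (t i + real (Suc j) * ((t (Suc i) - t i) / real N)) \<omega> - U (t i + real j * ((t (Suc i) - t i) / real N)) \<omega>)"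
        using j by (simp add: K_def p_def)
    qed simp
    ultimately show ?thesis by simp
  qed
  have S_law: "distr M borel (S m a (a + h)) = distr M borel (S m 0 h)" if "0 \<le> a" "0 < h" for m a h
  proof -
    define \<delta> where "\<delta> = h / real (Suc m)"
    have \<delta>: "\<delta> > 0" using that by (simp add: \<delta>_def)
    \<comment> \<open>The right-hand side no longer contains \<open>a\<close>.\<close>
    have law: "distr M borel (S m a (a + h))
        = distr (PiM {..<Suc m} (\<lambda>_. distr (\<rho> \<delta>) borel (R \<delta>))) borel (\<lambda>x. \<Sum>i<Suc m. x i)" if a: "0 \<le> a" for a
    proof -
      define \<tau> where "\<tau> i = a + real i * \<delta>" for i
      have \<tau>: "0 \<le> \<tau> 0" "\<And>i. \<tau> i < \<tau> (Suc i)" "\<And>i. \<tau> (Suc i) = \<tau> i + \<delta>" "\<And>i. 0 \<le> \<tau> i"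
        using a \<delta> by (auto simp: \<tau>_def algebra_simps)
      define Z where "Z i \<omega> = T (\<tau> i) (U (\<tau> (Suc i)) \<omega> - U (\<tau> i) \<omega>)" for i \<omega>
      have incr: "indep_vars (\<lambda>_. borel) (\<lambda>i \<omega>. U (\<tau> (Suc i)) \<omega> - U (\<tau> i) \<omega>) {..<Suc m}"
        "\<And>i. i < Suc m \<Longrightarrow> distr M borel (\<lambda>\<omega>. U (\<tau> (Suc i)) \<omega> - U (\<tau> i) \<omega>) = \<nu> (\<tau> i) (\<tau> (Suc i))"
        using incr_law[of \<tau> "Suc m" U, OF \<tau>(1,2) U_meas U_V] by blast+
      have Z_indep: "indep_vars (\<lambda>_. borel) Z {..<Suc m}"
        unfolding Z_def by (rule indep_vars_compose2[OF incr(1)]) (rule borel_measurable_blinfun_apply)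
      have Z_law: "distr M borel (Z i) = distr (\<rho> \<delta>) borel (R \<delta>)" if "i \<in> {..<Suc m}" for i
      proof -
        have "distr M borel (Z i) = distr (distr M borel (\<lambda>\<omega>. U (\<tau> (Suc i)) \<omega> - U (\<tau> i) \<omega>)) borel (T (\<tau> i))"
          by (subst distr_distr) (auto simp: comp_def Z_def[abs_def] intro!: borel_measurable_blinfun_apply)
        also have "\<dots> = distr (distr (\<rho> (\<tau> (Suc i) - \<tau> i)) borel (R (\<tau> (Suc i)))) borel (T (\<tau> i))"
          using that by (subst incr(2)) (auto simp: \<nu>_def)
        also have "\<dots> = distr (\<rho> \<delta>) borel (T (\<tau> i) \<circ> R (\<tau> i + \<delta>))"
          unfolding \<tau>(3) using \<delta> by (subst distr_distr) (auto simp: measurable_\<rho> intro!: borel_measurable_blinfun_apply)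
        \<comment> \<open>Evaluating \<open>T\<close> at the left end point cancels all of the
          inverse except the cell length \<delta>.\<close>
        also have "T (\<tau> i) \<circ> R (\<tau> i + \<delta>) = R \<delta>"
          using RT_add(2)[of \<delta> "\<tau> i"] \<delta> \<tau>(4) by (auto simp: fun_eq_iff)
        finally show ?thesis .
      qed
      have Z_meas [measurable]: "Z i \<in> borel_measurable M" for i unfolding Z_def by measurable
      have "S m a (a + h) = (\<lambda>x. \<Sum>i<Suc m. x i) \<circ> (\<lambda>\<omega>. \<lambda>i\<in>{..<Suc m}. Z i \<omega>)"
        by (auto simp: S_def Z_def \<tau>_def \<delta>_def fun_eq_iff simp del: sum.lessThan_Suc)
      then have "distr M borel (S m a (a + h))
          = distr (distr M (PiM {..<Suc m} (\<lambda>_. borel)) (\<lambda>\<omega>. \<lambda>i\<in>{..<Suc m}. Z i \<omega>)) borel (\<lambda>x. \<Sum>i<Suc m. x i)"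
        by (subst distr_distr) (auto intro!: borel_measurable_sum measurable_component_singleton measurable_restrict simp del: sum.lessThan_Suc)
      also have "distr M (PiM {..<Suc m} (\<lambda>_. borel)) (\<lambda>\<omega>. \<lambda>i\<in>{..<Suc m}. Z i \<omega>) = PiM {..<Suc m} (\<lambda>_. distr (\<rho> \<delta>) borel (R \<delta>))"
        by (rule distr_eq_PiM_of_indep_vars[OF _ Z_indep Z_law]) auto
      finally show ?thesis .
    qed
    show ?thesis using law[OF that(1)] law[of 0] by simp
  qed
  \<comment> \<open>Equality of the laws of the Riemann sums passes to the limit through integrals
    of bounded continuous functions.\<close>
  have Y_stationary: "distr M borel (\<lambda>\<omega>. Y (s + h) \<omega> - Y s \<omega>) = distr M borel (\<lambda>\<omega>. Y h \<omega> - Y 0 \<omega>)"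
    if "0 \<le> s" "0 \<le> h" for s h
  proof (cases "h = 0")
    case False
    then have h: "0 < h" using that by simp
    have [measurable]: "Y (s + h) \<in> borel_measurable M" "Y s \<in> borel_measurable M" "Y h \<in> borel_measurable M" "Y 0 \<in> borel_measurable M"
      using that by auto
    show ?thesis
    proof (rule prob_eqI_bcontfun)
      fix f :: "'a \<Rightarrow>\<^sub>C real"
      have lim: "(\<lambda>m. \<integral>x. f x \<partial>distr M borel (S m a (a + h))) \<longlonglongrightarrow> (\<integral>x. f x \<partial>distr M borel (\<lambda>\<omega>. Y (a + h) \<omega> - Y a \<omega>))"
        if a: "0 \<le> a" for a
      proof -
        have [measurable]: "Y (a + h) \<in> borel_measurable M" "Y a \<in> borel_measurable M" using a h by auto
        have "(\<lambda>m. \<integral>\<omega>. f (S m a (a + h) \<omega>) \<partial>M) \<longlonglongrightarrow> (\<integral>\<omega>. f (Y (a + h) \<omega> - Y a \<omega>) \<partial>M)"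
        proof (rule integral_dominated_convergence[where w = "\<lambda>_. norm f"])
          show "AE \<omega> in M. (\<lambda>m. f (S m a (a + h) \<omega>)) \<longlonglongrightarrow> f (Y (a + h) \<omega> - Y a \<omega>)"
          proof (rule AE_I2)
            fix \<omega>
            have "isCont f (Y (a + h) \<omega> - Y a \<omega>)"
              using continuous_on_apply_bcontfun[of UNIV f]
              by (simp add: continuous_on_eq_continuous_at del: continuous_on_apply_bcontfun)
            then show "(\<lambda>m. f (S m a (a + h) \<omega>)) \<longlonglongrightarrow> f (Y (a + h) \<omega> - Y a \<omega>)"
              by (rule isCont_tendsto_compose) (rule S_lim, use a h in auto)
          qed
        qed (use norm_bounded[of f] in auto)
        then show ?thesis by (simp add: Bochner_Integration.integral_distr)
      qed
      show "(\<integral>x. f x \<partial>distr M borel (\<lambda>\<omega>. Y (s + h) \<omega> - Y s \<omega>)) = (\<integral>x. f x \<partial>distr M borel (\<lambda>\<omega>. Y h \<omega> - Y 0 \<omega>))"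
        using LIMSEQ_unique[OF lim[OF that(1)]] lim[of 0] S_law[OF that(1) h] by simp
    qed (auto intro!: prob_space_distr)
  qed simp
  have levy: "levy_process M Y"
    unfolding levy_process_def
  proof (intro conjI allI ballI impI)
    show "prob_space M" by (rule M)
    show "Y t \<in> borel_measurable M" if "0 \<le> t" for t using that by (rule Y_meas)
    show "Y 0 \<omega> = 0" for \<omega> by (simp add: Y_def Y')
    show "cadlag (\<lambda>t. Y t \<omega>)" for \<omega> by (simp add: Y_def Y')
    show "distr M borel (\<lambda>\<omega>. Y (s + h) \<omega> - Y s \<omega>) = distr M borel (\<lambda>\<omega>. Y h \<omega> - Y 0 \<omega>)"
      if "0 \<le> s" "0 \<le> h" for s h using that by (rule Y_stationary)
    fix n and t :: "nat \<Rightarrow> real" assume t: "0 \<le> t 0 \<and> (\<forall>i<n. t i < t (Suc i))"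
    show "indep_vars (\<lambda>_. borel) (\<lambda>i \<omega>. Y (t (Suc i)) \<omega> - Y (t i) \<omega>) {..<n}"
    proof (rule indep_vars_limit)
      show "indep_vars (\<lambda>_. borel) (\<lambda>i. S m (t i) (t (Suc i))) {..<n}" for m
        using t by (intro S_indep) auto
      fix i \<omega> assume i: "i \<in> {..<n}"
      have "0 \<le> t j" if "j \<le> n" for j
        using that
      proof (induction j)
        case (Suc j)
        then show ?case using t by (meson Suc_le_eq Suc_leD less_imp_le order_trans)
      qed (use t in simp)
      then show "(\<lambda>m. S m (t i) (t (Suc i)) \<omega>) \<longlonglongrightarrow> Y (t (Suc i)) \<omega> - Y (t i) \<omega>"
        using t i by (intro S_lim) auto
    qed simp
  qed
  have X_law: "distr M borel (\<lambda>\<omega>. T t (U t \<omega>)) = \<rho> t" if t: "0 \<le> t" for t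
  \<comment> \<open>The increment law is available over intervals of positive length; at t = 0 the
    claim is that \<open>\<rho> 0\<close> is the point mass at 0.\<close>
  proof (cases "t = 0")
    case True
    show ?thesis
    proof (rule prob_eqI_bcontfun)
      fix f :: "'a \<Rightarrow>\<^sub>C real"
      interpret \<rho>0: prob_space "\<rho> 0" by (rule prob_\<rho>) simp
      have "(\<integral>x. f x \<partial>\<rho> 0) = (\<integral>x. f 0 \<partial>\<rho> 0)"
      proof (rule integral_cong_AE)
        show "AE x in \<rho> 0. f x = f 0" using \<rho>_0 by eventually_elim simp
        show "apply_bcontfun f \<in> borel_measurable (\<rho> 0)" by (simp add: measurable_\<rho>)
      qed simp
      moreover have "(\<integral>x. f x \<partial>distr M borel (\<lambda>\<omega>. T t (U t \<omega>))) = (\<integral>\<omega>. f (T t (U t \<omega>)) \<partial>M)"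
        by (rule Bochner_Integration.integral_distr) measurable
      ultimately show "(\<integral>x. f x \<partial>distr M borel (\<lambda>\<omega>. T t (U t \<omega>))) = (\<integral>x. f x \<partial>\<rho> t)"
        by (simp add: True U_0 T_0 prob_space \<rho>0.prob_space)
    qed (use t in \<open>auto intro!: prob_space_distr prob_\<rho> sets_\<rho>\<close>)
  next
    case False
    define \<tau> where "\<tau> i = (if i = 0 then 0 else t)" for i :: nat
    have "distr M borel (\<lambda>\<omega>. U (\<tau> (Suc 0)) \<omega> - U (\<tau> 0) \<omega>) = \<nu> (\<tau> 0) (\<tau> (Suc 0))"
      by (rule incr_law(2)[of \<tau> 1]) (use t False U_meas U_V in \<open>auto simp: \<tau>_def\<close>)
    then have law: "distr M borel (U t) = distr (\<rho> t) borel (R t)" by (simp add: \<tau>_def U_0 \<nu>_def)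
    have "distr M borel (\<lambda>\<omega>. T t (U t \<omega>)) = distr (distr M borel (U t)) borel (T t)"
      by (subst distr_distr) (auto simp: comp_def intro!: borel_measurable_blinfun_apply)
    also have "\<dots> = distr (\<rho> t) borel (T t \<circ> R t)"
      unfolding law using t by (subst distr_distr) (auto simp: measurable_\<rho> intro!: borel_measurable_blinfun_apply)
    also have "\<dots> = distr (\<rho> t) (\<rho> t) (\<lambda>x. x)"
      using t by (intro distr_cong) (auto simp: TR sets_\<rho>)
    also have "\<dots> = \<rho> t" by (rule distr_id)
    finally show ?thesis .
  qed
  have "mehler_representation T P M Y"
    unfolding mehler_representation_def
  proof (intro allI impI conjI ballI)
    fix t :: real assume t: "0 \<le> t"
    have int: "has_dy_integral (\<lambda>s. T (t - s)) (\<lambda>s. Y s \<omega>) 0 t (T t (U t \<omega>))" for \<omega>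
      using Y'(4)[OF t] by (simp add: Y_def)
    note ri = random_integral_eq[where Y = Y, OF t int]
    show "dg_integrable (\<lambda>s. T (t - s)) (\<lambda>s. Y s \<omega>) 0 t" for \<omega> by (rule ri(2))
    fix f :: "'a \<Rightarrow>\<^sub>C real" and x
    have X [measurable]: "(\<lambda>\<omega>. T t (U t \<omega>)) \<in> borel_measurable M" by measurable
    show "integrable M (\<lambda>\<omega>. f (T t x + random_integral (\<lambda>s. T (t - s)) Y 0 t \<omega>))"
      unfolding ri(1) by (rule integrable_bcontfun) measurable
    have "P t f x = (\<integral>y. f (T t x + y) \<partial>distr M borel (\<lambda>\<omega>. T t (U t \<omega>)))"
      unfolding X_law[OF t] using t by (rule P_eq)
    also have "\<dots> = (\<integral>\<omega>. f (T t x + T t (U t \<omega>)) \<partial>M)"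
      by (rule Bochner_Integration.integral_distr) measurable
    finally show "P t f x = (\<integral>\<omega>. f (T t x + random_integral (\<lambda>s. T (t - s)) Y 0 t \<omega>) \<partial>M)"
      unfolding ri(1) .
  qed
  with levy show ?thesis by blast
qed

end

lemma uniformly_continuous_mehlerI:
  fixes T :: "real \<Rightarrow> 'a::{banach, second_countable_topology} \<Rightarrow>\<^sub>L 'a"
  assumes "generalized_mehler_semigroup T \<rho> P" "weakly_continuous_at_zero \<rho>"
    and "(T \<longlongrightarrow> id_blinfun) (at_right 0)"
  shows "uniformly_continuous_mehler T \<rho> P"
proof unfold_locales
  have C0: "C0_semigroup T" using assms(1) by (simp add: generalized_mehler_semigroup_def)
  show "T 0 = id_blinfun" using C0 by (simp add: C0_semigroup_def)
  show "T t o\<^sub>L T s = T (t + s)" if "0 \<le> s" "0 \<le> t" for s t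
    using C0 that by (simp add: C0_semigroup_def)
qed (rule assms)+

theorem corollary3:
  shows
    "(\<forall>(T :: real \<Rightarrow> (real ^ 'd) \<Rightarrow>\<^sub>L (real ^ 'd)) \<rho> P.
        generalized_mehler_semigroup T \<rho> P \<and> weakly_continuous_at_zero \<rho> \<longrightarrow>
        (\<exists>(M :: (real \<Rightarrow> real ^ 'd) measure) Y.
           levy_process M Y \<and> mehler_representation T P M Y))
     \<and>
     (\<forall>(Q :: 'e::{banach, second_countable_topology} \<Rightarrow>\<^sub>L 'e) T \<rho> P.
        (\<forall>t\<ge>0. T t = blinfun_exp (t *\<^sub>R Q)) \<and>
        generalized_mehler_semigroup T \<rho> P \<and> weakly_continuous_at_zero \<rho> \<longrightarrow>
        (\<exists>(M :: (real \<Rightarrow> 'e) measure) Y.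
           levy_process M Y \<and> mehler_representation T P M Y))"
proof (intro conjI allI impI)
  fix T :: "real \<Rightarrow> (real ^ 'd) \<Rightarrow>\<^sub>L (real ^ 'd)" and \<rho> P
  assume *: "generalized_mehler_semigroup T \<rho> P \<and> weakly_continuous_at_zero \<rho>"
  then have "(T \<longlongrightarrow> id_blinfun) (at_right 0)"
    by (intro C0_semigroup_euclidean_tendsto) (simp add: generalized_mehler_semigroup_def)
  then show "\<exists>(M :: (real \<Rightarrow> real ^ 'd) measure) Y. levy_process M Y \<and> mehler_representation T P M Y"
    using * by (intro uniformly_continuous_mehler.mehler_levy_representation uniformly_continuous_mehlerI) auto
next
  fix Q :: "'e \<Rightarrow>\<^sub>L 'e" and T \<rho> P
  assume *: "(\<forall>t\<ge>0. T t = blinfun_exp (t *\<^sub>R Q)) \<and> generalized_mehler_semigroup T \<rho> P \<and> weakly_continuous_at_zero \<rho>"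
  \<comment> \<open>\<open>T\<close> is tied to the exponential only for t \<ge> 0, which is all
    that a right limit at 0 sees.\<close>
  have "\<forall>\<^sub>F t in at_right 0. blinfun_exp (t *\<^sub>R Q) = T t"
    using * by (auto simp: eventually_at_right_field intro: exI[of _ 1])
  then have "(T \<longlongrightarrow> id_blinfun) (at_right 0)"
    by (rule Lim_transform_eventually[OF blinfun_exp_tendsto_id])
  then show "\<exists>(M :: (real \<Rightarrow> 'e) measure) Y. levy_process M Y \<and> mehler_representation T P M Y"
    using * by (intro uniformly_continuous_mehler.mehler_levy_representation uniformly_continuous_mehlerI) auto
qed

end
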